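(* Let $G$ and $H$ be maximally almost periodic locally compact groups such that $H$ is $\sigma$-compact, and such that either $G$ is $\sigma$-compact, or $G$ respects compactness and $G^b$ is realcompact. Let $T: AP(G)\to AP(H)$ be a non-vanishing linear isometry (not assumed surjective) that respects finite-dimensional unitary representations. Then there exist a closed subgroup $H_0\subseteq H$, a continuous group homomorphism $t$ of $H_0$ onto $G$, and an element $\gamma\in\widehat{H}$ such that $$(Tf)(h)=\gamma(h)\, f(t(h))\quad\text{for all } h\in H_0 \text{ and all } f\in AP(G).$$
   Context: All groups are Hausdorff topological groups. For a topological group $G$, the Bohr compactification is a compact group $bG$ together with a continuous homomorphism $b:G\to bG$ with dense image such that every continuous homomorphism $h$ from $G$ into a compact group $K$ factors as $h=\overline{h}\circ b$ with $\overline{h}:bG\to K$ a continuous homomorphism. $AP(G)$ denotes the set of almost periodic functions on $G$: continuous functions $f:G\to\mathbb{C}$ such that for every $\epsilon>0$ there is a finite decomposition $G=\bigcup_{i=1}^n G_i$ with $|f(zxw)-f(zyw)|<\epsilon$ for all $z,w\in G$ and all $x,y\in G_i$, $i=1,\dots,n$. Equivalently, $AP(G)=\{F\circ b: F\in C(bG)\}$, where $C(\cdot)$ denotes continuous complex-valued functions. $AP(G)$ carries the supremum norm. $G$ is maximally almost periodic if $b:G\to bG$ is injective (equivalently, its finite-dimensional continuous unitary representations separate points). $G^b$ denotes the group $G$ with the topology inherited from $bG$ (the Bohr topology). $G$ respects compactness if every subset of $G$ that is compact in the Bohr topology is also compact in the original topology of $G$. $\widehat{H}$ is the group of continuous homomorphisms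 from $H$ into the unit circle $\mathbb{T}$. For $n\ge 1$, $\mathcal{U}(n)$ is the group of unitary complex $n\times n$ matrices and $Rep_n(G)$ is the set of continuous homomorphisms $G\to\mathcal{U}(n)$. A linear map $T:AP(G)\to AP(H)$ respects finite-dimensional unitary representations if for every $n$ and every $D=(d_{jk})_{j,k=1}^n\in Rep_n(G)$, the matrix $T(D)=(T(d_{jk}))_{j,k=1}^n$ belongs to $Rep_n(H)$. $T$ is non-vanishing if for every $f\in AP(G)$: $(Tf)(y)\neq 0$ for all $y\in H$ if and only if $f(x)\ne 0$ for all $x\in G$. *)

theory Defs
  imports
    "HOL-Analysis.Analysis"
    "HOL-Algebra.Product_Groups"
    "Jordan_Normal_Form.Schur_Decomposition"
begin

no_notation eq_closure_of ("closure'_of\<index>")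

section \<open>Topological groups\<close>

record 'a topgroup = "'a monoid" +
  topo :: "'a topology"

locale topological_group = group G for G :: "'a topgroup" (structure) +
  assumes topspace_topo: "topspace (topo G) = carrier G"
    and Hausdorff: "Hausdorff_space (topo G)"
    and continuous_mult:
      "continuous_map (prod_topology (topo G) (topo G)) (topo G) (\<lambda>(x, y). x \<otimes> y)"
    and continuous_inv: "continuous_map (topo G) (topo G) (\<lambda>x. inv x)"

definition compact_group :: "'a topgroup \<Rightarrow> bool" where
  "compact_group K \<longleftrightarrow> topological_group K \<and> compact_space (topo K)"

definition cont_hom :: "'a topgroup \<Rightarrow> 'b topgroup \<Rightarrow> ('a \<Rightarrow> 'b) set" where
  "cont_hom G K = {h \<in> hom G K. continuous_map (topo G) (topo K) h}"

definition topsubgroup :: "'a topgroup \<Rightarrow> 'a set \<Rightarrow> 'a topgroup" where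
  "topsubgroup G S = G\<lparr>carrier := S, topo := subtopology (topo G) S\<rparr>"

definition sigma_compact_space :: "'a topology \<Rightarrow> bool" where
  "sigma_compact_space X \<longleftrightarrow>
     (\<exists>C :: nat \<Rightarrow> 'a set. (\<forall>n. compactin X (C n)) \<and> topspace X = (\<Union>n. C n))"

text \<open>A realcompact space is a space homeomorphic to a closed subspace of a power of the real
  line. The index set of the power may be taken among the real-valued functions on the space: if
  the space embeds as a closed subspace of some power, then it does so by evaluation at all
  its continuous real-valued functions. The empty power is a one-point space.\<close>

definition realcompact_space :: "'a topology \<Rightarrow> bool" where
  "realcompact_space X \<longleftrightarrow>
     (\<exists>(I :: ('a \<Rightarrow> real) set) S.
        closedin (product_topology (\<lambda>_. euclideanreal) I) S \<and>
        X homeomorphic_space subtopology (product_topology (\<lambda>_. euclideanreal) I) S)"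

section \<open>The Bohr compactification\<close>

text \<open>The compact groups in the universal property have their carriers in the type
  \<open>'g set set\<close>. This is no restriction: the lemma \<open>bohr_universal\<close> below derives the universal
  property for compact groups over every type. The lemma \<open>bohr_exists\<close> shows that a Bohr
  compactification exists over the type \<open>'g set set\<close>.\<close>

definition is_bohr_compactification ::
  "'g topgroup \<Rightarrow> 'b topgroup \<Rightarrow> ('g \<Rightarrow> 'b) \<Rightarrow> bool" where
  "is_bohr_compactification G B b \<longleftrightarrow>
     compact_group B \<and> b \<in> cont_hom G B \<and>
     topo B closure_of (b ` carrier G) = carrier B \<and>
     (\<forall>(K :: 'g set set topgroup) h. compact_group K \<longrightarrow> h \<in> cont_hom G K \<longrightarrow>
        (\<exists>h' \<in> cont_hom B K. \<forall>x \<in> carrier G. h x = h' (b x)))"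

text \<open>The Bohr compactification is unique up to isomorphism (see \<open>bohr_topology_unique\<close>), so the
  choice made here is immaterial.\<close>

definition bohr :: "'g topgroup \<Rightarrow> 'g set set topgroup \<times> ('g \<Rightarrow> 'g set set)" where
  "bohr G = (SOME (B, b). is_bohr_compactification G B b)"

definition bohr_group :: "'g topgroup \<Rightarrow> 'g set set topgroup" where
  "bohr_group G = fst (bohr G)"

definition bohr_map :: "'g topgroup \<Rightarrow> 'g \<Rightarrow> 'g set set" where
  "bohr_map G = snd (bohr G)"

definition bohr_topology :: "'g topgroup \<Rightarrow> 'g topology" where
  "bohr_topology G = pullback_topology (carrier G) (bohr_map G) (topo (bohr_group G))"

definition maximally_almost_periodic :: "'g topgroup \<Rightarrow> bool" where
  "maximally_almost_periodic G \<longleftrightarrow> inj_on (bohr_map G) (carrier G)"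

definition respects_compactness :: "'g topgroup \<Rightarrow> bool" where
  "respects_compactness G \<longleftrightarrow>
     (\<forall>S. compactin (bohr_topology G) S \<longrightarrow> compactin (topo G) S)"

section \<open>Almost periodic functions and representations\<close>

text \<open>Functions on the carrier are represented by their extensional extensions to the type, so
  that equality of functions on the carrier is equality of elements of \<open>AP\<close>.\<close>

definition AP :: "'g topgroup \<Rightarrow> ('g \<Rightarrow> complex) set" where
  "AP G = {f \<in> extensional (carrier G). continuous_map (topo G) euclidean f \<and>
     (\<forall>\<epsilon>>0. \<exists>\<P>. finite \<P> \<and> \<Union>\<P> = carrier G \<and>
        (\<forall>P\<in>\<P>. \<forall>x\<in>P. \<forall>y\<in>P. \<forall>z\<in>carrier G. \<forall>w\<in>carrier G.
           cmod (f (z \<otimes>\<^bsub>G\<^esub> x \<otimes>\<^bsub>G\<^esub> w) - f (z \<otimes>\<^bsub>G\<^esub> y \<otimes>\<^bsub>G\<^esub> w)) < \<epsilon>))}"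

definition sup_norm :: "'g topgroup \<Rightarrow> ('g \<Rightarrow> complex) \<Rightarrow> real" where
  "sup_norm G f = (SUP x\<in>carrier G. cmod (f x))"

definition AP_linear ::
  "'g topgroup \<Rightarrow> 'h topgroup \<Rightarrow> (('g \<Rightarrow> complex) \<Rightarrow> 'h \<Rightarrow> complex) \<Rightarrow> bool" where
  "AP_linear G H T \<longleftrightarrow> T \<in> AP G \<rightarrow> AP H \<and>
     (\<forall>f\<in>AP G. \<forall>g\<in>AP G.
        T (\<lambda>x\<in>carrier G. f x + g x) = (\<lambda>y\<in>carrier H. T f y + T g y)) \<and>
     (\<forall>c. \<forall>f\<in>AP G. T (\<lambda>x\<in>carrier G. c * f x) = (\<lambda>y\<in>carrier H. c * T f y))"

definition AP_isometry ::
  "'g topgroup \<Rightarrow> 'h topgroup \<Rightarrow> (('g \<Rightarrow> complex) \<Rightarrow> 'h \<Rightarrow> complex) \<Rightarrow> bool" where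
  "AP_isometry G H T \<longleftrightarrow>
     (\<forall>f\<in>AP G. \<forall>g\<in>AP G.
        sup_norm H (\<lambda>y. T f y - T g y) = sup_norm G (\<lambda>x. f x - g x))"

definition non_vanishing ::
  "'g topgroup \<Rightarrow> 'h topgroup \<Rightarrow> (('g \<Rightarrow> complex) \<Rightarrow> 'h \<Rightarrow> complex) \<Rightarrow> bool" where
  "non_vanishing G H T \<longleftrightarrow>
     (\<forall>f\<in>AP G. (\<forall>y\<in>carrier H. T f y \<noteq> 0) \<longleftrightarrow> (\<forall>x\<in>carrier G. f x \<noteq> 0))"

definition circle_group :: "complex topgroup" where
  "circle_group = \<lparr>carrier = sphere 0 1, mult = (*), one = 1,
     topo = subtopology euclidean (sphere 0 1)\<rparr>"

definition dual_group :: "'g topgroup \<Rightarrow> ('g \<Rightarrow> complex) set" where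
  "dual_group G = cont_hom G circle_group"

definition unitary_mats :: "nat \<Rightarrow> complex mat set" where
  "unitary_mats n =
     {A \<in> carrier_mat n n. A * mat_adjoint A = 1\<^sub>m n \<and> mat_adjoint A * A = 1\<^sub>m n}"

text \<open>The topology of entrywise convergence.\<close>

definition unitary_group :: "nat \<Rightarrow> complex mat topgroup" where
  "unitary_group n = \<lparr>carrier = unitary_mats n, mult = (*), one = 1\<^sub>m n,
     topo = pullback_topology (unitary_mats n)
       (\<lambda>A. \<lambda>p\<in>{..<n} \<times> {..<n}. A $$ p)
       (product_topology (\<lambda>_. euclidean) ({..<n} \<times> {..<n}))\<rparr>"

definition Rep :: "nat \<Rightarrow> 'g topgroup \<Rightarrow> ('g \<Rightarrow> complex mat) set" where
  "Rep n G = cont_hom G (unitary_group n)"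

definition respects_unitary_reps ::
  "'g topgroup \<Rightarrow> 'h topgroup \<Rightarrow> (('g \<Rightarrow> complex) \<Rightarrow> 'h \<Rightarrow> complex) \<Rightarrow> bool" where
  "respects_unitary_reps G H T \<longleftrightarrow>
     (\<forall>n\<ge>1. \<forall>D \<in> Rep n G.
        (\<lambda>y. mat n n (\<lambda>p. T (\<lambda>x\<in>carrier G. D x $$ p) y)) \<in> Rep n H)"

section \<open>Existence and universality of the Bohr compactification\<close>

lemma cont_hom_compose:
  assumes "f \<in> cont_hom G H" "g \<in> cont_hom H K"
  shows "(\<lambda>x. g (f x)) \<in> cont_hom G K"
  using assms continuous_map_compose[of "topo G" "topo H" f "topo K" g]
  by (auto simp: cont_hom_def hom_def o_def Pi_iff)

lemma group_same_operations:
  assumes "group A" and [simp]: "carrier B = carrier A" "mult B = mult A" "one B = one A"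
  shows "group B"
proof -
  interpret A: group A by fact
  show ?thesis
    by (rule groupI) (use A.m_assoc A.l_inv_ex in auto)
qed

lemma topological_group_topsubgroup:
  fixes G (structure)
  assumes G: "topological_group G" and S: "subgroup S G"
  shows "topological_group (topsubgroup G S)"
proof -
  interpret topological_group G by fact
  have sub: "S \<subseteq> carrier G" using S by (rule subgroup.subset)
  have gr: "group (G\<lparr>carrier := S\<rparr>)" using S by (rule subgroup_imp_group)
  have "group (topsubgroup G S)"
    by (rule group_same_operations[OF gr]) (simp_all add: topsubgroup_def)
  then interpret S: group "topsubgroup G S" .
  have iv: "inv\<^bsub>topsubgroup G S\<^esub> x = inv x" if "x \<in> S" for x
  proof (rule S.inv_equality)
    show "inv x \<otimes>\<^bsub>topsubgroup G S\<^esub> x = \<one>\<^bsub>topsubgroup G S\<^esub>"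
      using that sub by (auto simp: topsubgroup_def)
  qed (use that S in \<open>auto simp: topsubgroup_def subgroup.m_inv_closed\<close>)
  show ?thesis
  proof
    show "topspace (topo (topsubgroup G S)) = carrier (topsubgroup G S)"
      using sub topspace_topo by (auto simp: topsubgroup_def)
    show "Hausdorff_space (topo (topsubgroup G S))"
      by (simp add: topsubgroup_def Hausdorff Hausdorff_space_subtopology)
    have "continuous_map (subtopology (prod_topology (topo G) (topo G)) (S \<times> S))
        (subtopology (topo G) S) (\<lambda>(x, y). x \<otimes> y)"
      using continuous_mult S
      by (auto simp: continuous_map_in_subtopology continuous_map_from_subtopology subgroup.m_closed)
    then show "continuous_map (prod_topology (topo (topsubgroup G S)) (topo (topsubgroup G S)))
       (topo (topsubgroup G S)) (\<lambda>(x, y). x \<otimes>\<^bsub>topsubgroup G S\<^esub> y)"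
      by (simp add: topsubgroup_def subtopology_Times)
    have "continuous_map (subtopology (topo G) S) (subtopology (topo G) S) (\<lambda>x. inv x)"
      using continuous_inv S
      by (auto simp: continuous_map_in_subtopology continuous_map_from_subtopology subgroup.m_inv_closed)
    then have "continuous_map (topo (topsubgroup G S)) (topo (topsubgroup G S)) (\<lambda>x. inv x)"
      by (simp add: topsubgroup_def)
    then show "continuous_map (topo (topsubgroup G S)) (topo (topsubgroup G S))
        (\<lambda>x. inv\<^bsub>topsubgroup G S\<^esub> x)"
      by (rule continuous_map_eq) (simp add: topsubgroup_def flip: iv)
  qed
qed

lemma (in topological_group) subgroup_closure:
  assumes S: "subgroup S G"
  shows "subgroup (topo G closure_of S) G"
proof
  have sub: "S \<subseteq> carrier G" using S by (rule subgroup.subset)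
  show "topo G closure_of S \<subseteq> carrier G"
    using closure_of_subset_topspace[of "topo G" S] topspace_topo by simp
  show "\<one> \<in> topo G closure_of S"
    using closure_of_subset[of S "topo G"] sub topspace_topo subgroup.one_closed[OF S] by auto
  fix x y assume x: "x \<in> topo G closure_of S" and y: "y \<in> topo G closure_of S"
  have "(\<lambda>(x, y). x \<otimes> y) ` (S \<times> S) \<subseteq> S" using S by (auto simp: subgroup.m_closed)
  then show "x \<otimes> y \<in> topo G closure_of S"
    using continuous_map_image_closure_subset[OF continuous_mult, of "S \<times> S"] x y
      closure_of_mono[of "(\<lambda>(x, y). x \<otimes> y) ` (S \<times> S)" S "topo G"]
    by (auto simp: closure_of_Times)
next
  fix x assume x: "x \<in> topo G closure_of S"
  have "(\<lambda>x. inv x) ` S \<subseteq> S" using S by (auto simp: subgroup.m_inv_closed)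
  then show "inv x \<in> topo G closure_of S"
    using continuous_map_image_closure_subset[OF continuous_inv, of S] x
      closure_of_mono[of _ S "topo G"] by blast
qed

definition transport :: "('a \<Rightarrow> 'b) \<Rightarrow> 'a topgroup \<Rightarrow> 'b topgroup" where
  "transport e K =
    (let C = carrier K; d = inv_into C e in
     \<lparr>carrier = e ` C, mult = (\<lambda>u v. e (d u \<otimes>\<^bsub>K\<^esub> d v)), one = e \<one>\<^bsub>K\<^esub>,
      topo = pullback_topology (e ` C) d (topo K)\<rparr>)"

lemma transport:
  fixes K (structure)
  assumes K: "topological_group K" and e: "inj_on e (carrier K)"
  shows topological_group_transport: "topological_group (transport e K)"
    and transport_to: "e \<in> cont_hom K (transport e K)"
    and transport_from: "inv_into (carrier K) e \<in> cont_hom (transport e K) K"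
proof -
  interpret topological_group K by fact
  let ?T = "transport e K"
  define d where "d = inv_into (carrier K) e"
  have de [simp]: "d (e x) = x" if "x \<in> carrier K" for x
    using that e by (simp add: d_def)
  have simps [simp]: "carrier ?T = e ` carrier K" "\<one>\<^bsub>?T\<^esub> = e \<one>"
    "u \<otimes>\<^bsub>?T\<^esub> v = e (d u \<otimes> d v)" "topo ?T = pullback_topology (e ` carrier K) d (topo K)" for u v
    by (auto simp: transport_def Let_def d_def)
  have "group ?T"
  proof (rule groupI)
    fix x assume "x \<in> carrier ?T"
    then obtain a where a: "a \<in> carrier K" "x = e a" by auto
    then show "\<exists>y\<in>carrier ?T. y \<otimes>\<^bsub>?T\<^esub> x = \<one>\<^bsub>?T\<^esub>"
      by (intro bexI[of _ "e (inv a)"]) auto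
  qed (auto simp: m_assoc)
  then interpret T: group ?T .
  have iv: "inv\<^bsub>?T\<^esub> (e x) = e (inv x)" if "x \<in> carrier K" for x
    by (rule T.inv_equality) (use that in auto)
  have ts: "topspace (topo ?T) = e ` carrier K"
    by (auto simp: topspace_pullback_topology topspace_topo)
  have cd: "continuous_map (topo ?T) (topo K) d"
    using continuous_map_pullback[OF continuous_map_id, of "e ` carrier K" d "topo K"] by simp
  have ce: "continuous_map X (topo ?T) (\<lambda>x. e (g x))" if "continuous_map X (topo K) g" for X :: "'c topology" and g
  proof -
    have "g x \<in> carrier K" if "x \<in> topspace X" for x
      using that \<open>continuous_map X (topo K) g\<close> topspace_topo by (auto simp: continuous_map_def Pi_iff)
    moreover from this have "continuous_map X (topo K) (d \<circ> (\<lambda>x. e (g x)))"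
      using continuous_map_eq[OF that, of "d \<circ> (\<lambda>x. e (g x))"] by simp
    ultimately show ?thesis
      by (auto intro!: continuous_map_pullback')
  qed
  show "topological_group ?T"
  proof
    show "topspace (topo ?T) = carrier ?T" using ts by simp
    show "Hausdorff_space (topo ?T)"
      by (rule Hausdorff_space_injective_preimage[OF Hausdorff cd])
         (simp only: ts, auto simp: inj_on_def)
    have "continuous_map (prod_topology (topo ?T) (topo ?T)) (prod_topology (topo K) (topo K))
       (\<lambda>(x, y). (d x, d y))"
      using cd by (simp add: continuous_map_prod_top)
    from ce[OF continuous_map_compose[OF this continuous_mult]]
    show "continuous_map (prod_topology (topo ?T) (topo ?T)) (topo ?T) (\<lambda>(x, y). x \<otimes>\<^bsub>?T\<^esub> y)"
      by (simp add: o_def case_prod_unfold)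
    show "continuous_map (topo ?T) (topo ?T) (\<lambda>x. inv\<^bsub>?T\<^esub> x)"
      by (rule continuous_map_eq[OF ce[OF continuous_map_compose[OF cd continuous_inv]]])
         (simp only: ts, auto simp: iv)
  qed
  show "e \<in> cont_hom K ?T"
    using ce[OF continuous_map_id] by (auto simp: cont_hom_def hom_def)
  show "inv_into (carrier K) e \<in> cont_hom ?T K"
    unfolding d_def[symmetric] using cd by (auto simp: cont_hom_def hom_def)
qed

lemma compact_group_transport:
  assumes "compact_group K" "inj_on e (carrier K)"
  shows "compact_group (transport e K)"
proof -
  have K: "topological_group K" and c: "compact_space (topo K)"
    using assms by (auto simp: compact_group_def)
  note t = transport[OF K assms(2)]
  have "e ` topspace (topo K) = topspace (topo (transport e K))"
    using topological_group.topspace_topo[OF K] topological_group.topspace_topo[OF t(1)]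
    by (simp add: transport_def Let_def)
  moreover have "continuous_map (topo K) (topo (transport e K)) e"
    using t(2) by (simp add: cont_hom_def)
  then have "compactin (topo (transport e K)) (e ` topspace (topo K))"
    using c unfolding compact_space_def by (rule image_compactin[rotated])
  ultimately have "compact_space (topo (transport e K))"
    by (simp add: compact_space_def)
  with t(1) show ?thesis by (simp add: compact_group_def)
qed

text \<open>A Hausdorff space with a dense image of \<open>G\<close> has at most as many points as there are sets of
  subsets of \<open>G\<close>: send a point to the traces of its open neighbourhoods.\<close>

lemma dense_image_inj:
  fixes h :: "'g \<Rightarrow> 'k"
  assumes X: "Hausdorff_space X" and d: "X closure_of (h ` A) = topspace X"
  obtains e :: "'k \<Rightarrow> 'g set set" where "inj_on e (topspace X)"
proof
  show "inj_on (\<lambda>k. {h -` V \<inter> A |V. openin X V \<and> k \<in> V}) (topspace X)"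
  proof (rule inj_onI, rule ccontr)
    fix k l assume k: "k \<in> topspace X" and l: "l \<in> topspace X" and ne: "k \<noteq> l"
      and eq: "{h -` V \<inter> A |V. openin X V \<and> k \<in> V} = {h -` V \<inter> A |V. openin X V \<and> l \<in> V}"
    obtain V V' where V: "openin X V" "openin X V'" "k \<in> V" "l \<in> V'" "disjnt V V'"
      using X k l ne unfolding Hausdorff_space_def by meson
    have "h -` V \<inter> A \<in> {h -` V \<inter> A |V. openin X V \<and> k \<in> V}"
      using V(1,3) by blast
    then have "h -` V \<inter> A \<in> {h -` V \<inter> A |V. openin X V \<and> l \<in> V}"
      by (simp only: eq)
    then obtain W where W: "openin X W" "l \<in> W" "h -` V \<inter> A = h -` W \<inter> A" by blast
    have "l \<in> X closure_of (h ` A)" using d l by simp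
    moreover have "openin X (W \<inter> V')" using W(1) V(2) by (rule openin_Int)
    ultimately obtain x where x: "x \<in> A" "h x \<in> W \<inter> V'"
      using W(2) V(4) by (auto simp: in_closure_of)
    then have "x \<in> h -` W \<inter> A" by simp
    then have "h x \<in> V" by (simp flip: W(3))
    then show False using x(2) V(5) by (auto simp: disjnt_iff)
  qed
qed

lemma dense_image_group:
  assumes G: "topological_group G" and K: "compact_group K" and h: "h \<in> cont_hom G K"
  defines "C \<equiv> topo K closure_of (h ` carrier G)"
  shows "compact_group (topsubgroup K C)" "h \<in> cont_hom G (topsubgroup K C)"
    "topo (topsubgroup K C) closure_of (h ` carrier G) = C"
    "id \<in> cont_hom (topsubgroup K C) K"
proof -
  interpret G: topological_group G by fact
  interpret K: topological_group K using K by (simp add: compact_group_def)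
  have hh: "h \<in> hom G K" and hc: "continuous_map (topo G) (topo K) h"
    using h by (auto simp: cont_hom_def)
  interpret group_hom G K h using hh by (simp add: group_hom_def group_hom_axioms_def)
  have sg: "subgroup C K" unfolding C_def by (rule K.subgroup_closure) (rule img_is_subgroup)
  have sub: "h ` carrier G \<subseteq> C"
    unfolding C_def by (rule closure_of_subset) (auto simp: K.topspace_topo)
  have "compactin (topo K) C"
    using K closedin_compact_space[of "topo K" C] by (simp add: C_def compact_group_def)
  then show "compact_group (topsubgroup K C)"
    using topological_group_topsubgroup[OF K.topological_group_axioms sg]
    by (simp add: compact_group_def topsubgroup_def compact_space_subtopology)
  show "h \<in> cont_hom G (topsubgroup K C)"
    using hh hc sub G.topspace_topo
    by (auto simp: cont_hom_def hom_def topsubgroup_def continuous_map_in_subtopology)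
  show "topo (topsubgroup K C) closure_of (h ` carrier G) = C"
  proof -
    have "C \<inter> h ` carrier G = h ` carrier G" using sub by blast
    then show ?thesis by (simp add: topsubgroup_def closure_of_subtopology flip: C_def)
  qed
  show "id \<in> cont_hom (topsubgroup K C) K"
    using subgroup.subset[OF sg]
    by (auto simp: cont_hom_def hom_def topsubgroup_def continuous_map_from_subtopology)
qed

lemma bohr_universal:
  fixes G :: "'g topgroup" and K :: "'k topgroup"
  assumes G: "topological_group G" and B: "is_bohr_compactification G B b"
    and K: "compact_group K" and h: "h \<in> cont_hom G K"
  shows "\<exists>h' \<in> cont_hom B K. \<forall>x \<in> carrier G. h x = h' (b x)"
proof -
  define C where "C = topo K closure_of (h ` carrier G)"
  note d = dense_image_group[OF G K h, folded C_def]
  have tg: "topological_group (topsubgroup K C)" using d(1) by (simp add: compact_group_def)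
  have car: "carrier (topsubgroup K C) = C" by (simp add: topsubgroup_def)
  have ts: "topspace (topo (topsubgroup K C)) = C"
    using topological_group.topspace_topo[OF tg] car by simp
  obtain e :: "'k \<Rightarrow> 'g set set" where e: "inj_on e C"
    using dense_image_inj[OF topological_group.Hausdorff[OF tg], of h "carrier G"] d(3) ts by metis
  then have e': "inj_on e (carrier (topsubgroup K C))" by (simp add: car)
  note t = transport[OF tg e']
  have "(\<lambda>x. e (h x)) \<in> cont_hom G (transport e (topsubgroup K C))"
    using cont_hom_compose[OF d(2) t(2)] .
  then obtain h' where h': "h' \<in> cont_hom B (transport e (topsubgroup K C))"
    "\<forall>x\<in>carrier G. e (h x) = h' (b x)"
    using B compact_group_transport[OF d(1) e'] unfolding is_bohr_compactification_def by metis
  have "(\<lambda>x. id (inv_into C e (h' x))) \<in> cont_hom B K"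
    using cont_hom_compose[OF cont_hom_compose[OF h'(1) t(3)] d(4)] by (simp add: car)
  moreover have "h x = inv_into C e (h' (b x))" if "x \<in> carrier G" for x
  proof -
    have "h x \<in> C" using d(2) that car by (auto simp: cont_hom_def hom_def)
    then show ?thesis using h'(2) that e by (metis inv_into_f_f)
  qed
  ultimately show ?thesis by (intro bexI) auto
qed

definition product_topgroup :: "'i set \<Rightarrow> ('i \<Rightarrow> 'a topgroup) \<Rightarrow> ('i \<Rightarrow> 'a) topgroup" where
  "product_topgroup I K =
     \<lparr>carrier = (\<Pi>\<^sub>E i\<in>I. carrier (K i)), mult = (\<lambda>x y. \<lambda>i\<in>I. x i \<otimes>\<^bsub>K i\<^esub> y i),
      one = (\<lambda>i\<in>I. \<one>\<^bsub>K i\<^esub>), topo = product_topology (\<lambda>i. topo (K i)) I\<rparr>"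

lemma compact_group_product:
  assumes K: "\<And>i. i \<in> I \<Longrightarrow> compact_group (K i)"
  shows "compact_group (product_topgroup I K)"
proof -
  let ?P = "product_topgroup I K"
  have tg: "topological_group (K i)" and cs: "compact_space (topo (K i))" if "i \<in> I" for i
    using K that by (auto simp: compact_group_def)
  have gr: "group (K i)" if "i \<in> I" for i using tg[OF that] by (simp add: topological_group_def)
  have simps [simp]: "carrier ?P = (\<Pi>\<^sub>E i\<in>I. carrier (K i))" "\<one>\<^bsub>?P\<^esub> = (\<lambda>i\<in>I. \<one>\<^bsub>K i\<^esub>)"
    "x \<otimes>\<^bsub>?P\<^esub> y = (\<lambda>i\<in>I. x i \<otimes>\<^bsub>K i\<^esub> y i)" "topo ?P = product_topology (\<lambda>i. topo (K i)) I" for x y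
    by (simp_all add: product_topgroup_def)
  have "group (product_group I K)" using gr by simp
  then have "group ?P"
  proof (rule group_same_operations)
    show "carrier ?P = carrier (product_group I K)"
      by (simp only: simps carrier_product_group)
    show "mult ?P = mult (product_group I K)"
      by (simp only: product_topgroup_def mult_product_group monoid.select_convs)
    show "\<one>\<^bsub>?P\<^esub> = \<one>\<^bsub>product_group I K\<^esub>"
      by (simp only: simps one_product_group)
  qed
  then interpret P: group ?P .
  have iv: "inv\<^bsub>?P\<^esub> x = (\<lambda>i\<in>I. inv\<^bsub>K i\<^esub> x i)" if "x \<in> carrier ?P" for x
  proof (rule P.inv_equality)
    have x: "x i \<in> carrier (K i)" if "i \<in> I" for i
      using \<open>x \<in> carrier ?P\<close> that unfolding simps by (rule PiE_mem)
    show "(\<lambda>i\<in>I. inv\<^bsub>K i\<^esub> x i) \<otimes>\<^bsub>?P\<^esub> x = \<one>\<^bsub>?P\<^esub>"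
      unfolding simps by (rule restrict_ext) (simp add: group.l_inv[OF gr x])
    show "(\<lambda>i\<in>I. inv\<^bsub>K i\<^esub> x i) \<in> carrier ?P"
      unfolding simps by (rule restrict_PiE_iff[THEN iffD2]) (blast intro: group.inv_closed[OF gr x])
  qed (rule that)
  have ts: "topspace (topo ?P) = carrier ?P"
    using tg by (auto simp: topological_group.topspace_topo cong: PiE_cong)
  have proj: "continuous_map (topo ?P) (topo (K i)) (\<lambda>x. x i)" if "i \<in> I" for i
    using continuous_map_product_projection[OF that, of "\<lambda>i. topo (K i)"] by simp
  have "topological_group ?P"
  proof
    show "topspace (topo ?P) = carrier ?P" by (rule ts)
    show "Hausdorff_space (topo ?P)"
      using tg by (simp add: Hausdorff_space_product_topology topological_group.Hausdorff)
    have "continuous_map (prod_topology (topo ?P) (topo ?P)) (topo (K i))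
        (\<lambda>z. fst z i \<otimes>\<^bsub>K i\<^esub> snd z i)" if i: "i \<in> I" for i
    proof -
      have "continuous_map (prod_topology (topo ?P) (topo ?P)) (prod_topology (topo (K i)) (topo (K i)))
         (\<lambda>(x, y). (x i, y i))"
        using proj[OF i] by (simp only: continuous_map_prod_top) simp
      from continuous_map_compose[OF this topological_group.continuous_mult[OF tg[OF i]]]
      show ?thesis by (simp add: o_def case_prod_unfold)
    qed
    then show "continuous_map (prod_topology (topo ?P) (topo ?P)) (topo ?P) (\<lambda>(x, y). x \<otimes>\<^bsub>?P\<^esub> y)"
      by (auto simp: continuous_map_componentwise case_prod_unfold)
    have "continuous_map (topo ?P) (topo ?P) (\<lambda>x. \<lambda>i\<in>I. inv\<^bsub>K i\<^esub> x i)"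
      using continuous_map_compose[OF proj topological_group.continuous_inv[OF tg]]
      by (auto simp: continuous_map_componentwise o_def)
    then show "continuous_map (topo ?P) (topo ?P) (\<lambda>x. inv\<^bsub>?P\<^esub> x)"
      by (rule continuous_map_eq) (simp only: ts iv)
  qed
  moreover have "compact_space (topo ?P)"
    using cs by (auto simp: compact_space_product_topology)
  ultimately show ?thesis by (simp add: compact_group_def)
qed

lemma bohr_exists:
  fixes G :: "'g topgroup"
  assumes G: "topological_group G"
  shows "\<exists>(B :: 'g set set topgroup) b. is_bohr_compactification G B b"
proof -
  interpret G: topological_group G by fact
  define I :: "('g set set topgroup \<times> ('g \<Rightarrow> 'g set set)) set"
    where "I = {(K, h). compact_group K \<and> h \<in> cont_hom G K}"
  define P where "P = product_topgroup I fst"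
  define b0 where "b0 = (\<lambda>x. \<lambda>i\<in>I. snd i x)"
  have simps: "carrier P = (\<Pi>\<^sub>E i\<in>I. carrier (fst i))"
    "x \<otimes>\<^bsub>P\<^esub> y = (\<lambda>i\<in>I. x i \<otimes>\<^bsub>fst i\<^esub> y i)" "topo P = product_topology (\<lambda>i. topo (fst i)) I" for x y
    by (auto simp: P_def product_topgroup_def product_group_def monoid.defs)
  have P: "compact_group P" unfolding P_def by (rule compact_group_product) (auto simp: I_def)
  have I: "snd i \<in> cont_hom G (fst i)" if "i \<in> I" for i using that by (auto simp: I_def)
  have b0: "b0 \<in> cont_hom G P"
    using I unfolding cont_hom_def
    by (auto simp: hom_def simps b0_def continuous_map_componentwise Pi_iff intro!: restrict_ext)
  define C where "C = topo P closure_of (b0 ` carrier G)"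
  note d = dense_image_group[OF G P b0, folded C_def]
  have tg: "topological_group (topsubgroup P C)" using d(1) by (simp add: compact_group_def)
  have car: "carrier (topsubgroup P C) = C" by (simp add: topsubgroup_def)
  have ts: "topspace (topo (topsubgroup P C)) = C"
    using topological_group.topspace_topo[OF tg] car by simp
  obtain e :: "_ \<Rightarrow> 'g set set" where e: "inj_on e C"
    using dense_image_inj[OF topological_group.Hausdorff[OF tg], of b0 "carrier G"] d(3) ts by metis
  then have e': "inj_on e (carrier (topsubgroup P C))" by (simp add: car)
  note t = transport[OF tg e']
  let ?B = "transport e (topsubgroup P C)"
  let ?b = "\<lambda>x. e (b0 x)"
  have carB: "carrier ?B = e ` C" by (simp add: transport_def Let_def car)
  have tsB: "topspace (topo ?B) = e ` C"
    using topological_group.topspace_topo[OF t(1)] carB by simp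
  have bC: "b0 x \<in> C" if "x \<in> carrier G" for x
    using d(2) that car by (auto simp: cont_hom_def hom_def)
  have "e ` C \<subseteq> topo ?B closure_of (e ` b0 ` carrier G)"
    using continuous_map_image_closure_subset[of "topo (topsubgroup P C)" "topo ?B" e "b0 ` carrier G"]
      t(2) d(3) by (simp add: cont_hom_def)
  then have dense: "topo ?B closure_of (?b ` carrier G) = carrier ?B"
    using closure_of_subset_topspace[of "topo ?B" "?b ` carrier G"] tsB carB
    by (simp add: image_image subset_antisym)
  have univ: "\<exists>h'\<in>cont_hom ?B K. \<forall>x\<in>carrier G. h x = h' (?b x)"
    if K: "compact_group K" "h \<in> cont_hom G K" for K :: "'g set set topgroup" and h
  proof -
    have i: "(K, h) \<in> I" using K by (simp add: I_def)
    have "(\<lambda>p. p (K, h)) \<in> cont_hom P K"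
      using i continuous_map_product_projection[OF i, of "\<lambda>i. topo (fst i)"]
      unfolding cont_hom_def by (auto simp: hom_def simps dest: PiE_mem[OF _ i])
    from cont_hom_compose[OF cont_hom_compose[OF t(3) d(4)] this]
    have "(\<lambda>u. (inv_into C e u) (K, h)) \<in> cont_hom ?B K" by (simp add: car)
    moreover have "h x = (inv_into C e (?b x)) (K, h)" if "x \<in> carrier G" for x
      using e bC[OF that] i by (simp add: b0_def)
    ultimately show ?thesis by (intro bexI) auto
  qed
  have "is_bohr_compactification G ?B ?b"
    unfolding is_bohr_compactification_def
    using compact_group_transport[OF d(1) e'] cont_hom_compose[OF d(2) t(2)] dense univ by simp
  then show ?thesis by blast
qed

lemma bohr_is_bohr:
  assumes "topological_group G"
  shows "is_bohr_compactification G (bohr_group G) (bohr_map G)"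
proof -
  have "case bohr G of (B, b) \<Rightarrow> is_bohr_compactification G B b"
    unfolding bohr_def using bohr_exists[OF assms] by (metis (mono_tags, lifting) case_prodI someI)
  then show ?thesis by (simp add: bohr_group_def bohr_map_def case_prod_unfold)
qed

lemma bohr_topology_unique:
  fixes G :: "'g topgroup" and B :: "'b topgroup"
  assumes G: "topological_group G" and B: "is_bohr_compactification G B b"
  shows "bohr_topology G = pullback_topology (carrier G) b (topo B)"
    and "maximally_almost_periodic G \<longleftrightarrow> inj_on b (carrier G)"
proof -
  note B0 = bohr_is_bohr[OF G]
  have cg: "compact_group B" "b \<in> cont_hom G B"
    "compact_group (bohr_group G)" "bohr_map G \<in> cont_hom G (bohr_group G)"
    using B B0 by (auto simp: is_bohr_compactification_def)
  obtain u where u: "u \<in> cont_hom (bohr_group G) B" "\<forall>x\<in>carrier G. b x = u (bohr_map G x)"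
    using bohr_universal[OF G B0 cg(1,2)] by blast
  obtain v where v: "v \<in> cont_hom B (bohr_group G)" "\<forall>x\<in>carrier G. bohr_map G x = v (b x)"
    using bohr_universal[OF G B cg(3,4)] by blast
  have le: "openin (pullback_topology A f X) S \<Longrightarrow> openin (pullback_topology A g Y) S"
    if w: "continuous_map Y X w" and fg: "\<forall>x\<in>A. f x = w (g x)" "g ` A \<subseteq> topspace Y"
    for A :: "'g set" and f :: "'g \<Rightarrow> 'c" and g :: "'g \<Rightarrow> 'd" and X Y w S
  proof -
    assume "openin (pullback_topology A f X) S"
    then obtain U where U: "openin X U" "S = f -` U \<inter> A" by (auto simp: openin_pullback_topology)
    have "openin Y {y \<in> topspace Y. w y \<in> U}" using w U(1) by (rule openin_continuous_map_preimage)
    moreover have "S = g -` {y \<in> topspace Y. w y \<in> U} \<inter> A" using U(2) fg by auto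
    ultimately show ?thesis by (auto simp: openin_pullback_topology)
  qed
  have im: "b ` carrier G \<subseteq> topspace (topo B)"
    "bohr_map G ` carrier G \<subseteq> topspace (topo (bohr_group G))"
    using cg by (auto simp: cont_hom_def hom_def compact_group_def topological_group.topspace_topo)
  show "bohr_topology G = pullback_topology (carrier G) b (topo B)"
    unfolding bohr_topology_def topology_eq
    using le[OF _ v(2) im(1)] le[OF _ u(2) im(2)] u(1) v(1) by (auto simp: cont_hom_def)
  show "maximally_almost_periodic G \<longleftrightarrow> inj_on b (carrier G)"
  proof
    show "maximally_almost_periodic G \<Longrightarrow> inj_on b (carrier G)"
      using v(2) by (auto simp: maximally_almost_periodic_def inj_on_def)
    show "inj_on b (carrier G) \<Longrightarrow> maximally_almost_periodic G"
      using u(2) by (auto simp: maximally_almost_periodic_def inj_on_def)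
  qed
qed

end

theory Submission
  imports Defs
begin

text \<open>Let \<open>\<gamma> = T 1\<close>. As the constant 1 is a one-dimensional representation,
\<open>\<gamma>\<close> is a character of \<open>H\<close>. For \<open>h\<close> in \<open>H\<close> put
\<open>\<phi> h f = cnj (\<gamma> h) * T f h\<close>. Since \<open>T\<close> is non-vanishing, the
function \<open>T (f - \<phi> h f) = T f - \<phi> h f * \<gamma>\<close>, which vanishes at
\<open>h\<close>, comes from a function with a zero; so the linear functional \<open>\<phi> h\<close> takes
every \<open>f\<close> to one of its values on \<open>G\<close>. A functional of this kind agrees on any
given sequence of functions with evaluation at a point of \<open>G\<close> (\<open>simultaneous\<close>):
for a real function \<open>a\<close>, the range of \<open>a + \<i> * a\<^sup>2\<close> shows
\<open>\<phi> (a\<^sup>2) = (\<phi> a)\<^sup>2\<close>, so that a weighted sum of the squares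
\<open>\<bar>f n - \<phi> (f n)\<bar>\<^sup>2\<close> lies in the kernel of the functional, hence has a
zero.

The functional is then evaluation at one point \<open>t h\<close> for all of \<open>AP G\<close>
(\<open>functional_is_evaluation\<close>). If \<open>G\<close> is \<open>\<sigma>\<close>-compact, a
countable subcover of the sets where \<open>f x \<noteq> \<phi> f\<close> would contradict the case of
sequences. In the other case the same argument gives a point of the Bohr compactification all of whose
\<open>G\<^sub>\<delta>\<close> neighbourhoods meet \<open>G\<close>, and if the Bohr topology is
realcompact, such points belong to \<open>G\<close> (\<open>realcompact_dense\<close>): by the countable
chain condition of compact groups, the closure of an open set is invariant under right translation by the
elements of some \<open>G\<^sub>\<delta>\<close> neighbourhood of the identity, and this forces every Bohr
continuous real function on \<open>G\<close> to have a limit at the point. Conversely every point of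
\<open>G\<close> is some \<open>t h\<close>: otherwise, as \<open>H\<close> is Lindelof, one function on
\<open>G\<close> that vanishes at the point would be mapped to a function without zeros.

That \<open>t\<close> is a homomorphism can only be read off from representations, so these have to be shown
to separate the points of \<open>G\<close>. This is the theorem of Peter and Weyl for almost periodic
functions. An almost periodic \<open>f\<close> makes \<open>G\<close> a group with the totally bounded
bi-invariant pseudometric \<open>d x y = sup \<bar>f (z x w) - f (z y w)\<bar>\<close>. Such a
group has an invariant mean (\<open>iter_converges\<close>): iterated left averages over finer and finer
nets lose their oscillation. The convolution operator \<open>conv\<close> with the kernel
\<open>max 0 (r - d x y)\<close> is symmetric and compact for the inner product of the mean and
commutes with right translations, so the span of its eigenfunctions with eigenvalue bounded below is a
finite-dimensional invariant space, and these spaces approximate \<open>f\<close> uniformly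
(\<open>coefficient_approximation\<close>). Real functions suffice, so the representations found are
orthogonal.

Continuity of \<open>t\<close> into the Bohr topology is immediate. Continuity into the topology of
\<open>G\<close> follows from Baire's theorem if \<open>G\<close> is \<open>\<sigma>\<close>-compact, and
otherwise because compact neighbourhoods in \<open>H\<close> have Bohr compact, hence compact, images. The
subgroup is all of \<open>H\<close>.\<close>

section \<open>Groups with a totally bounded bi-invariant pseudometric\<close>

locale totally_bounded_group = group G for G :: "('a, 'm) monoid_scheme" (structure) +
  fixes d :: "'a \<Rightarrow> 'a \<Rightarrow> real"
  assumes d_self: "x \<in> carrier G \<Longrightarrow> d x x = 0"
    and d_sym: "x \<in> carrier G \<Longrightarrow> y \<in> carrier G \<Longrightarrow> d x y = d y x"
    and d_tri: "x \<in> carrier G \<Longrightarrow> y \<in> carrier G \<Longrightarrow> z \<in> carrier G \<Longrightarrow> d x z \<le> d x y + d y z"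
    and d_left: "x \<in> carrier G \<Longrightarrow> y \<in> carrier G \<Longrightarrow> z \<in> carrier G \<Longrightarrow> d (z \<otimes> x) (z \<otimes> y) = d x y"
    and d_right: "x \<in> carrier G \<Longrightarrow> y \<in> carrier G \<Longrightarrow> z \<in> carrier G \<Longrightarrow> d (x \<otimes> z) (y \<otimes> z) = d x y"
    and tb: "e > 0 \<Longrightarrow> \<exists>F. finite F \<and> F \<subseteq> carrier G \<and> (\<forall>x\<in>carrier G. \<exists>a\<in>F. d x a < e)"
begin

lemma d_nonneg: "x \<in> carrier G \<Longrightarrow> y \<in> carrier G \<Longrightarrow> 0 \<le> d x y"
  using d_tri[of x y x] d_self[of x] d_sym[of x y] by simp

text \<open>Uniform continuity for the pseudometric; it is the function space on which the mean and the operators live.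
Only values on the carrier matter.\<close>

definition UC :: "('a \<Rightarrow> real) \<Rightarrow> bool" where
  "UC f \<longleftrightarrow> (\<forall>e>0. \<exists>r>0. \<forall>x\<in>carrier G. \<forall>y\<in>carrier G. d x y < r \<longrightarrow> \<bar>f x - f y\<bar> < e)"

lemma UC_obtain:
  assumes "UC f" "e > 0"
  obtains r where "r > 0" "\<And>x y. x \<in> carrier G \<Longrightarrow> y \<in> carrier G \<Longrightarrow> d x y < r \<Longrightarrow> \<bar>f x - f y\<bar> < e"
  using assms unfolding UC_def by metis

lemma UC_by_two:
  assumes "UC f" "UC g"
    and "\<And>e. e > 0 \<Longrightarrow> \<exists>s>0. \<forall>x\<in>carrier G. \<forall>y\<in>carrier G.
      \<bar>f x - f y\<bar> < s \<longrightarrow> \<bar>g x - g y\<bar> < s \<longrightarrow> \<bar>h x - h y\<bar> < e"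
  shows "UC h"
  unfolding UC_def
proof (intro allI impI)
  fix e :: real assume "e > 0"
  then obtain s where s: "s > 0" "\<forall>x\<in>carrier G. \<forall>y\<in>carrier G.
      \<bar>f x - f y\<bar> < s \<longrightarrow> \<bar>g x - g y\<bar> < s \<longrightarrow> \<bar>h x - h y\<bar> < e" using assms(3) by blast
  obtain r1 where r1: "r1 > 0" "\<And>x y. x \<in> carrier G \<Longrightarrow> y \<in> carrier G \<Longrightarrow> d x y < r1 \<Longrightarrow> \<bar>f x - f y\<bar> < s"
    using UC_obtain[OF assms(1) s(1)] by blast
  obtain r2 where r2: "r2 > 0" "\<And>x y. x \<in> carrier G \<Longrightarrow> y \<in> carrier G \<Longrightarrow> d x y < r2 \<Longrightarrow> \<bar>g x - g y\<bar> < s"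
    using UC_obtain[OF assms(2) s(1)] by blast
  show "\<exists>r>0. \<forall>x\<in>carrier G. \<forall>y\<in>carrier G. d x y < r \<longrightarrow> \<bar>h x - h y\<bar> < e"
    by (rule exI[of _ "min r1 r2"]) (use r1 r2 s in auto)
qed

lemma UC_bounded:
  assumes "UC f"
  obtains B where "B > 0" "\<And>x. x \<in> carrier G \<Longrightarrow> \<bar>f x\<bar> \<le> B"
proof -
  obtain r where r: "r > 0" "\<And>x y. x \<in> carrier G \<Longrightarrow> y \<in> carrier G \<Longrightarrow> d x y < r \<Longrightarrow> \<bar>f x - f y\<bar> < 1"
    using UC_obtain[OF assms, of 1] by auto
  obtain F where F: "finite F" "F \<subseteq> carrier G" "\<forall>x\<in>carrier G. \<exists>a\<in>F. d x a < r"
    using tb[OF r(1)] by auto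
  have "\<bar>f x\<bar> \<le> (\<Sum>a\<in>F. \<bar>f a\<bar>) + 1" if x: "x \<in> carrier G" for x
  proof -
    obtain a where a: "a \<in> F" "d x a < r" using F(3) x by blast
    have "\<bar>f x - f a\<bar> < 1" using r(2)[OF x _ a(2)] a F by auto
    moreover have "\<bar>f a\<bar> \<le> (\<Sum>a\<in>F. \<bar>f a\<bar>)" using a F by (intro member_le_sum) auto
    ultimately show ?thesis by linarith
  qed
  moreover have "(\<Sum>a\<in>F. \<bar>f a\<bar>) + 1 > 0" by (simp add: add_nonneg_pos sum_nonneg)
  ultimately show ?thesis using that by blast
qed

lemma UC_cong: "UC f \<Longrightarrow> (\<And>x. x \<in> carrier G \<Longrightarrow> f x = g x) \<Longrightarrow> UC g"
  unfolding UC_def by (metis (no_types, lifting))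

lemma UC_lipschitz:
  assumes "\<And>x y. x \<in> carrier G \<Longrightarrow> y \<in> carrier G \<Longrightarrow> \<bar>f x - f y\<bar> \<le> L * d x y"
  shows "UC f"
  unfolding UC_def
proof (intro allI impI)
  fix e :: real assume e: "e > 0"
  show "\<exists>r>0. \<forall>x\<in>carrier G. \<forall>y\<in>carrier G. d x y < r \<longrightarrow> \<bar>f x - f y\<bar> < e"
  proof (intro exI[of _ "e / (\<bar>L\<bar> + 1)"] conjI ballI impI)
    fix x y assume xy: "x \<in> carrier G" "y \<in> carrier G" "d x y < e / (\<bar>L\<bar> + 1)"
    have "\<bar>f x - f y\<bar> \<le> L * d x y" using assms xy by blast
    also have "\<dots> \<le> (\<bar>L\<bar> + 1) * d x y" using d_nonneg[OF xy(1,2)] by (intro mult_right_mono) auto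
    also have "\<dots> < e" using xy(3) by (simp add: pos_less_divide_eq mult.commute)
    finally show "\<bar>f x - f y\<bar> < e" .
  qed (use e in auto)
qed

lemma UC_const [simp]: "UC (\<lambda>x. c)"
  by (rule UC_lipschitz[of _ 0]) simp

lemma UC_add: "UC f \<Longrightarrow> UC g \<Longrightarrow> UC (\<lambda>x. f x + g x)"
proof (rule UC_by_two)
  fix e :: real assume "e > 0"
  then show "\<exists>s>0. \<forall>x\<in>carrier G. \<forall>y\<in>carrier G. \<bar>f x - f y\<bar> < s \<longrightarrow> \<bar>g x - g y\<bar> < s \<longrightarrow>
     \<bar>f x + g x - (f y + g y)\<bar> < e"
    by (intro exI[of _ "e/2"]) (auto simp: abs_if split: if_splits)
qed

lemma UC_mult:
  assumes f: "UC f" and g: "UC g"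
  shows "UC (\<lambda>x. f x * g x)"
proof -
  obtain B where B: "B > 0" "\<And>x. x \<in> carrier G \<Longrightarrow> \<bar>f x\<bar> \<le> B" using UC_bounded[OF f] by blast
  obtain C where C: "C > 0" "\<And>x. x \<in> carrier G \<Longrightarrow> \<bar>g x\<bar> \<le> C" using UC_bounded[OF g] by blast
  show ?thesis
  proof (rule UC_by_two[OF f g])
    fix e :: real assume e: "e > 0"
    show "\<exists>s>0. \<forall>x\<in>carrier G. \<forall>y\<in>carrier G. \<bar>f x - f y\<bar> < s \<longrightarrow> \<bar>g x - g y\<bar> < s \<longrightarrow>
       \<bar>f x * g x - f y * g y\<bar> < e"
    proof (intro exI[of _ "e / (B + C)"] conjI ballI impI)
      fix x y assume xy: "x \<in> carrier G" "y \<in> carrier G"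
        and *: "\<bar>f x - f y\<bar> < e / (B + C)" "\<bar>g x - g y\<bar> < e / (B + C)"
      have "f x * g x - f y * g y = f x * (g x - g y) + (f x - f y) * g y"
        by (simp add: algebra_simps)
      then have "\<bar>f x * g x - f y * g y\<bar> \<le> \<bar>f x\<bar> * \<bar>g x - g y\<bar> + \<bar>f x - f y\<bar> * \<bar>g y\<bar>"
        by (metis abs_mult abs_triangle_ineq)
      also have "\<dots> \<le> B * \<bar>g x - g y\<bar> + \<bar>f x - f y\<bar> * C"
        using B(2)[OF xy(1)] C(2)[OF xy(2)] by (intro add_mono mult_mono) auto
      also have "\<dots> < B * (e / (B + C)) + (e / (B + C)) * C"
        using * B(1) C(1) by (intro add_strict_mono mult_strict_left_mono mult_strict_right_mono) auto
      also have "\<dots> = (B + C) * (e / (B + C))" by (metis distrib_right mult.commute)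
      also have "\<dots> = e" using B(1) C(1) by simp
      finally show "\<bar>f x * g x - f y * g y\<bar> < e" .
    qed (use e B C in auto)
  qed
qed

lemma UC_cmult: "UC f \<Longrightarrow> UC (\<lambda>x. c * f x)"
  using UC_mult[of "\<lambda>_. c" f] by simp

lemma UC_multc: "UC f \<Longrightarrow> UC (\<lambda>x. f x * c)"
  using UC_mult[of f "\<lambda>_. c"] by simp

lemma UC_diff: "UC f \<Longrightarrow> UC g \<Longrightarrow> UC (\<lambda>x. f x - g x)"
  using UC_add[of f "\<lambda>x. (-1) * g x"] UC_cmult[of g "-1"] by simp

lemma UC_sum: "(\<And>i. i \<in> I \<Longrightarrow> UC (f i)) \<Longrightarrow> UC (\<lambda>x. \<Sum>i\<in>I. f i x)"
  by (induction I rule: infinite_finite_induct) (auto intro: UC_add)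

lemma UC_inverse:
  assumes f: "UC f" and c: "c > 0" "\<And>x. x \<in> carrier G \<Longrightarrow> c \<le> f x"
  shows "UC (\<lambda>x. 1 / f x)"
proof (rule UC_by_two[OF f f])
  fix e :: real assume e: "e > 0"
  show "\<exists>s>0. \<forall>x\<in>carrier G. \<forall>y\<in>carrier G. \<bar>f x - f y\<bar> < s \<longrightarrow> \<bar>f x - f y\<bar> < s \<longrightarrow>
     \<bar>1 / f x - 1 / f y\<bar> < e"
  proof (intro exI[of _ "e * (c * c)"] conjI ballI impI)
    fix x y assume xy: "x \<in> carrier G" "y \<in> carrier G" and *: "\<bar>f x - f y\<bar> < e * (c * c)"
    have p: "0 < f x" "0 < f y" using c xy by (metis less_le_trans)+
    have "1 / f x - 1 / f y = (f y - f x) / (f x * f y)" using p by (simp add: field_simps)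
    then have "\<bar>1 / f x - 1 / f y\<bar> = \<bar>f x - f y\<bar> / (f x * f y)"
      using p by (simp add: abs_mult abs_minus_commute)
    also have "\<dots> \<le> \<bar>f x - f y\<bar> / (c * c)"
      using c p xy by (intro divide_left_mono mult_mono) auto
    also have "\<dots> < e" using * c by (simp add: pos_divide_less_eq)
    finally show "\<bar>1 / f x - 1 / f y\<bar> < e" .
  qed (use e c in auto)
qed

lemma UC_right: "UC f \<Longrightarrow> a \<in> carrier G \<Longrightarrow> UC (\<lambda>x. f (x \<otimes> a))"
  unfolding UC_def by (metis d_right m_closed)

lemma UC_uniform_limit:
  assumes "\<And>e. e > 0 \<Longrightarrow> \<exists>h. UC h \<and> (\<forall>x\<in>carrier G. \<bar>f x - h x\<bar> < e)"
  shows "UC f"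
  unfolding UC_def
proof (intro allI impI)
  fix e :: real assume e: "e > 0"
  then obtain h where h: "UC h" "\<forall>x\<in>carrier G. \<bar>f x - h x\<bar> < e/3" using assms[of "e/3"] by auto
  obtain r where r: "r > 0" "\<And>x y. x \<in> carrier G \<Longrightarrow> y \<in> carrier G \<Longrightarrow> d x y < r \<Longrightarrow> \<bar>h x - h y\<bar> < e/3"
    using UC_obtain[OF h(1), of "e/3"] e by auto
  show "\<exists>r>0. \<forall>x\<in>carrier G. \<forall>y\<in>carrier G. d x y < r \<longrightarrow> \<bar>f x - f y\<bar> < e"
  proof (intro exI[of _ r] conjI ballI impI)
    fix x y assume "x \<in> carrier G" "y \<in> carrier G" "d x y < r"
    then have "\<bar>h x - h y\<bar> < e/3" "\<bar>f x - h x\<bar> < e/3" "\<bar>f y - h y\<bar> < e/3" using r h by auto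
    then show "\<bar>f x - f y\<bar> < e" by linarith
  qed (rule r)
qed

lemma UC_dist: "a \<in> carrier G \<Longrightarrow> UC (\<lambda>x. d x a)"
proof (rule UC_lipschitz[of _ 1])
  fix x y assume "a \<in> carrier G" "x \<in> carrier G" "y \<in> carrier G"
  then show "\<bar>d x a - d y a\<bar> \<le> 1 * d x y" using d_tri[of x y a] d_tri[of y x a] d_sym[of x y] by auto
qed

section \<open>The invariant mean\<close>

definition net :: "nat \<Rightarrow> 'a set" where
  "net n = (SOME F. finite F \<and> F \<subseteq> carrier G \<and> (\<forall>x\<in>carrier G. \<exists>a\<in>F. d x a < inverse (real (Suc n))))"

lemma net: "finite (net n)" "net n \<subseteq> carrier G"
    "x \<in> carrier G \<Longrightarrow> \<exists>a\<in>net n. d x a < inverse (real (Suc n))"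
    "net n \<noteq> {}" "card (net n) > 0"
proof -
  have "finite (net n) \<and> net n \<subseteq> carrier G \<and> (\<forall>x\<in>carrier G. \<exists>a\<in>net n. d x a < inverse (real (Suc n)))"
    unfolding net_def by (rule someI_ex) (use tb[of "inverse (real (Suc n))"] in simp)
  then show *: "finite (net n)" "net n \<subseteq> carrier G" and
    "x \<in> carrier G \<Longrightarrow> \<exists>a\<in>net n. d x a < inverse (real (Suc n))" and "net n \<noteq> {}"
    using one_closed by blast+
  then show "card (net n) > 0" by (simp add: card_gt_0_iff)
qed

lemma net_closed [simp]: "a \<in> net n \<Longrightarrow> a \<in> carrier G"
  using net(2) by blast

definition avg :: "'a set \<Rightarrow> ('a \<Rightarrow> real) \<Rightarrow> 'a \<Rightarrow> real" where
  "avg F f x = (\<Sum>a\<in>F. f (a \<otimes> x)) / real (card F)"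

text \<open>The net used at stage \<open>s\<close> is \<open>fst (prod_decode s)\<close>, so that every net is used
infinitely often.\<close>

primrec iter :: "('a \<Rightarrow> real) \<Rightarrow> nat \<Rightarrow> 'a \<Rightarrow> real" where
  "iter f 0 = f"
| "iter f (Suc s) = avg (net (fst (prod_decode s))) (iter f s)"

definition mean :: "('a \<Rightarrow> real) \<Rightarrow> real" where
  "mean f = lim (\<lambda>n. iter f n \<one>)"

lemma avg_le:
  assumes "\<And>a. a \<in> net n \<Longrightarrow> f (a \<otimes> x) \<le> u" shows "avg (net n) f x \<le> u"
  using sum_bounded_above[of "net n" "\<lambda>a. f (a \<otimes> x)" u] assms net(5)[of n]
  by (simp add: avg_def pos_divide_le_eq mult.commute)

lemma avg_ge:
  assumes "\<And>a. a \<in> net n \<Longrightarrow> l \<le> f (a \<otimes> x)" shows "l \<le> avg (net n) f x"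
  using sum_bounded_below[of "net n" l "\<lambda>a. f (a \<otimes> x)"] assms net(5)[of n]
  by (simp add: avg_def pos_le_divide_eq mult.commute)

lemma iter_bounds:
  assumes "\<And>x. x \<in> carrier G \<Longrightarrow> l \<le> f x \<and> f x \<le> u" "x \<in> carrier G"
  shows "l \<le> iter f s x \<and> iter f s x \<le> u"
  using assms(2)
proof (induction s arbitrary: x)
  case (Suc s)
  have "l \<le> iter f s (a \<otimes> x) \<and> iter f s (a \<otimes> x) \<le> u" if "a \<in> net n" for a n
    using Suc that by simp
  then show ?case by (auto intro!: avg_le avg_ge)
qed (use assms in auto)

lemma iter_linear:
  "x \<in> carrier G \<Longrightarrow> iter (\<lambda>x. p * f x + q * g x) s x = p * iter f s x + q * iter g s x"
proof (induction s arbitrary: x)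
  case (Suc s)
  have "avg (net n) (iter (\<lambda>x. p * f x + q * g x) s) x =
    p * avg (net n) (iter f s) x + q * avg (net n) (iter g s) x" for n
    unfolding avg_def using Suc net(2)
    by (subst sum.cong[OF refl Suc.IH]) (auto simp: sum.distrib sum_distrib_left add_divide_distrib)
  then show ?case by simp
qed simp

text \<open>Left averages commute with right translations; this is what makes the mean right invariant.\<close>

lemma iter_right:
  assumes "a \<in> carrier G"
  shows "x \<in> carrier G \<Longrightarrow> iter (\<lambda>x. f (x \<otimes> a)) s x = iter f s (x \<otimes> a)"
proof (induction s arbitrary: x)
  case (Suc s)
  have "b \<otimes> x \<in> carrier G" "b \<otimes> x \<otimes> a = b \<otimes> (x \<otimes> a)" if "b \<in> net n" for b n
    using that net(2) assms Suc.prems by (auto intro: m_assoc)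
  then show ?case using Suc by (auto simp: avg_def intro!: sum.cong)
qed simp

lemma iter_modulus:
  assumes "\<And>x y. x \<in> carrier G \<Longrightarrow> y \<in> carrier G \<Longrightarrow> d x y < r \<Longrightarrow> \<bar>f x - f y\<bar> \<le> e"
    and "x \<in> carrier G" "y \<in> carrier G" "d x y < r"
  shows "\<bar>iter f s x - iter f s y\<bar> \<le> e"
  using assms(2-)
proof (induction s arbitrary: x y)
  case (Suc s)
  have *: "\<bar>iter f s (a \<otimes> x) - iter f s (a \<otimes> y)\<bar> \<le> e" if "a \<in> net n" for a n
    using that net(2) Suc by (intro Suc.IH) (auto simp: d_left subset_eq)
  let ?n = "fst (prod_decode s)"
  have "\<bar>iter f (Suc s) x - iter f (Suc s) y\<bar>
     = \<bar>\<Sum>a\<in>net ?n. iter f s (a \<otimes> x) - iter f s (a \<otimes> y)\<bar> / card (net ?n)"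
    by (simp add: avg_def sum_subtractf flip: diff_divide_distrib)
  also have "\<dots> \<le> (\<Sum>a\<in>net ?n. \<bar>iter f s (a \<otimes> x) - iter f s (a \<otimes> y)\<bar>) / card (net ?n)"
    by (intro divide_right_mono sum_abs) auto
  also have "\<dots> \<le> (\<Sum>a\<in>net ?n. e) / card (net ?n)"
    by (intro divide_right_mono sum_mono *) auto
  also have "\<dots> = e" using net(5)[of ?n] by simp
  finally show ?case .
qed (use assms in auto)

text \<open>The suprema \<open>u s\<close> decrease and the infima \<open>l s\<close> increase. By total boundedness,
for each \<open>x\<close> some element \<open>a\<close> of a fine enough net moves \<open>x\<close> close to
a point where the function is nearly minimal, so averaging over that net replaces at least one of the
\<open>N\<close> values by a nearly minimal one and lowers the supremum by a fixed proportion of the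
oscillation. The modulus of continuity does not deteriorate, because \<open>d\<close> is left invariant, and
the same net occurs infinitely often.\<close>

lemma iter_converges:
  assumes f: "UC f"
  shows "\<exists>c. \<forall>e>0. \<exists>N. \<forall>n\<ge>N. \<forall>x\<in>carrier G. \<bar>iter f n x - c\<bar> < e"
proof -
  obtain B where B: "B > 0" "\<And>x. x \<in> carrier G \<Longrightarrow> \<bar>f x\<bar> \<le> B" using UC_bounded[OF f] by blast
  have bd: "- B \<le> iter f s x \<and> iter f s x \<le> B" if "x \<in> carrier G" for s x
    by (rule iter_bounds[OF _ that]) (use B(2) in \<open>force simp: abs_le_iff\<close>)
  have ba: "bdd_above (iter f s ` carrier G)" and bb: "bdd_below (iter f s ` carrier G)" for s
    using bd by (auto intro!: bdd_aboveI2 bdd_belowI2)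
  have ne: "carrier G \<noteq> {}" using one_closed by blast
  define u where "u s = (SUP x\<in>carrier G. iter f s x)" for s
  define l where "l s = (INF x\<in>carrier G. iter f s x)" for s
  have lu: "l s \<le> iter f s x" "iter f s x \<le> u s" if "x \<in> carrier G" for s x
    using that ba bb by (auto simp: u_def l_def intro: cSUP_upper cINF_lower)
  have u_dec: "u (Suc s) \<le> u s" for s
    unfolding u_def[of "Suc s"] using ne lu(2)[of _ s] by (auto intro!: cSUP_least avg_le simp del: not_le)
  have l_inc: "l s \<le> l (Suc s)" for s
    unfolding l_def[of "Suc s"] using ne lu(1)[of _ s] by (auto intro!: cINF_greatest avg_ge)
  have uB: "- B \<le> u s" and lB: "l s \<le> B" and lleu: "l s \<le> u s" for s
    using lu[OF one_closed, of s] bd[OF one_closed, of s] by auto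
  have "decseq u" "incseq l" using u_dec l_inc by (auto intro: decseq_SucI incseq_SucI)
  then obtain U L where U: "u \<longlonglongrightarrow> U" "\<And>s. U \<le> u s" and L: "l \<longlonglongrightarrow> L" "\<And>s. l s \<le> L"
    using decseq_convergent[of u "-B"] incseq_convergent[of l B] uB lB by metis
  have "U - L \<le> 2 * e" if e: "e > 0" for e
  proof -
    obtain r where r: "r > 0" "\<And>x y. x \<in> carrier G \<Longrightarrow> y \<in> carrier G \<Longrightarrow> d x y < r \<Longrightarrow> \<bar>f x - f y\<bar> < e"
      using UC_obtain[OF f e] by blast
    obtain n where n: "inverse (real (Suc n)) < r" using reals_Archimedean[OF r(1)] by blast
    define N where "N = real (card (net n))"
    have N: "N > 0" using net(5) by (simp add: N_def)
    \<comment> \<open>averaging over the net \<open>n\<close> contracts the oscillation up to an error \<open>2 * e\<close>\<close>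
    have contr: "N * u (Suc s) \<le> (N - 1) * u s + (l s + 2 * e)" if s: "fst (prod_decode s) = n" for s
    proof -
      have "\<exists>x0\<in>carrier G. iter f s x0 < l s + e"
        using cINF_less_iff[OF ne bb, of s "l s + e"] e by (auto simp: l_def)
      then obtain x0 where x0: "x0 \<in> carrier G" "iter f s x0 < l s + e" by blast
      have "N * iter f (Suc s) x \<le> (N - 1) * u s + (l s + 2 * e)" if x: "x \<in> carrier G" for x
      proof -
        obtain a where a: "a \<in> net n" "d (x0 \<otimes> inv x) a < inverse (real (Suc n))"
          using net(3)[of "x0 \<otimes> inv x" n] x x0 by auto
        have ac: "a \<in> carrier G" using a net(2) by blast
        have "d (a \<otimes> x) x0 = d (a \<otimes> x) (x0 \<otimes> inv x \<otimes> x)" using x x0 by (simp add: m_assoc)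
        also have "\<dots> = d a (x0 \<otimes> inv x)" using x x0 ac by (intro d_right) auto
        also have "\<dots> < r" using a n d_sym[OF ac, of "x0 \<otimes> inv x"] x x0 by auto
        finally have "\<bar>iter f s (a \<otimes> x) - iter f s x0\<bar> \<le> e"
          using r(2) ac x x0 by (intro iter_modulus[of r f e]) (auto intro: less_imp_le)
        then have 1: "iter f s (a \<otimes> x) \<le> l s + 2 * e" using x0 by linarith
        have "N * iter f (Suc s) x = (\<Sum>b\<in>net n. iter f s (b \<otimes> x))"
          using N s by (simp add: avg_def N_def)
        also have "\<dots> = iter f s (a \<otimes> x) + (\<Sum>b\<in>net n - {a}. iter f s (b \<otimes> x))"
          using a net(1) by (intro sum.remove) auto
        also have "(\<Sum>b\<in>net n - {a}. iter f s (b \<otimes> x)) \<le> real (card (net n - {a})) * u s"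
          using net(2) x by (intro sum_bounded_above lu) auto
        also have "real (card (net n - {a})) = N - 1"
          using a(1) net(1,5)[of n] by (simp add: N_def of_nat_diff Suc_leI)
        finally show ?thesis using 1 by linarith
      qed
      then have "iter f (Suc s) x \<le> ((N - 1) * u s + (l s + 2 * e)) / N" if "x \<in> carrier G" for x
        using that N by (simp add: pos_le_divide_eq mult.commute)
      then have "u (Suc s) \<le> ((N - 1) * u s + (l s + 2 * e)) / N"
        unfolding u_def[of "Suc s"] by (rule cSUP_least[OF ne])
      then show ?thesis using N by (simp add: pos_le_divide_eq mult.commute)
    qed
    define s where "s j = prod_encode (n, j)" for j
    have s: "filterlim s at_top at_top"
      using le_prod_encode_2 unfolding s_def by (intro filterlim_at_top_mono[OF filterlim_ident]) auto
    have "(\<lambda>j. N * u (Suc (s j))) \<longlonglongrightarrow> N * U"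
      using filterlim_compose[OF LIMSEQ_Suc[OF U(1)] s] by (intro tendsto_intros)
    moreover have "(\<lambda>j. (N - 1) * u (s j) + (l (s j) + 2 * e)) \<longlonglongrightarrow> (N - 1) * U + (L + 2 * e)"
      using filterlim_compose[OF U(1) s] filterlim_compose[OF L(1) s] by (intro tendsto_intros)
    ultimately have "N * U \<le> (N - 1) * U + (L + 2 * e)"
      by (rule LIMSEQ_le) (auto intro!: contr simp: s_def)
    then show ?thesis by (simp add: algebra_simps)
  qed
  then have "U - L \<le> 0" by (metis add.left_neutral field_le_epsilon field_sum_of_halves half_gt_zero mult_2)
  moreover have "L \<le> U" using lleu LIMSEQ_le[OF L(1) U(1)] by blast
  ultimately have UL: "U = L" by simp
  show ?thesis
  proof (intro exI[of _ L] allI impI)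
    fix e :: real assume e: "e > 0"
    have "(\<lambda>n. u n - l n) \<longlonglongrightarrow> 0" using tendsto_diff[OF U(1) L(1)] UL by simp
    then obtain N where N: "\<forall>n\<ge>N. \<bar>u n - l n\<bar> < e"
      using e by (auto simp: LIMSEQ_def dist_real_def)
    show "\<exists>N. \<forall>n\<ge>N. \<forall>x\<in>carrier G. \<bar>iter f n x - L\<bar> < e"
    proof (intro exI[of _ N] allI impI ballI)
      fix n x assume "N \<le> n" "x \<in> carrier G"
      then show "\<bar>iter f n x - L\<bar> < e" using N lu[of x n] U(2)[of n] L(2)[of n] UL by fastforce
    qed
  qed
qed

lemma iter_tendsto_mean:
  assumes "UC f" "x \<in> carrier G"
  shows "(\<lambda>n. iter f n x) \<longlonglongrightarrow> mean f"
proof -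
  obtain c where c: "\<And>e. e > 0 \<Longrightarrow> \<exists>N. \<forall>n\<ge>N. \<forall>x\<in>carrier G. \<bar>iter f n x - c\<bar> < e"
    using iter_converges[OF assms(1)] by blast
  have *: "(\<lambda>n. iter f n y) \<longlonglongrightarrow> c" if "y \<in> carrier G" for y
    unfolding LIMSEQ_def dist_real_def using c that by meson
  then show ?thesis using assms limI[OF *[OF one_closed]] by (simp add: mean_def)
qed

lemma mean_linear:
  assumes "UC f" "UC g"
  shows "mean (\<lambda>x. p * f x + q * g x) = p * mean f + q * mean g"
proof -
  have "(\<lambda>n. iter (\<lambda>x. p * f x + q * g x) n \<one>) \<longlonglongrightarrow> p * mean f + q * mean g"
    unfolding iter_linear[OF one_closed]
    using iter_tendsto_mean[OF _ one_closed] assms by (intro tendsto_intros) auto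
  moreover have "UC (\<lambda>x. p * f x + q * g x)" using assms by (intro UC_add UC_cmult)
  ultimately show ?thesis using iter_tendsto_mean[OF _ one_closed] LIMSEQ_unique by blast
qed

lemma mean_add: "UC f \<Longrightarrow> UC g \<Longrightarrow> mean (\<lambda>x. f x + g x) = mean f + mean g"
  using mean_linear[of f g 1 1] by simp

lemma mean_diff: "UC f \<Longrightarrow> UC g \<Longrightarrow> mean (\<lambda>x. f x - g x) = mean f - mean g"
  using mean_linear[of f g 1 "-1"] by simp

lemma mean_cmult: "UC f \<Longrightarrow> mean (\<lambda>x. c * f x) = c * mean f"
  using mean_linear[of f f c 0] by simp

lemma mean_multc: "UC f \<Longrightarrow> mean (\<lambda>x. f x * c) = mean f * c"
  using mean_cmult[of f c] by (simp add: mult.commute)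

lemma mean_bounds:
  assumes "UC f" "\<And>x. x \<in> carrier G \<Longrightarrow> l \<le> f x \<and> f x \<le> u"
  shows "l \<le> mean f" "mean f \<le> u"
  using iter_tendsto_mean[OF assms(1) one_closed] iter_bounds[of l f u, OF assms(2) one_closed]
  by (auto intro: LIMSEQ_le_const LIMSEQ_le_const2)

lemma mean_const [simp]: "mean (\<lambda>x. c) = c"
  using mean_bounds[of "\<lambda>x. c" c c] by simp

lemma mean_abs_le:
  assumes "UC f" "\<And>x. x \<in> carrier G \<Longrightarrow> \<bar>f x\<bar> \<le> B" shows "\<bar>mean f\<bar> \<le> B"
proof -
  have "- B \<le> f x \<and> f x \<le> B" if "x \<in> carrier G" for x using assms(2)[OF that] by linarith
  then show ?thesis using mean_bounds[OF assms(1), of "-B" B] by (simp add: abs_le_iff)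
qed

lemma mean_nonneg:
  assumes "UC f" "\<And>x. x \<in> carrier G \<Longrightarrow> 0 \<le> f x" shows "0 \<le> mean f"
proof -
  obtain B where B: "\<And>x. x \<in> carrier G \<Longrightarrow> \<bar>f x\<bar> \<le> B" using UC_bounded[OF assms(1)] by blast
  show ?thesis by (rule mean_bounds(1)[OF assms(1), of 0 B]) (use assms(2) B in force)
qed

lemma mean_mono:
  assumes "UC f" "UC g" "\<And>x. x \<in> carrier G \<Longrightarrow> f x \<le> g x" shows "mean f \<le> mean g"
  using mean_nonneg[OF UC_diff[OF assms(2,1)]] assms by (simp add: mean_diff)

lemma mean_cong:
  assumes "UC f" "\<And>x. x \<in> carrier G \<Longrightarrow> f x = g x" shows "mean f = mean g"
  using mean_mono[OF assms(1) UC_cong[OF assms]] mean_mono[OF UC_cong[OF assms] assms(1)] assms(2)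
  by fastforce

lemma mean_sum:
  assumes "\<And>i. i \<in> I \<Longrightarrow> UC (f i)" shows "mean (\<lambda>x. \<Sum>i\<in>I. f i x) = (\<Sum>i\<in>I. mean (f i))"
  using assms by (induction I rule: infinite_finite_induct) (auto simp: mean_add UC_sum)

lemma mean_right:
  assumes "UC f" "a \<in> carrier G" shows "mean (\<lambda>x. f (x \<otimes> a)) = mean f"
proof -
  have "(\<lambda>n. iter (\<lambda>x. f (x \<otimes> a)) n \<one>) \<longlonglongrightarrow> mean f"
    unfolding iter_right[OF assms(2) one_closed] using iter_tendsto_mean assms by simp
  then show ?thesis using iter_tendsto_mean[OF UC_right[OF assms] one_closed] LIMSEQ_unique by blast
qed

text \<open>Finitely many right translates of the function add up to something bounded below, and they all have the same
mean.\<close>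

lemma mean_pos:
  assumes f: "UC f" and nn: "\<And>x. x \<in> carrier G \<Longrightarrow> 0 \<le> f x" and x0: "x0 \<in> carrier G" "f x0 > 0"
  shows "mean f > 0"
proof -
  define c where "c = f x0 / 2"
  have c: "c > 0" using x0 by (simp add: c_def)
  obtain r where r: "r > 0" "\<And>x y. x \<in> carrier G \<Longrightarrow> y \<in> carrier G \<Longrightarrow> d x y < r \<Longrightarrow> \<bar>f x - f y\<bar> < c"
    using UC_obtain[OF f c] by blast
  obtain F where F: "finite F" "F \<subseteq> carrier G" "\<forall>x\<in>carrier G. \<exists>a\<in>F. d x a < r"
    using tb[OF r(1)] by auto
  have UCs: "UC (\<lambda>x. \<Sum>a\<in>F. f (x \<otimes> a))" using F f by (intro UC_sum UC_right) auto
  have "c \<le> (\<Sum>a\<in>F. f (x \<otimes> a))" if x: "x \<in> carrier G" for x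
  proof -
    obtain a where a: "a \<in> F" "d (inv x \<otimes> x0) a < r" using F(3) x x0 by auto
    have ac: "a \<in> carrier G" using a F by blast
    have "d (x \<otimes> a) x0 = d (x \<otimes> a) (x \<otimes> (inv x \<otimes> x0))" using x x0 by (simp flip: m_assoc)
    also have "\<dots> = d a (inv x \<otimes> x0)" using x x0 ac by (intro d_left) auto
    also have "\<dots> < r" using a d_sym[OF ac, of "inv x \<otimes> x0"] x x0 by auto
    finally have "\<bar>f (x \<otimes> a) - f x0\<bar> < c" using r(2) x x0 ac by auto
    then have "c \<le> f (x \<otimes> a)" unfolding c_def by (simp add: field_simps abs_if split: if_splits)
    also have "\<dots> \<le> (\<Sum>a\<in>F. f (x \<otimes> a))" using a F nn x by (intro member_le_sum) auto
    finally show ?thesis .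
  qed
  then have "c \<le> mean (\<lambda>x. \<Sum>a\<in>F. f (x \<otimes> a))"
    using mean_mono[OF UC_const UCs, of c] by simp
  also have "\<dots> = (\<Sum>a\<in>F. mean f)"
    using F f by (subst mean_sum) (auto simp: subset_eq mean_right intro: UC_right)
  finally have "c \<le> real (card F) * mean f" by simp
  then show ?thesis using c by (metis less_le_trans of_nat_0_le_iff zero_less_mult_pos zero_less_mult_iff not_less)
qed

lemma partition_of_unity:
  assumes e: "e > 0"
  obtains F P where "finite F" "F \<subseteq> carrier G" "\<And>a. a \<in> F \<Longrightarrow> UC (P a)"
    "\<And>a x. a \<in> F \<Longrightarrow> x \<in> carrier G \<Longrightarrow> 0 \<le> P a x" "\<And>x. x \<in> carrier G \<Longrightarrow> (\<Sum>a\<in>F. P a x) = 1"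
    "\<And>a x. a \<in> F \<Longrightarrow> x \<in> carrier G \<Longrightarrow> P a x \<noteq> 0 \<Longrightarrow> d x a < e"
proof -
  obtain F where F: "finite F" "F \<subseteq> carrier G" "\<forall>x\<in>carrier G. \<exists>a\<in>F. d x a < e / 2"
    using tb[of "e/2"] e by auto
  define p where "p a x = max 0 (e - d x a)" for a x
  define S where "S x = (\<Sum>a\<in>F. p a x)" for x
  have UCp: "UC (p a)" if "a \<in> F" for a
  proof (rule UC_by_two)
    show "UC (\<lambda>x. d x a)" "UC (\<lambda>x. d x a)" using UC_dist that F by blast+
    show "\<exists>s>0. \<forall>x\<in>carrier G. \<forall>y\<in>carrier G. \<bar>d x a - d y a\<bar> < s \<longrightarrow>
      \<bar>d x a - d y a\<bar> < s \<longrightarrow> \<bar>p a x - p a y\<bar> < e" if "e > 0" for e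
      by (rule exI[of _ e]) (use that in \<open>auto simp: p_def max_def\<close>)
  qed
  have UCS: "UC S" unfolding S_def using UCp by (rule UC_sum)
  have Spos: "e / 2 \<le> S x" if x: "x \<in> carrier G" for x
  proof -
    obtain a where a: "a \<in> F" "d x a < e/2" using F x by blast
    have "e / 2 \<le> p a x" using a by (simp add: p_def max_def)
    also have "\<dots> \<le> S x" unfolding S_def using a F by (intro member_le_sum) (auto simp: p_def)
    finally show ?thesis .
  qed
  show ?thesis
  proof (rule that[OF F(1,2), of "\<lambda>a x. p a x * (1 / S x)"])
    show "UC (\<lambda>x. p a x * (1 / S x))" if "a \<in> F" for a
      using UC_mult[OF UCp[OF that] UC_inverse[OF UCS _ Spos]] e by simp
    fix x assume x: "x \<in> carrier G"
    have S0: "S x > 0" using Spos[OF x] e by linarith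
    show "(\<Sum>a\<in>F. p a x * (1 / S x)) = 1"
      using S0 unfolding S_def by (simp flip: sum_divide_distrib)
    fix a assume a: "a \<in> F"
    show "0 \<le> p a x * (1 / S x)" using S0 by (simp add: p_def)
    show "d x a < e" if "p a x * (1 / S x) \<noteq> 0"
      using that by (auto simp: p_def max_def split: if_splits)
  qed
qed

text \<open>Fubini's theorem for the mean. With a fine partition of unity \<open>P\<close>, the function
\<open>F x y\<close> is uniformly close to \<open>\<Sum>a. P a x * F a y\<close>, for which both
iterated means are the same finite sum.\<close>

lemma mean_swap:
  assumes x: "\<And>e. e > 0 \<Longrightarrow> \<exists>r>0. \<forall>x\<in>carrier G. \<forall>x'\<in>carrier G. \<forall>y\<in>carrier G. d x x' < r \<longrightarrow> \<bar>F x y - F x' y\<bar> < e"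
    and y: "\<And>x. x \<in> carrier G \<Longrightarrow> UC (F x)"
  shows "UC (\<lambda>x. mean (F x))" "UC (\<lambda>y. mean (\<lambda>x. F x y))"
    "mean (\<lambda>x. mean (F x)) = mean (\<lambda>y. mean (\<lambda>x. F x y))"
proof -
  have UCx: "UC (\<lambda>x. F x y)" if "y \<in> carrier G" for y
    unfolding UC_def using x that by meson
  have key: "\<exists>h. UC h \<and> (\<forall>x\<in>carrier G. \<bar>mean (F x) - h x\<bar> \<le> e) \<and>
     (\<exists>k. UC k \<and> (\<forall>y\<in>carrier G. \<bar>mean (\<lambda>x. F x y) - k y\<bar> \<le> e) \<and> mean h = mean k)" if e: "e > 0" for e
  proof -
    obtain r where r: "r > 0" "\<forall>x\<in>carrier G. \<forall>x'\<in>carrier G. \<forall>y\<in>carrier G. d x x' < r \<longrightarrow> \<bar>F x y - F x' y\<bar> < e"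
      using x[OF e] by blast
    obtain S P where P: "finite S" "S \<subseteq> carrier G" "\<And>a. a \<in> S \<Longrightarrow> UC (P a)"
      "\<And>a x. a \<in> S \<Longrightarrow> x \<in> carrier G \<Longrightarrow> 0 \<le> P a x" "\<And>x. x \<in> carrier G \<Longrightarrow> (\<Sum>a\<in>S. P a x) = 1"
      "\<And>a x. a \<in> S \<Longrightarrow> x \<in> carrier G \<Longrightarrow> P a x \<noteq> 0 \<Longrightarrow> d x a < r"
      using partition_of_unity[OF r(1)] by metis
    define A where "A x y = (\<Sum>a\<in>S. P a x * F a y)" for x y
    have UCF: "UC (F a)" if "a \<in> S" for a using that P y by blast
    have close: "\<bar>F x y - A x y\<bar> \<le> e" if xy: "x \<in> carrier G" "y \<in> carrier G" for x y
    proof -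
      have "F x y - A x y = (\<Sum>a\<in>S. P a x * F x y) - (\<Sum>a\<in>S. P a x * F a y)"
        using P(5)[OF xy(1)] by (simp add: A_def flip: sum_distrib_right)
      also have "\<dots> = (\<Sum>a\<in>S. P a x * (F x y - F a y))"
        by (simp add: right_diff_distrib sum_subtractf)
      finally have "\<bar>F x y - A x y\<bar> \<le> (\<Sum>a\<in>S. \<bar>P a x * (F x y - F a y)\<bar>)"
        by (simp add: sum_abs)
      also have "\<dots> \<le> (\<Sum>a\<in>S. P a x * e)"
      proof (rule sum_mono)
        fix a assume a: "a \<in> S"
        show "\<bar>P a x * (F x y - F a y)\<bar> \<le> P a x * e"
        proof (cases "P a x = 0")
          case False
          then have "\<bar>F x y - F a y\<bar> \<le> e" using P(2) P(6)[of a x] a xy r(2) by force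
          then show ?thesis using P(4)[OF a xy(1)] by (simp add: abs_mult mult_left_mono)
        qed simp
      qed
      also have "\<dots> = e" using P(5)[OF xy(1)] by (simp flip: sum_distrib_right)
      finally show ?thesis .
    qed
    have UCA1: "UC (A x)" if "x \<in> carrier G" for x
      unfolding A_def by (intro UC_sum UC_cmult UCF)
    have UCA2: "UC (\<lambda>x. A x y)" for y
      unfolding A_def by (intro UC_sum UC_multc P(3))
    have mA1: "mean (A x) = (\<Sum>a\<in>S. P a x * mean (F a))" for x
      unfolding A_def using UCF by (subst mean_sum) (auto intro: UC_cmult simp: mean_cmult)
    have UCm: "UC (\<lambda>x. mean (A x))"
      unfolding mA1 by (intro UC_sum UC_multc P(3))
    have mA2: "mean (\<lambda>x. A x y) = (\<Sum>a\<in>S. mean (P a) * F a y)" for y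
      unfolding A_def using P(3)
      by (subst mean_sum) (auto intro: UC_multc simp: mean_multc)
    have UCk: "UC (\<lambda>y. mean (\<lambda>x. A x y))"
      unfolding mA2 by (intro UC_sum UC_cmult UCF)
    have 1: "\<bar>mean (F x) - mean (A x)\<bar> \<le> e" if "x \<in> carrier G" for x
      using mean_abs_le[OF UC_diff[OF y[OF that] UCA1[OF that]], of e] close that by (simp add: mean_diff y UCA1)
    have 2: "\<bar>mean (\<lambda>x. F x y) - mean (\<lambda>x. A x y)\<bar> \<le> e" if "y \<in> carrier G" for y
      using mean_abs_le[OF UC_diff[OF UCx[OF that] UCA2], of y e] close that by (simp add: mean_diff UCx UCA2)
    have 3: "mean (\<lambda>x. mean (A x)) = mean (\<lambda>y. mean (\<lambda>x. A x y))"
      unfolding mA1 mA2 using P(3) UCF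
      by (subst (1 2) mean_sum) (auto intro: UC_multc UC_cmult simp: mean_multc mean_cmult)
    show ?thesis using 1 2 3 UCm UCk by blast
  qed
  show U1: "UC (\<lambda>x. mean (F x))"
  proof (rule UC_uniform_limit)
    fix e :: real assume "e > 0"
    then show "\<exists>h. UC h \<and> (\<forall>x\<in>carrier G. \<bar>mean (F x) - h x\<bar> < e)"
      using key[of "e/2"] by (force intro: le_less_trans)
  qed
  show U2: "UC (\<lambda>y. mean (\<lambda>x. F x y))"
  proof (rule UC_uniform_limit)
    fix e :: real assume "e > 0"
    then show "\<exists>h. UC h \<and> (\<forall>y\<in>carrier G. \<bar>mean (\<lambda>x. F x y) - h y\<bar> < e)"
      using key[of "e/2"] by (force intro: le_less_trans)
  qed
  have "\<bar>mean (\<lambda>x. mean (F x)) - mean (\<lambda>y. mean (\<lambda>x. F x y))\<bar> \<le> 0 + e" if e: "e > 0" for e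
  proof -
    obtain h k where h: "UC h" "\<forall>x\<in>carrier G. \<bar>mean (F x) - h x\<bar> \<le> e/2"
       and k: "UC k" "\<forall>y\<in>carrier G. \<bar>mean (\<lambda>x. F x y) - k y\<bar> \<le> e/2" and hk: "mean h = mean k"
      using key[of "e/2"] e by auto
    have "\<bar>mean (\<lambda>x. mean (F x)) - mean h\<bar> \<le> e/2"
      using mean_abs_le[OF UC_diff[OF U1 h(1)], of "e/2"] h U1 by (simp add: mean_diff)
    moreover have "\<bar>mean (\<lambda>y. mean (\<lambda>x. F x y)) - mean k\<bar> \<le> e/2"
      using mean_abs_le[OF UC_diff[OF U2 k(1)], of "e/2"] k U2 by (simp add: mean_diff)
    ultimately show ?thesis using hk by linarith
  qed
  then have "\<bar>mean (\<lambda>x. mean (F x)) - mean (\<lambda>y. mean (\<lambda>x. F x y))\<bar> \<le> 0" by (rule field_le_epsilon)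
  then show "mean (\<lambda>x. mean (F x)) = mean (\<lambda>y. mean (\<lambda>x. F x y))" by simp
qed

end

context totally_bounded_group
begin

definition ip :: "('a \<Rightarrow> real) \<Rightarrow> ('a \<Rightarrow> real) \<Rightarrow> real" where
  "ip f g = mean (\<lambda>x. f x * g x)"

lemma ip_commute: "ip f g = ip g f"
  by (simp add: ip_def mult.commute)

lemma ip_diff_left: "UC f \<Longrightarrow> UC g \<Longrightarrow> UC h \<Longrightarrow> ip (\<lambda>x. f x - g x) h = ip f h - ip g h"
  by (simp add: ip_def ring_distribs mean_diff UC_mult)

lemma ip_cmult_left: "UC f \<Longrightarrow> UC h \<Longrightarrow> ip (\<lambda>x. c * f x) h = c * ip f h"
  by (simp add: ip_def mult.assoc mean_cmult UC_mult)

lemma ip_sum_left: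
  "(\<And>i. i \<in> I \<Longrightarrow> UC (f i)) \<Longrightarrow> UC h \<Longrightarrow> ip (\<lambda>x. \<Sum>i\<in>I. f i x) h = (\<Sum>i\<in>I. ip (f i) h)"
  by (simp add: ip_def sum_distrib_right mean_sum UC_mult)

lemma ip_combination_left:
  "(\<And>i. i \<in> I \<Longrightarrow> UC (f i)) \<Longrightarrow> UC h \<Longrightarrow> ip (\<lambda>x. \<Sum>i\<in>I. c i * f i x) h = (\<Sum>i\<in>I. c i * ip (f i) h)"
  by (subst ip_sum_left) (auto simp: ip_cmult_left UC_cmult)

lemma ip_cong:
  assumes "UC f" "UC g" "\<And>x. x \<in> carrier G \<Longrightarrow> f x = f' x" "\<And>x. x \<in> carrier G \<Longrightarrow> g x = g' x"
  shows "ip f g = ip f' g'"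
  unfolding ip_def by (rule mean_cong) (use assms in \<open>auto intro: UC_mult\<close>)

lemma ip_nonneg: "UC f \<Longrightarrow> 0 \<le> ip f f"
  unfolding ip_def by (rule mean_nonneg) (auto intro: UC_mult)

lemma ip_eq_0:
  assumes "UC f" "ip f f = 0" "x \<in> carrier G" shows "f x = 0"
proof (rule ccontr)
  assume "f x \<noteq> 0"
  then have "f x * f x > 0" by (metis not_real_square_gt_zero)
  then have "ip f f > 0" unfolding ip_def using assms by (intro mean_pos[of _ x] UC_mult) auto
  with assms show False by simp
qed

lemma ip_le:
  assumes "UC f" "\<And>x. x \<in> carrier G \<Longrightarrow> \<bar>f x\<bar> \<le> B" shows "ip f f \<le> B\<^sup>2"
proof -
  have "f x * f x \<le> B\<^sup>2" if "x \<in> carrier G" for x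
    using assms(2)[OF that] by (metis abs_ge_zero abs_le_square_iff abs_of_nonneg order_trans power2_eq_square)
  then show ?thesis using mean_mono[of "\<lambda>x. f x * f x" "\<lambda>x. B\<^sup>2"] assms UC_mult by (simp add: ip_def)
qed

lemma cauchy_schwarz:
  assumes f: "UC f" and g: "UC g"
  shows "(ip f g)\<^sup>2 \<le> ip f f * ip g g"
proof (cases "ip g g = 0")
  case True
  then have "f x * g x = 0" if "x \<in> carrier G" for x using ip_eq_0[OF g _ that] by simp
  then have "ip f g = 0" unfolding ip_def using mean_cong[of "\<lambda>x. f x * g x" "\<lambda>_. 0"] f g UC_mult by simp
  then show ?thesis using True by simp
next
  case False
  then have p: "ip g g > 0" using ip_nonneg[OF g] by linarith
  define t where "t = ip f g / ip g g"
  have ug: "UC (\<lambda>x. t * g x)" using g by (rule UC_cmult)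
  have uh: "UC (\<lambda>x. f x - t * g x)" using f ug by (rule UC_diff)
  have "0 \<le> ip (\<lambda>x. f x - t * g x) (\<lambda>x. f x - t * g x)" using uh by (rule ip_nonneg)
  also have "\<dots> = ip f (\<lambda>x. f x - t * g x) - t * ip g (\<lambda>x. f x - t * g x)"
    using f g ug uh by (simp add: ip_diff_left ip_cmult_left)
  also have "ip f (\<lambda>x. f x - t * g x) = ip f f - t * ip f g"
    using f g ug by (simp add: ip_commute[of f "\<lambda>x. f x - t * g x"] ip_commute[of f g] ip_diff_left ip_cmult_left)
  also have "ip g (\<lambda>x. f x - t * g x) = ip f g - t * ip g g"
    using f g ug by (simp add: ip_commute[of g "\<lambda>x. f x - t * g x"] ip_diff_left ip_cmult_left)
  also have "ip f f - t * ip f g - t * (ip f g - t * ip g g) = ip f f - (ip f g)\<^sup>2 / ip g g"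
    using p by (simp add: t_def power2_eq_square field_simps)
  finally show ?thesis using p by (simp add: pos_divide_le_eq)
qed

lemma abs_ip_le:
  assumes f: "UC f" and g: "UC g" and B: "\<And>x. x \<in> carrier G \<Longrightarrow> \<bar>f x\<bar> \<le> B"
  shows "\<bar>ip f g\<bar> \<le> B * sqrt (ip g g)"
proof -
  have "B \<ge> 0" using B[OF one_closed] by linarith
  have "(ip f g)\<^sup>2 \<le> B\<^sup>2 * ip g g"
    using cauchy_schwarz[OF f g] ip_le[OF f B] ip_nonneg[OF g] by (meson mult_right_mono order_trans)
  then have "sqrt ((ip f g)\<^sup>2) \<le> sqrt (B\<^sup>2 * ip g g)" by (rule real_sqrt_le_mono)
  then show ?thesis using \<open>B \<ge> 0\<close> by (simp add: real_sqrt_mult)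
qed

lemma ip_right:
  assumes "UC f" "UC g" "a \<in> carrier G"
  shows "ip (\<lambda>x. f (x \<otimes> a)) (\<lambda>x. g (x \<otimes> a)) = ip f g"
  unfolding ip_def using mean_right[OF UC_mult[OF assms(1,2)] assms(3)] .

section \<open>The convolution operator\<close>

text \<open>A kernel that depends on the distance only is symmetric and invariant under right translation of both
arguments.\<close>

definition bump :: "real \<Rightarrow> 'a \<Rightarrow> 'a \<Rightarrow> real" where
  "bump r x y = max 0 (r - d x y)"

definition conv :: "real \<Rightarrow> ('a \<Rightarrow> real) \<Rightarrow> 'a \<Rightarrow> real" where
  "conv r f x = ip (bump r x) f"

lemma bump_bounds: "r \<ge> 0 \<Longrightarrow> x \<in> carrier G \<Longrightarrow> y \<in> carrier G \<Longrightarrow> \<bar>bump r x y\<bar> \<le> r"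
  using d_nonneg[of x y] by (auto simp: bump_def max_def)

lemma bump_sym: "x \<in> carrier G \<Longrightarrow> y \<in> carrier G \<Longrightarrow> bump r x y = bump r y x"
  using d_sym[of x y] by (simp add: bump_def)

lemma bump_lip:
  assumes "x \<in> carrier G" "y \<in> carrier G" "z \<in> carrier G"
  shows "\<bar>bump r x z - bump r y z\<bar> \<le> d x y"
proof -
  have "\<bar>d x z - d y z\<bar> \<le> d x y"
    using d_tri[of x y z] d_tri[of y x z] d_sym[of x y] assms by (auto simp: abs_le_iff)
  then show ?thesis by (auto simp: bump_def max_def)
qed

lemma UC_bump: "x \<in> carrier G \<Longrightarrow> UC (bump r x)"
  by (rule UC_lipschitz[of _ 1]) (use bump_lip[of _ _ x r] bump_sym[of x _ r] in auto)

lemma abs_conv_le: "r \<ge> 0 \<Longrightarrow> UC f \<Longrightarrow> x \<in> carrier G \<Longrightarrow> \<bar>conv r f x\<bar> \<le> r * sqrt (ip f f)"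
  unfolding conv_def by (intro abs_ip_le UC_bump bump_bounds)

text \<open>Together with \<open>abs_conv_le\<close> this is the compactness of the operator: it takes a ball of the
inner product seminorm to a bounded family of functions with a common Lipschitz constant.\<close>

lemma conv_lip:
  assumes "UC f" "x \<in> carrier G" "y \<in> carrier G"
  shows "\<bar>conv r f x - conv r f y\<bar> \<le> d x y * sqrt (ip f f)"
proof -
  have "conv r f x - conv r f y = ip (\<lambda>z. bump r x z - bump r y z) f"
    using assms by (simp add: conv_def ip_diff_left UC_bump)
  then show ?thesis using assms by (auto intro!: abs_ip_le UC_diff UC_bump bump_lip)
qed

lemma UC_conv: "UC f \<Longrightarrow> UC (conv r f)"
  by (rule UC_lipschitz[of _ "sqrt (ip f f)"]) (simp add: conv_lip mult.commute)

lemma conv_cong: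
  "UC f \<Longrightarrow> (\<And>y. y \<in> carrier G \<Longrightarrow> f y = g y) \<Longrightarrow> x \<in> carrier G \<Longrightarrow> conv r f x = conv r g x"
  unfolding conv_def by (rule ip_cong) (auto intro: UC_bump)

lemma conv_diff: "UC f \<Longrightarrow> UC g \<Longrightarrow> x \<in> carrier G \<Longrightarrow> conv r (\<lambda>y. f y - g y) x = conv r f x - conv r g x"
  by (simp add: conv_def ip_commute[of "bump r x"] ip_diff_left UC_bump)

lemma conv_cmult: "UC f \<Longrightarrow> x \<in> carrier G \<Longrightarrow> conv r (\<lambda>y. c * f y) x = c * conv r f x"
  by (simp add: conv_def ip_commute[of "bump r x"] ip_cmult_left UC_bump)

lemma conv_combination: "(\<And>i. i \<in> I \<Longrightarrow> UC (f i)) \<Longrightarrow> x \<in> carrier G \<Longrightarrow>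
    conv r (\<lambda>y. \<Sum>i\<in>I. c i * f i y) x = (\<Sum>i\<in>I. c i * conv r (f i) x)"
  by (simp add: conv_def ip_commute[of "bump r x"] ip_combination_left UC_bump)

lemma conv_right:
  assumes "UC f" "a \<in> carrier G" "x \<in> carrier G"
  shows "conv r (\<lambda>z. f (z \<otimes> a)) x = conv r f (x \<otimes> a)"
proof -
  have "conv r f (x \<otimes> a) = mean (\<lambda>y. bump r (x \<otimes> a) (y \<otimes> a) * f (y \<otimes> a))"
    unfolding conv_def ip_def
    using mean_right[OF UC_mult[OF UC_bump assms(1)] assms(2), of "x \<otimes> a" r] assms by simp
  also have "\<dots> = conv r (\<lambda>z. f (z \<otimes> a)) x"
    unfolding conv_def ip_def using assms
    by (intro mean_cong[OF UC_right[OF UC_mult[OF UC_bump]]]) (auto simp: bump_def d_right)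
  finally show ?thesis by simp
qed

lemma conv_sym:
  assumes r: "r \<ge> 0" and f: "UC f" and g: "UC g"
  shows "ip (conv r f) g = ip f (conv r g)"
proof -
  define F where "F = (\<lambda>x y. bump r x y * f y * g x)"
  obtain B where B: "B > 0" "\<And>x. x \<in> carrier G \<Longrightarrow> \<bar>f x\<bar> \<le> B" using UC_bounded[OF f] by blast
  obtain C where C: "C > 0" "\<And>x. x \<in> carrier G \<Longrightarrow> \<bar>g x\<bar> \<le> C" using UC_bounded[OF g] by blast
  have equi: "\<exists>s>0. \<forall>x\<in>carrier G. \<forall>x'\<in>carrier G. \<forall>y\<in>carrier G. d x x' < s \<longrightarrow> \<bar>F x y - F x' y\<bar> < e"
    if e: "e > 0" for e
  proof -
    define q where "q = e / (2 * B * (r + 1))"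
    have q: "q > 0" using e B r by (simp add: q_def)
    obtain s where s: "s > 0" "\<And>x y. x \<in> carrier G \<Longrightarrow> y \<in> carrier G \<Longrightarrow> d x y < s \<Longrightarrow> \<bar>g x - g y\<bar> < q"
      using UC_obtain[OF g q] by blast
    show ?thesis
    proof (intro exI[of _ "min s (e / (2 * B * C))"] conjI ballI impI)
      fix x x' y assume xy: "x \<in> carrier G" "x' \<in> carrier G" "y \<in> carrier G"
        and dd: "d x x' < min s (e / (2 * B * C))"
      have "F x y - F x' y = (bump r x y - bump r x' y) * f y * g x + bump r x' y * f y * (g x - g x')"
        by (simp add: F_def algebra_simps)
      then have "\<bar>F x y - F x' y\<bar> \<le> \<bar>bump r x y - bump r x' y\<bar> * \<bar>f y\<bar> * \<bar>g x\<bar> + \<bar>bump r x' y\<bar> * \<bar>f y\<bar> * \<bar>g x - g x'\<bar>"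
        by (metis abs_mult abs_triangle_ineq)
      also have "\<dots> \<le> d x x' * B * C + r * B * q"
        using bump_lip[of x x' y r] bump_bounds[of r x' y] B C s(2)[of x x'] xy dd r q d_nonneg[of x x']
        by (intro add_mono mult_mono) (auto intro: less_imp_le)
      also have "d x x' * B * C < e / 2" using dd B C by (simp add: field_simps)
      also have "r * B * q \<le> e / 2"
      proof -
        have "r * B * q \<le> (r + 1) * B * q" using B q by (intro mult_right_mono) auto
        also have "\<dots> = e / 2" using B r by (simp add: q_def)
        finally show ?thesis .
      qed
      finally show "\<bar>F x y - F x' y\<bar> < e" by simp
    qed (use s e B C in auto)
  qed
  have U: "UC (F x)" if "x \<in> carrier G" for x
    unfolding F_def using that f by (intro UC_multc UC_mult UC_bump)
  have "ip (conv r f) g = mean (\<lambda>x. mean (F x))"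
    unfolding ip_def[of "conv r f"]
    by (rule mean_cong[OF UC_mult[OF UC_conv[OF f] g]])
       (use f g in \<open>simp add: conv_def ip_def F_def mean_multc UC_mult UC_bump\<close>)
  also have "\<dots> = mean (\<lambda>y. mean (\<lambda>x. F x y))" using equi U by (rule mean_swap)
  also have "\<dots> = ip f (conv r g)"
    unfolding ip_def[of f]
  proof (rule mean_cong[OF mean_swap(2)[OF equi U]])
    fix y assume y: "y \<in> carrier G"
    have u: "UC (\<lambda>x. f y * (bump r y x * g x))" by (intro UC_cmult UC_mult UC_bump y g)
    have "mean (\<lambda>x. F x y) = mean (\<lambda>x. f y * (bump r y x * g x))"
      by (rule mean_cong[symmetric, OF u]) (use y bump_sym in \<open>simp add: F_def\<close>)
    also have "\<dots> = f y * conv r g y"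
      using y g by (simp add: conv_def ip_def mean_cmult UC_mult UC_bump)
    finally show "mean (\<lambda>x. F x y) = f y * conv r g y" .
  qed
  finally show ?thesis .
qed

text \<open>The values on the countable dense union of the nets form a sequence in a compact cube of a countable power
of the reals; a subsequence that converges there converges uniformly, by the common Lipschitz constant.\<close>

lemma arzela_ascoli:
  fixes v :: "nat \<Rightarrow> 'a \<Rightarrow> real"
  assumes lip: "\<And>n x y. x \<in> carrier G \<Longrightarrow> y \<in> carrier G \<Longrightarrow> \<bar>v n x - v n y\<bar> \<le> L * d x y"
    and bd: "\<And>n x. x \<in> carrier G \<Longrightarrow> \<bar>v n x\<bar> \<le> B"
  obtains s :: "nat \<Rightarrow> nat" and g where "strict_mono s" "UC g"
    "\<And>e. e > 0 \<Longrightarrow> \<exists>N. \<forall>n\<ge>N. \<forall>x\<in>carrier G. \<bar>v (s n) x - g x\<bar> < e"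
proof -
  define D where "D = (\<Union>n. net n)"
  have D: "countable D" "D \<noteq> {}" "D \<subseteq> carrier G"
    unfolding D_def using net by (auto intro: countable_finite)
  define a where "a = from_nat_into D"
  have a: "range a = D" using range_from_nat_into D by (simp add: a_def)
  have aG: "a i \<in> carrier G" for i using a D by blast
  let ?K = "PiE UNIV (\<lambda>_::nat. {-B..B})"
  have "compactin (product_topology (\<lambda>i::nat. euclideanreal) UNIV) ?K"
    unfolding compactin_PiE by simp
  then have "compact ?K" by (simp add: euclidean_product_topology)
  then have sc: "seq_compact ?K" by (simp add: compact_imp_seq_compact)
  have "v n (a i) \<in> {-B..B}" for n i using bd[OF aG, of n i] by (simp add: abs_le_iff)
  then have "\<forall>n. (\<lambda>i. v n (a i)) \<in> ?K" by (auto simp: PiE_UNIV_domain)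
  then obtain l s where s: "strict_mono s" and l: "((\<lambda>n i. v n (a i)) \<circ> s) \<longlonglongrightarrow> l"
    using sc[unfolded seq_compact_def, rule_format, of "\<lambda>n i. v n (a i)"] by blast
  have lim: "(\<lambda>n. v (s n) (a i)) \<longlonglongrightarrow> l i" for i
    using l unfolding limitin_canonical_iff[symmetric] euclidean_product_topology[symmetric]
    by (simp add: limitin_componentwise o_def)
  have unif: "\<exists>N. \<forall>m\<ge>N. \<forall>n\<ge>N. \<forall>x\<in>carrier G. \<bar>v (s m) x - v (s n) x\<bar> < e" if e: "e > 0" for e
  proof -
    define p where "p = \<bar>L\<bar> + 1"
    have p: "p > 0" "L \<le> p" by (simp_all add: p_def)
    have "e / (4 * p) > 0" using e p by simp
    then obtain k where k: "inverse (real (Suc k)) < e / (4 * p)" using reals_Archimedean by blast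
    have "\<exists>N. \<forall>n\<ge>N. \<forall>m\<ge>N. \<bar>v (s m) b - v (s n) b\<bar> < e / 4" if b: "b \<in> net k" for b
    proof -
      have "b \<in> range a" using b unfolding a D_def by blast
      then obtain i where "b = a i" by blast
      then have "Cauchy (\<lambda>n. v (s n) b)" using lim LIMSEQ_imp_Cauchy by blast
      then show ?thesis using e unfolding Cauchy_def dist_real_def by (metis zero_less_divide_iff zero_less_numeral)
    qed
    then obtain N where N: "\<And>b m n. b \<in> net k \<Longrightarrow> m \<ge> N b \<Longrightarrow> n \<ge> N b \<Longrightarrow> \<bar>v (s m) b - v (s n) b\<bar> < e / 4"
      by metis
    define M where "M = Max (N ` net k)"
    have M: "N b \<le> M" if "b \<in> net k" for b using that net(1) by (auto simp: M_def)
    show ?thesis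
    proof (intro exI[of _ M] allI impI ballI)
      fix m n x assume mn: "M \<le> m" "M \<le> n" and x: "x \<in> carrier G"
      obtain b where b: "b \<in> net k" "d x b < inverse (real (Suc k))" using net(3)[OF x] by blast
      have bG: "b \<in> carrier G" using b by simp
      have "L * d x b \<le> p * d x b" using d_nonneg[OF x bG] p by (intro mult_right_mono) auto
      also have "\<dots> \<le> p * (e / (4 * p))" using b k p by (intro mult_left_mono) auto
      also have "\<dots> = e / 4" using p by simp
      finally have Lb: "L * d x b \<le> e / 4" .
      have "\<bar>v (s m) b - v (s n) b\<bar> < e / 4" using N[OF b(1)] M[OF b(1)] mn by force
      then show "\<bar>v (s m) x - v (s n) x\<bar> < e"
        using lip[OF x bG, of "s m"] lip[OF x bG, of "s n"] Lb e by linarith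
    qed
  qed
  define g where "g x = lim (\<lambda>n. v (s n) x)" for x
  have glim: "(\<lambda>n. v (s n) x) \<longlonglongrightarrow> g x" if "x \<in> carrier G" for x
  proof -
    have "Cauchy (\<lambda>n. v (s n) x)"
      unfolding Cauchy_def dist_real_def using unif that by meson
    then show ?thesis unfolding g_def by (simp add: Cauchy_convergent convergent_LIMSEQ_iff[symmetric])
  qed
  have conv: "\<exists>N. \<forall>n\<ge>N. \<forall>x\<in>carrier G. \<bar>v (s n) x - g x\<bar> < e" if e: "e > 0" for e
  proof -
    obtain N where N: "\<forall>m\<ge>N. \<forall>n\<ge>N. \<forall>x\<in>carrier G. \<bar>v (s m) x - v (s n) x\<bar> < e/2"
      using unif[of "e/2"] e by auto
    show ?thesis
    proof (intro exI[of _ N] allI impI ballI)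
      fix n x assume n: "N \<le> n" and x: "x \<in> carrier G"
      have "(\<lambda>m. \<bar>v (s n) x - v (s m) x\<bar>) \<longlonglongrightarrow> \<bar>v (s n) x - g x\<bar>"
        by (intro tendsto_intros glim x)
      moreover have "\<forall>m\<ge>N. \<bar>v (s n) x - v (s m) x\<bar> \<le> e/2" using N n x by (auto intro: less_imp_le)
      ultimately have "\<bar>v (s n) x - g x\<bar> \<le> e/2" by (meson LIMSEQ_le_const2)
      then show "\<bar>v (s n) x - g x\<bar> < e" using e by linarith
    qed
  qed
  have "UC g"
  proof (rule UC_uniform_limit)
    fix e :: real assume "e > 0"
    then obtain N where "\<forall>x\<in>carrier G. \<bar>v (s N) x - g x\<bar> < e" using conv by blast
    moreover have "UC (v (s N))" using lip by (rule UC_lipschitz)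
    ultimately show "\<exists>h. UC h \<and> (\<forall>x\<in>carrier G. \<bar>g x - h x\<bar> < e)"
      by (metis abs_minus_commute)
  qed
  then show ?thesis by (rule that[OF s]) (rule conv)
qed

section \<open>Eigenfunctions of the squared operator\<close>

text \<open>Eigenfunctions are taken for the square of \<open>conv r\<close>: its largest eigenvalue on an invariant
subspace is the square of the norm, so a maximizing sequence leads to an eigenfunction without a distinction
of signs. The zero function counts as an eigenfunction.\<close>

definition eigenfunction :: "real \<Rightarrow> real \<Rightarrow> ('a \<Rightarrow> real) \<Rightarrow> bool" where
  "eigenfunction r \<mu> v \<longleftrightarrow> UC v \<and> (\<forall>x\<in>carrier G. conv r (conv r v) x = \<mu> * v x)"

definition eigenfamily :: "real \<Rightarrow> real \<Rightarrow> nat \<Rightarrow> (nat \<Rightarrow> 'a \<Rightarrow> real) \<Rightarrow> bool" where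
  "eigenfamily r e n u \<longleftrightarrow> (\<forall>i<n. \<exists>\<mu>\<ge>e. eigenfunction r \<mu> (u i)) \<and>
     (\<forall>i<n. \<forall>j<n. ip (u i) (u j) = (if i = j then 1 else 0))"

lemma eigenfunction_ip:
  assumes r: "r \<ge> 0" and v: "eigenfunction r \<mu> v" and w: "UC w"
  shows "ip (conv r (conv r w)) v = \<mu> * ip w v"
proof -
  have uv: "UC v" and ev: "\<And>x. x \<in> carrier G \<Longrightarrow> conv r (conv r v) x = \<mu> * v x"
    using v by (auto simp: eigenfunction_def)
  have "ip (conv r (conv r w)) v = ip w (conv r (conv r v))"
    using r uv w by (simp add: conv_sym UC_conv)
  also have "\<dots> = ip w (\<lambda>x. \<mu> * v x)" using uv w ev by (intro ip_cong) (auto intro: UC_conv)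
  also have "\<dots> = \<mu> * ip w v" using uv w by (simp add: ip_commute[of w] ip_cmult_left)
  finally show ?thesis .
qed

lemma eigenfunction_orthogonal:
  assumes r: "r \<ge> 0" and v: "eigenfunction r \<mu> v" and w: "eigenfunction r \<nu> w" and ne: "\<mu> \<noteq> \<nu>"
  shows "ip v w = 0"
proof -
  have uv: "UC v" "UC w" and ev: "\<And>x. x \<in> carrier G \<Longrightarrow> conv r (conv r v) x = \<mu> * v x"
    using v w by (auto simp: eigenfunction_def)
  have "\<nu> * ip v w = ip (conv r (conv r v)) w" using eigenfunction_ip[OF r w uv(1)] by simp
  also have "\<dots> = ip (\<lambda>x. \<mu> * v x) w" using uv ev by (intro ip_cong) (auto intro: UC_conv)
  also have "\<dots> = \<mu> * ip v w" using uv by (simp add: ip_cmult_left)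
  finally show ?thesis using ne by simp
qed

lemma eigenfunction_right:
  assumes "eigenfunction r \<mu> v" "a \<in> carrier G"
  shows "eigenfunction r \<mu> (\<lambda>x. v (x \<otimes> a))"
  unfolding eigenfunction_def
proof (intro conjI ballI)
  have uv: "UC v" and ev: "\<And>x. x \<in> carrier G \<Longrightarrow> conv r (conv r v) x = \<mu> * v x"
    using assms by (auto simp: eigenfunction_def)
  show uva: "UC (\<lambda>x. v (x \<otimes> a))" using uv assms(2) by (rule UC_right)
  fix x assume x: "x \<in> carrier G"
  have "conv r (conv r (\<lambda>x. v (x \<otimes> a))) x = conv r (\<lambda>x. conv r v (x \<otimes> a)) x"
    using uv uva assms x by (intro conv_cong) (auto intro: UC_conv simp: conv_right)
  also have "\<dots> = \<mu> * v (x \<otimes> a)"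
    using uv assms x ev by (simp add: conv_right UC_conv)
  finally show "conv r (conv r (\<lambda>x. v (x \<otimes> a))) x = \<mu> * v (x \<otimes> a)" .
qed

lemma eigenfunction_conv:
  assumes "eigenfunction r \<mu> v"
  shows "eigenfunction r \<mu> (conv r v)"
  unfolding eigenfunction_def
proof (intro conjI ballI)
  have uv: "UC v" and ev: "\<And>x. x \<in> carrier G \<Longrightarrow> conv r (conv r v) x = \<mu> * v x"
    using assms by (auto simp: eigenfunction_def)
  show "UC (conv r v)" using uv by (rule UC_conv)
  fix x assume x: "x \<in> carrier G"
  have "conv r (conv r (conv r v)) x = conv r (\<lambda>y. \<mu> * v y) x"
    using uv ev x by (intro conv_cong) (auto intro: UC_conv)
  then show "conv r (conv r (conv r v)) x = \<mu> * conv r v x" using uv x by (simp add: conv_cmult)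
qed

lemma bessel:
  fixes n :: nat
  assumes q: "UC q" and u: "\<And>i. i < n \<Longrightarrow> UC (u i)"
    and on: "\<And>i j. i < n \<Longrightarrow> j < n \<Longrightarrow> ip (u i) (u j) = (if i = j then 1 else 0)"
  shows "(\<Sum>i<n. (ip q (u i))\<^sup>2) \<le> ip q q"
proof -
  define p where "p = (\<lambda>x. \<Sum>i<n. ip q (u i) * u i x)"
  have up: "UC p" unfolding p_def using u by (intro UC_sum UC_cmult) auto
  have uqp: "UC (\<lambda>x. q x - p x)" using q up by (rule UC_diff)
  have ipp: "ip p w = (\<Sum>i<n. ip q (u i) * ip (u i) w)" if "UC w" for w
    unfolding p_def using u that by (subst ip_combination_left) auto
  have pq: "ip p q = (\<Sum>i<n. (ip q (u i))\<^sup>2)"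
    using ipp[OF q] by (simp add: power2_eq_square ip_commute[of _ q])
  have puj: "ip p (u j) = ip q (u j)" if j: "j < n" for j
  proof -
    have "ip p (u j) = (\<Sum>i<n. ip q (u i) * ip (u i) (u j))" by (rule ipp[OF u[OF j]])
    also have "\<dots> = (\<Sum>i<n. if i = j then ip q (u j) else 0)" using on j by (intro sum.cong) auto
    also have "\<dots> = ip q (u j)" using j by (subst sum.delta) auto
    finally show ?thesis .
  qed
  have pp: "ip p p = (\<Sum>i<n. (ip q (u i))\<^sup>2)"
    using ipp[OF up] puj by (simp add: ip_commute[of "u _" p] power2_eq_square)
  have "0 \<le> ip (\<lambda>x. q x - p x) (\<lambda>x. q x - p x)" using uqp by (rule ip_nonneg)
  also have "\<dots> = ip q q - ip p q - (ip p q - ip p p)"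
    using q up uqp by (simp add: ip_diff_left ip_commute[of q "\<lambda>x. q x - p x"] ip_commute[of p "\<lambda>x. q x - p x"] ip_commute[of q p])
  finally show ?thesis using pq pp by simp
qed

text \<open>At a point \<open>x\<close>, Bessel's inequality for the function \<open>conv r (bump r x)\<close>,
whose inner products with the \<open>u i\<close> are multiples of \<open>u i x\<close>, bounds
\<open>\<Sum>i. (u i x)\<^sup>2\<close> independently of \<open>n\<close> and \<open>x\<close>. The mean
of this sum is \<open>n\<close>.\<close>

lemma eigenfamily_card:
  assumes r: "r \<ge> 0" and e: "e > 0" and fam: "eigenfamily r e n u"
  shows "real n \<le> (r\<^sup>2 / e)\<^sup>2"
proof -
  have u: "UC (u i)" if "i < n" for i using fam that by (auto simp: eigenfamily_def eigenfunction_def)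
  have on: "ip (u i) (u j) = (if i = j then 1 else 0)" if "i < n" "j < n" for i j
    using fam that by (auto simp: eigenfamily_def)
  have pt: "(\<Sum>i<n. u i x * u i x) \<le> (r\<^sup>2 / e)\<^sup>2" if x: "x \<in> carrier G" for x
  proof -
    let ?q = "conv r (bump r x)"
    have uq: "UC ?q" using x by (intro UC_conv UC_bump)
    have "\<bar>?q y\<bar> \<le> r\<^sup>2" if y: "y \<in> carrier G" for y
    proof -
      have "\<bar>?q y\<bar> \<le> r * sqrt (ip (bump r x) (bump r x))" using abs_conv_le[OF r UC_bump[OF x] y] .
      also have "\<dots> \<le> r * sqrt (r\<^sup>2)"
        using ip_le[OF UC_bump[OF x] bump_bounds[OF r x]] r by (intro mult_left_mono real_sqrt_le_mono)
      finally show ?thesis using r by (simp add: power2_eq_square)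
    qed
    then have qq: "ip ?q ?q \<le> (r\<^sup>2)\<^sup>2" using uq by (intro ip_le)
    have "(e * u i x)\<^sup>2 \<le> (ip ?q (u i))\<^sup>2" if i: "i < n" for i
    proof -
      obtain \<mu> where \<mu>: "\<mu> \<ge> e" "eigenfunction r \<mu> (u i)" using fam i by (auto simp: eigenfamily_def)
      have "ip ?q (u i) = ip (bump r x) (conv r (u i))" using r u[OF i] x by (simp add: conv_sym UC_bump)
      also have "\<dots> = \<mu> * u i x" using \<mu>(2) x by (simp add: eigenfunction_def flip: conv_def)
      finally show ?thesis
        using \<mu> e by (simp add: power_mult_distrib mult_right_mono power_mono)
    qed
    then have "(\<Sum>i<n. (e * u i x)\<^sup>2) \<le> (\<Sum>i<n. (ip ?q (u i))\<^sup>2)" by (intro sum_mono) auto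
    also have "\<dots> \<le> ip ?q ?q" by (rule bessel[OF uq]) (use u on in auto)
    also note qq
    finally have "e\<^sup>2 * (\<Sum>i<n. u i x * u i x) \<le> (r\<^sup>2)\<^sup>2"
      by (simp add: power2_eq_square sum_distrib_left mult_ac)
    then show ?thesis using e by (simp add: power_divide field_simps)
  qed
  have "real n = (\<Sum>i<n. ip (u i) (u i))" using on by simp
  also have "\<dots> = mean (\<lambda>x. \<Sum>i<n. u i x * u i x)"
    unfolding ip_def using u by (subst mean_sum) (auto intro: UC_mult)
  also have "\<dots> \<le> mean (\<lambda>x. (r\<^sup>2 / e)\<^sup>2)"
    using pt u by (intro mean_mono UC_sum UC_mult) auto
  finally show ?thesis by simp
qed

lemma maximal_eigenfamily:
  assumes r: "r \<ge> 0" and e: "e > 0"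
  obtains n u where "eigenfamily r e n u"
    "\<And>v \<mu>. eigenfunction r \<mu> v \<Longrightarrow> \<mu> \<ge> e \<Longrightarrow> (\<And>i. i < n \<Longrightarrow> ip v (u i) = 0) \<Longrightarrow> ip v v = 0"
proof -
  let ?P = "\<lambda>n. \<exists>u. eigenfamily r e n u"
  have "?P 0" by (simp add: eigenfamily_def)
  moreover have "\<forall>n. ?P n \<longrightarrow> n \<le> nat \<lceil>(r\<^sup>2 / e)\<^sup>2\<rceil>"
    using eigenfamily_card[OF r e] by (metis le_nat_iff of_nat_0_le_iff of_nat_le_iff real_nat_ceiling_ge order_trans)
  ultimately obtain n where n: "?P n" "\<And>m. ?P m \<Longrightarrow> m \<le> n"
    using Nat.ex_has_greatest_nat[of ?P 0 "nat \<lceil>(r\<^sup>2 / e)\<^sup>2\<rceil>"] by blast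
  then obtain u where u: "eigenfamily r e n u" by blast
  have "ip v v = 0" if v: "eigenfunction r \<mu> v" "\<mu> \<ge> e" "\<And>i. i < n \<Longrightarrow> ip v (u i) = 0" for v \<mu>
  proof (rule ccontr)
    assume nz: "ip v v \<noteq> 0"
    have uv: "UC v" using v by (simp add: eigenfunction_def)
    have uu: "UC (u i)" if "i < n" for i using u that by (auto simp: eigenfamily_def eigenfunction_def)
    define c where "c = 1 / sqrt (ip v v)"
    have cc: "c * (c * ip v v) = 1" using nz ip_nonneg[OF uv] by (simp add: c_def field_simps)
    define w where "w = (\<lambda>x. c * v x)"
    have uw: "UC w" unfolding w_def using uv by (rule UC_cmult)
    have "conv r (conv r w) x = \<mu> * w x" if x: "x \<in> carrier G" for x
    proof -
      have "conv r (conv r w) x = conv r (\<lambda>y. c * conv r v y) x"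
        using uv x uw by (intro conv_cong) (auto intro: UC_conv simp: w_def conv_cmult)
      then show ?thesis using v(1) uv x by (simp add: conv_cmult UC_conv eigenfunction_def w_def)
    qed
    then have ew: "eigenfunction r \<mu> w" using uw by (simp add: eigenfunction_def)
    have ww: "ip w w = 1"
      unfolding w_def using uv cc
      by (simp add: ip_cmult_left UC_cmult ip_commute[of v "\<lambda>x. c * v x"])
    have wu: "ip w (u i) = 0" "ip (u i) w = 0" if "i < n" for i
      using v(3)[OF that] uv uu[OF that] by (simp_all add: ip_commute[of "u i"] w_def ip_cmult_left)
    have "eigenfamily r e (Suc n) (u(n := w))"
      using u ew v(2) ww wu by (auto simp: eigenfamily_def less_Suc_eq)
    then have "Suc n \<le> n" using n(2) by blast
    then show False by simp
  qed
  with u that show ?thesis by blast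
qed

end

text \<open>The span of a maximal orthonormal family of eigenfunctions with eigenvalues at least \<open>e\<close>.
Maximality makes it contain every such eigenfunction, so it is invariant under all operators that preserve
eigenfunctions, in particular under right translations.\<close>

locale eigenspan = totally_bounded_group +
  fixes r e :: real and n :: nat and u :: "nat \<Rightarrow> 'a \<Rightarrow> real"
  assumes r: "r > 0" and e: "e > 0" and family: "eigenfamily r e n u"
    and maximal: "\<And>v \<mu>. eigenfunction r \<mu> v \<Longrightarrow> \<mu> \<ge> e \<Longrightarrow> (\<And>i. i < n \<Longrightarrow> ip v (u i) = 0) \<Longrightarrow> ip v v = 0"
begin

lemma r_nonneg: "r \<ge> 0" using r by simp

lemma UC_u: "i < n \<Longrightarrow> UC (u i)"
  using family by (auto simp: eigenfamily_def eigenfunction_def)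

lemma orthonormal: "i < n \<Longrightarrow> j < n \<Longrightarrow> ip (u i) (u j) = (if i = j then 1 else 0)"
  using family by (auto simp: eigenfamily_def)

definition proj :: "('a \<Rightarrow> real) \<Rightarrow> 'a \<Rightarrow> real" where
  "proj v x = (\<Sum>i<n. ip v (u i) * u i x)"

lemma UC_proj: "UC (proj v)"
  unfolding proj_def using UC_u by (intro UC_sum UC_cmult) auto

lemma ip_combination_u:
  assumes "j < n" shows "ip (\<lambda>x. \<Sum>i<n. c i * u i x) (u j) = c j"
proof -
  have "ip (\<lambda>x. \<Sum>i<n. c i * u i x) (u j) = (\<Sum>i<n. c i * ip (u i) (u j))"
    using UC_u assms by (subst ip_combination_left) auto
  also have "\<dots> = (\<Sum>i<n. if i = j then c i else 0)"
    using orthonormal assms by (intro sum.cong) auto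
  finally show ?thesis using assms by simp
qed

lemma ip_proj_u: "j < n \<Longrightarrow> ip (proj v) (u j) = ip v (u j)"
  using ip_combination_u[of j "\<lambda>i. ip v (u i)"] by (simp add: proj_def[abs_def])

lemma eigenfunction_in_span:
  assumes v: "eigenfunction r \<mu> v" "\<mu> \<ge> e" and x: "x \<in> carrier G"
  shows "v x = proj v x"
proof -
  have uv: "UC v" using v by (simp add: eigenfunction_def)
  define w where "w = (\<lambda>y. v y - proj v y)"
  have uw: "UC w" unfolding w_def using uv UC_proj by (rule UC_diff)
  have orth: "ip w (u i) = 0" if "i < n" for i
    using that uv UC_u UC_proj by (simp add: w_def ip_diff_left ip_proj_u)
  have cp: "conv r (conv r (proj v)) y = \<mu> * proj v y" if y: "y \<in> carrier G" for y
  proof -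
    have "conv r (conv r (proj v)) y = conv r (\<lambda>z. \<Sum>i<n. ip v (u i) * conv r (u i) z) y"
    proof (rule conv_cong[OF UC_conv[OF UC_proj] _ y])
      fix z assume "z \<in> carrier G"
      then show "conv r (proj v) z = (\<Sum>i<n. ip v (u i) * conv r (u i) z)"
        unfolding proj_def[abs_def] using UC_u by (subst conv_combination) auto
    qed
    also have "\<dots> = (\<Sum>i<n. ip v (u i) * conv r (conv r (u i)) y)"
      using y UC_u UC_conv by (subst conv_combination) auto
    also have "\<dots> = (\<Sum>i<n. ip v (u i) * (\<mu> * u i y))"
    proof (rule sum.cong[OF refl])
      fix i assume i: "i \<in> {..<n}"
      then obtain \<nu> where \<nu>: "eigenfunction r \<nu> (u i)" using family by (auto simp: eigenfamily_def)
      show "ip v (u i) * conv r (conv r (u i)) y = ip v (u i) * (\<mu> * u i y)"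
        using \<nu> y eigenfunction_orthogonal[OF r_nonneg v(1) \<nu>]
        by (cases "\<mu> = \<nu>") (auto simp: eigenfunction_def)
    qed
    finally show ?thesis by (simp add: proj_def sum_distrib_left mult.left_commute)
  qed
  have "conv r (conv r w) y = \<mu> * w y" if y: "y \<in> carrier G" for y
  proof -
    have "conv r (conv r w) y = conv r (\<lambda>z. conv r v z - conv r (proj v) z) y"
      using y uv uw UC_proj by (intro conv_cong UC_conv) (auto simp: w_def conv_diff)
    also have "\<dots> = \<mu> * w y"
      using y uv UC_proj v(1) cp by (simp add: conv_diff UC_conv eigenfunction_def w_def right_diff_distrib)
    finally show ?thesis .
  qed
  then have "eigenfunction r \<mu> w" using uw by (simp add: eigenfunction_def)
  then have "ip w w = 0" using maximal v(2) orth by blast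
  then show ?thesis using ip_eq_0[OF uw _ x] by (simp add: w_def)
qed

lemma u_conv_in_span:
  assumes "i < n" "x \<in> carrier G" shows "conv r (u i) x = proj (conv r (u i)) x"
  using assms family eigenfunction_conv eigenfunction_in_span
  unfolding eigenfamily_def by metis

lemma u_right_in_span:
  assumes "i < n" "x \<in> carrier G" "a \<in> carrier G"
  shows "u i (x \<otimes> a) = proj (\<lambda>x. u i (x \<otimes> a)) x"
proof -
  obtain \<mu> where "\<mu> \<ge> e" "eigenfunction r \<mu> (u i)" using assms family unfolding eigenfamily_def by blast
  then show ?thesis using eigenfunction_in_span[OF eigenfunction_right[OF _ assms(3)] _ assms(2)] by blast
qed

definition perp :: "('a \<Rightarrow> real) \<Rightarrow> bool" where
  "perp w \<longleftrightarrow> UC w \<and> (\<forall>i<n. ip w (u i) = 0)"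

lemma perp_conv: assumes "perp w" shows "perp (conv r w)"
  unfolding perp_def
proof (intro conjI allI impI)
  have uw: "UC w" and o: "\<And>i. i < n \<Longrightarrow> ip w (u i) = 0" using assms by (auto simp: perp_def)
  show "UC (conv r w)" using uw by (rule UC_conv)
  fix i assume i: "i < n"
  have "ip (conv r w) (u i) = ip (conv r (u i)) w"
    unfolding ip_commute[of "conv r w"] by (rule conv_sym[OF r_nonneg UC_u[OF i] uw, symmetric])
  also have "\<dots> = ip (\<lambda>x. \<Sum>j<n. ip (conv r (u i)) (u j) * u j x) w"
    by (rule ip_cong[OF UC_conv[OF UC_u[OF i]] uw])
      (use u_conv_in_span[OF i] in \<open>auto simp: proj_def\<close>)
  also have "\<dots> = 0" using uw o UC_u by (subst ip_combination_left) (auto simp: ip_commute)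
  finally show "ip (conv r w) (u i) = 0" .
qed

lemma perp_cmult: "perp w \<Longrightarrow> perp (\<lambda>x. c * w x)"
  by (auto simp: perp_def UC_cmult ip_cmult_left UC_u)

lemma ip_conv_conv: "UC w \<Longrightarrow> ip (conv r w) (conv r w) = ip w (conv r (conv r w))"
  by (rule conv_sym) (auto intro: r_nonneg UC_conv)

text \<open>On the orthogonal complement of the span the square of the norm of the operator is at most \<open>e\<close>.
Let \<open>m\<close> be that square and suppose that it exceeds \<open>e\<close>. If \<open>f k\<close> is
a maximizing sequence of the unit ball, then
\<open>\<parallel>conv (conv (f k)) - m * f k\<parallel>\<^sup>2 \<le> 2 * m\<^sup>2 - 2 * m * \<parallel>conv (f k)\<parallel>\<^sup>2\<close>
tends to 0, and by compactness a subsequence of \<open>conv (conv (f k))\<close> converges uniformly. The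
limit \<open>g\<close> is an eigenfunction for \<open>m\<close> that is orthogonal to the span, so it is
zero by maximality; but \<open>\<parallel>conv (f k)\<parallel>\<^sup>2\<close>, the inner product of
\<open>f k\<close> with \<open>conv (conv (f k))\<close>, tends to \<open>m > 0\<close>.\<close>

lemma conv_perp_small:
  assumes w: "perp w"
  shows "ip (conv r w) (conv r w) \<le> e * ip w w"
proof (rule ccontr)
  assume neg: "\<not> ?thesis"
  define N where "N w = ip (conv r w) (conv r w)" for w
  define S where "S = {N w |w. perp w \<and> ip w w \<le> 1}"
  have Nle: "N w \<le> r\<^sup>2 * ip w w" if "UC w" for w
  proof -
    have "N w \<le> (r * sqrt (ip w w))\<^sup>2" unfolding N_def
      using abs_conv_le[OF r_nonneg that] that by (intro ip_le UC_conv) auto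
    then show ?thesis using ip_nonneg[OF that] by (simp add: power_mult_distrib)
  qed
  have Nc: "N (\<lambda>x. c * w x) = c\<^sup>2 * N w" if "UC w" for c w
  proof -
    have "N (\<lambda>x. c * w x) = ip (\<lambda>x. c * conv r w x) (\<lambda>x. c * conv r w x)"
      unfolding N_def by (rule ip_cong) (use that in \<open>auto intro: UC_conv UC_cmult simp: conv_cmult\<close>)
    then show ?thesis unfolding N_def using that
      by (simp add: ip_cmult_left UC_conv UC_cmult power2_eq_square
          ip_commute[of "conv r w" "\<lambda>x. c * conv r w x"])
  qed
  have nc: "ip (\<lambda>x. c * w x) (\<lambda>x. c * w x) = c\<^sup>2 * ip w w" if "UC w" for c w
    using that by (simp add: ip_cmult_left UC_cmult power2_eq_square ip_commute[of w "\<lambda>x. c * w x"])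
  have bS: "bdd_above S"
  proof (rule bdd_aboveI)
    fix s assume "s \<in> S"
    then obtain w where w: "UC w" "ip w w \<le> 1" "s = N w" by (auto simp: S_def perp_def)
    have "r\<^sup>2 * ip w w \<le> r\<^sup>2 * 1" using w(2) by (intro mult_left_mono) auto
    then show "s \<le> r\<^sup>2" using Nle[OF w(1)] w(3) by simp
  qed
  define m where "m = Sup S"
  have Nm: "N w \<le> m * ip w w" if w: "perp w" for w
  proof (cases "ip w w = 0")
    case True
    then show ?thesis using Nle w by (fastforce simp: perp_def)
  next
    case False
    have uw: "UC w" using w by (simp add: perp_def)
    have p: "ip w w > 0" using False ip_nonneg[OF uw] by simp
    define c where "c = 1 / sqrt (ip w w)"
    have c: "c\<^sup>2 * ip w w = 1" using p by (simp add: c_def power_divide)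
    have "N (\<lambda>x. c * w x) \<in> S" unfolding S_def using perp_cmult[OF w] nc[OF uw] c by (intro CollectI exI[of _ "\<lambda>x. c * w x"]) simp
    then have "c\<^sup>2 * N w \<le> m" unfolding m_def using Nc[OF uw] bS by (metis cSup_upper)
    then have "c\<^sup>2 * N w * ip w w \<le> m * ip w w" using p by (intro mult_right_mono) auto
    then show ?thesis using c by (simp add: mult.commute mult.left_commute)
  qed
  have me: "m \<ge> e"
  proof (rule ccontr)
    assume "\<not> m \<ge> e"
    then have "m * ip w w \<le> e * ip w w" using ip_nonneg w by (intro mult_right_mono) (auto simp: perp_def)
    then show False using Nm[OF w] neg by (simp add: N_def)
  qed
  have Sne: "S \<noteq> {}" using w
  proof -
    have "ip (\<lambda>x. 0 * w x) (\<lambda>x. 0 * w x) \<le> 1" using nc[of w 0] w by (simp add: perp_def)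
    then have "N (\<lambda>x. 0 * w x) \<in> S" unfolding S_def
      by (intro CollectI exI[of _ "\<lambda>x. 0 * w x"] conjI refl perp_cmult w)
    then show ?thesis by blast
  qed
  have "\<exists>f. perp f \<and> ip f f \<le> 1 \<and> m - inverse (real (Suc k)) < N f" for k
    using less_cSup_iff[OF Sne bS, of "m - inverse (real (Suc k))"] by (auto simp: m_def S_def)
  then obtain f where f: "\<And>k. perp (f k)" "\<And>k. ip (f k) (f k) \<le> 1" "\<And>k. m - inverse (real (Suc k)) < N (f k)"
    by metis
  have uf: "UC (f k)" for k using f(1) by (simp add: perp_def)
  define B where "B k = conv r (conv r (f k))" for k
  have uB: "UC (B k)" for k unfolding B_def by (intro UC_conv uf)
  have sq1: "sqrt (N (f k)) \<le> r" for k
  proof -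
    have "r\<^sup>2 * ip (f k) (f k) \<le> r\<^sup>2 * 1" using f(2) by (intro mult_left_mono) auto
    then have "sqrt (N (f k)) \<le> sqrt (r\<^sup>2)" using Nle[OF uf, of k] by (intro real_sqrt_le_mono) linarith
    then show ?thesis using r by simp
  qed
  have lipB: "\<bar>B k x - B k y\<bar> \<le> r * d x y" if "x \<in> carrier G" "y \<in> carrier G" for k x y
  proof -
    have "\<bar>B k x - B k y\<bar> \<le> d x y * sqrt (N (f k))"
      unfolding B_def N_def by (intro conv_lip UC_conv uf that)
    also have "\<dots> \<le> d x y * r" using sq1 d_nonneg that by (intro mult_left_mono) auto
    finally show ?thesis by (simp add: mult.commute)
  qed
  have bdB: "\<bar>B k x\<bar> \<le> r * r" if "x \<in> carrier G" for k x
  proof -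
    have "\<bar>B k x\<bar> \<le> r * sqrt (N (f k))"
      unfolding B_def N_def by (intro abs_conv_le UC_conv uf that r_nonneg)
    also have "\<dots> \<le> r * r" using sq1 r by (intro mult_left_mono) auto
    finally show ?thesis .
  qed
  have "\<exists>s g. strict_mono (s :: nat \<Rightarrow> nat) \<and> UC g \<and>
      (\<forall>\<epsilon>>0. \<exists>K. \<forall>k\<ge>K. \<forall>x\<in>carrier G. \<bar>B (s k) x - g x\<bar> < \<epsilon>)"
    using lipB bdB by (rule arzela_ascoli[of B r "r * r"]) blast+
  then obtain s :: "nat \<Rightarrow> nat" and g where s: "strict_mono s" and ug: "UC g" and
    g: "\<And>\<epsilon>. \<epsilon> > 0 \<Longrightarrow> \<exists>K. \<forall>k\<ge>K. \<forall>x\<in>carrier G. \<bar>B (s k) x - g x\<bar> < \<epsilon>"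
    by blast
  have gpt: "(\<lambda>k. B (s k) x) \<longlonglongrightarrow> g x" if "x \<in> carrier G" for x
    unfolding LIMSEQ_def dist_real_def using g that by meson
  have gL2: "(\<lambda>k. ip (\<lambda>x. B (s k) x - g x) (\<lambda>x. B (s k) x - g x)) \<longlonglongrightarrow> 0"
    unfolding LIMSEQ_def dist_real_def
  proof (intro allI impI)
    fix \<epsilon> :: real assume \<epsilon>: "\<epsilon> > 0"
    then obtain K where K: "\<forall>k\<ge>K. \<forall>x\<in>carrier G. \<bar>B (s k) x - g x\<bar> < sqrt (\<epsilon> / 2)" using g[of "sqrt (\<epsilon>/2)"] by auto
    have "\<bar>ip (\<lambda>x. B (s k) x - g x) (\<lambda>x. B (s k) x - g x) - 0\<bar> < \<epsilon>" if "k \<ge> K" for k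
    proof -
      have ud: "UC (\<lambda>x. B (s k) x - g x)" using uB ug by (intro UC_diff)
      have "ip (\<lambda>x. B (s k) x - g x) (\<lambda>x. B (s k) x - g x) \<le> (sqrt (\<epsilon> / 2))\<^sup>2"
        using K that by (intro ip_le ud) (auto intro: less_imp_le)
      also have "\<dots> = \<epsilon> / 2" using \<epsilon> by simp
      finally show ?thesis using \<epsilon> ip_nonneg[OF ud] by simp
    qed
    then show "\<exists>K. \<forall>k\<ge>K. \<bar>ip (\<lambda>x. B (s k) x - g x) (\<lambda>x. B (s k) x - g x) - 0\<bar> < \<epsilon>" by blast
  qed
  have Nlim: "(\<lambda>k. N (f k)) \<longlonglongrightarrow> m"
  proof (rule tendsto_sandwich)
    show "\<forall>\<^sub>F k in sequentially. m - inverse (real (Suc k)) \<le> N (f k)" using f(3) by (intro always_eventually allI less_imp_le)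
    have "N (f k) \<le> m" for k using f(1,2) cSup_upper[OF _ bS] by (auto simp: m_def S_def)
    then show "\<forall>\<^sub>F k in sequentially. N (f k) \<le> m" by simp
    show "(\<lambda>k. m - inverse (real (Suc k))) \<longlonglongrightarrow> m"
      using tendsto_diff[OF tendsto_const LIMSEQ_inverse_real_of_nat, of m] by simp
  qed simp
  define D where "D k = (\<lambda>x. B k x - m * f k x)" for k
  have uD: "UC (D k)" for k unfolding D_def by (intro UC_diff uB UC_cmult uf)
  have Dlim: "(\<lambda>k. ip (D k) (D k)) \<longlonglongrightarrow> 0"
  proof (rule tendsto_sandwich)
    show "\<forall>\<^sub>F k in sequentially. 0 \<le> ip (D k) (D k)" using uD ip_nonneg by simp
    have "ip (D k) (D k) \<le> 2 * m\<^sup>2 - 2 * m * N (f k)" for k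
    proof -
      have umf: "UC (\<lambda>x. m * f k x)" using uf by (rule UC_cmult)
      have "ip (D k) (D k) = ip (B k) (D k) - m * ip (f k) (D k)"
        using uB uf umf uD by (subst (1) D_def) (simp add: ip_diff_left ip_cmult_left)
      also have "ip (B k) (D k) = ip (B k) (B k) - m * ip (f k) (B k)"
        using uB uf umf by (subst ip_commute) (simp add: D_def ip_diff_left ip_cmult_left)
      also have "ip (f k) (D k) = ip (f k) (B k) - m * ip (f k) (f k)"
        unfolding ip_commute[of "f k" "D k"] using uB uf umf
        by (simp add: D_def ip_diff_left ip_cmult_left ip_commute[of "B k" "f k"])
      also have "ip (f k) (B k) = N (f k)" unfolding B_def N_def using ip_conv_conv[OF uf] by simp
      finally have 1: "ip (D k) (D k) = ip (B k) (B k) - 2 * m * N (f k) + m\<^sup>2 * ip (f k) (f k)"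
        by (simp add: power2_eq_square algebra_simps)
      have "ip (B k) (B k) = N (conv r (f k))" by (simp add: B_def N_def)
      also have "\<dots> \<le> m * N (f k)" using Nm[OF perp_conv[OF f(1)]] by (simp add: N_def)
      also have "\<dots> \<le> m * m" using Nm[OF f(1), of k] f(2)[of k] me e
        by (intro mult_left_mono) (auto intro: order_trans[OF _ mult_left_le])
      finally have "ip (B k) (B k) \<le> m\<^sup>2" by (simp add: power2_eq_square)
      moreover have "m\<^sup>2 * ip (f k) (f k) \<le> m\<^sup>2" using f(2)[of k] by (intro mult_left_le) auto
      ultimately show ?thesis using 1 by linarith
    qed
    then show "\<forall>\<^sub>F k in sequentially. ip (D k) (D k) \<le> 2 * m\<^sup>2 - 2 * m * N (f k)" by simp
    have "(\<lambda>k. 2 * m\<^sup>2 - 2 * m * N (f k)) \<longlonglongrightarrow> 2 * m\<^sup>2 - 2 * m * m"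
      by (intro tendsto_intros Nlim)
    then show "(\<lambda>k. 2 * m\<^sup>2 - 2 * m * N (f k)) \<longlonglongrightarrow> 0" by (simp add: power2_eq_square)
  qed simp
  have conv2_lim: "(\<lambda>k. conv r (conv r (h k)) x) \<longlonglongrightarrow> 0"
    if h: "\<And>k. UC (h k)" and hl: "(\<lambda>k. ip (h k) (h k)) \<longlonglongrightarrow> 0" and x: "x \<in> carrier G" for h x
  proof (rule Lim_null_comparison[OF eventuallyI])
    fix k
    have "norm (conv r (conv r (h k)) x) \<le> r * sqrt (N (h k))"
      unfolding N_def using h x by (simp add: abs_conv_le[OF r_nonneg] UC_conv)
    also have "\<dots> \<le> r * sqrt (r\<^sup>2 * ip (h k) (h k))"
      using Nle[OF h] r by (intro mult_left_mono real_sqrt_le_mono) auto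
    finally show "norm (conv r (conv r (h k)) x) \<le> r * sqrt (r\<^sup>2 * ip (h k) (h k))" .
  next
    have "(\<lambda>k. r * sqrt (r\<^sup>2 * ip (h k) (h k))) \<longlonglongrightarrow> r * sqrt (r\<^sup>2 * 0)"
      by (intro tendsto_intros hl)
    then show "(\<lambda>k. r * sqrt (r\<^sup>2 * ip (h k) (h k))) \<longlonglongrightarrow> 0" by simp
  qed
  have eig: "conv r (conv r g) x = m * g x" if x: "x \<in> carrier G" for x
  proof -
    have "(\<lambda>k. conv r (conv r (\<lambda>y. B (s k) y - g y)) x) \<longlonglongrightarrow> 0"
      using uB ug gL2 x by (intro conv2_lim UC_diff)
    moreover have c2d: "conv r (conv r (\<lambda>y. h y - h' y)) x = conv r (conv r h) x - conv r (conv r h') x"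
      if h: "UC h" "UC h'" for h h'
    proof -
      have "conv r (conv r (\<lambda>y. h y - h' y)) x = conv r (\<lambda>z. conv r h z - conv r h' z) x"
        using h x by (intro conv_cong UC_conv UC_diff) (auto simp: conv_diff)
      then show ?thesis using h x by (simp add: conv_diff UC_conv)
    qed
    ultimately have 1: "(\<lambda>k. conv r (conv r (B (s k))) x - conv r (conv r g) x) \<longlonglongrightarrow> 0"
      using uB ug by simp
    have "(\<lambda>k. conv r (conv r (D (s k))) x) \<longlonglongrightarrow> 0"
      using LIMSEQ_subseq_LIMSEQ[OF Dlim s] by (intro conv2_lim uD x) (simp add: o_def)
    moreover have "conv r (conv r (D k)) x = conv r (conv r (B k)) x - m * B k x" for k
    proof -
      have "conv r (conv r (\<lambda>y. m * f k y)) x = conv r (\<lambda>z. m * conv r (f k) z) x"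
        using x uf by (intro conv_cong UC_conv UC_cmult) (auto simp: conv_cmult)
      then show ?thesis unfolding D_def using c2d[OF uB UC_cmult[OF uf]] x uf
        by (simp add: conv_cmult UC_conv B_def)
    qed
    ultimately have 2: "(\<lambda>k. conv r (conv r (B (s k))) x - m * B (s k) x) \<longlonglongrightarrow> 0" by simp
    have "(\<lambda>k. (conv r (conv r (B (s k))) x - m * B (s k) x) - (conv r (conv r (B (s k))) x - conv r (conv r g) x) + m * B (s k) x)
        \<longlonglongrightarrow> 0 - 0 + m * g x"
      by (intro tendsto_intros 1 2 gpt x)
    then have "(\<lambda>k. conv r (conv r g) x) \<longlonglongrightarrow> m * g x" by simp
    then show ?thesis using LIMSEQ_unique tendsto_const by blast
  qed
  have lim_ip: "(\<lambda>k. ip (B (s k)) v - ip g v) \<longlonglongrightarrow> 0" if v: "UC v" for v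
  proof (rule Lim_null_comparison[OF eventuallyI])
    fix k
    let ?h = "\<lambda>x. B (s k) x - g x"
    have uh: "UC ?h" by (intro UC_diff uB ug)
    have "(ip (B (s k)) v - ip g v)\<^sup>2 = (ip ?h v)\<^sup>2" using uB ug v by (simp add: ip_diff_left)
    also have "\<dots> \<le> ip ?h ?h * ip v v" by (rule cauchy_schwarz[OF uh v])
    finally show "norm (ip (B (s k)) v - ip g v) \<le> sqrt (ip ?h ?h * ip v v)"
      by (simp add: real_le_rsqrt)
  next
    have "(\<lambda>k. sqrt (ip (\<lambda>x. B (s k) x - g x) (\<lambda>x. B (s k) x - g x) * ip v v)) \<longlonglongrightarrow> sqrt (0 * ip v v)"
      by (intro tendsto_intros gL2)
    then show "(\<lambda>k. sqrt (ip (\<lambda>x. B (s k) x - g x) (\<lambda>x. B (s k) x - g x) * ip v v)) \<longlonglongrightarrow> 0" by simp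
  qed
  have "ip g (u i) = 0" if i: "i < n" for i
  proof -
    have "perp (B k)" for k unfolding B_def by (intro perp_conv f)
    then have "ip (B (s k)) (u i) = 0" for k using i by (simp add: perp_def)
    then show ?thesis using lim_ip[OF UC_u[OF i]] by (simp add: LIMSEQ_const_iff)
  qed
  then have "ip g g = 0" using maximal[of m g] eig ug me by (simp add: eigenfunction_def)
  then have g0: "g x = 0" if "x \<in> carrier G" for x using ip_eq_0[OF ug] that by blast
  \<comment> \<open>but then \<open>N (f (s k)) = ip (f (s k)) (B (s k))\<close> tends to 0\<close>
  have "(\<lambda>k. N (f (s k))) \<longlonglongrightarrow> 0"
  proof (rule Lim_null_comparison[OF eventuallyI])
    fix k
    have 0: "ip (B (s k)) (B (s k)) = ip (\<lambda>x. B (s k) x - g x) (\<lambda>x. B (s k) x - g x)"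
      using uB g0 by (intro ip_cong) auto
    have "(N (f (s k)))\<^sup>2 = (ip (f (s k)) (B (s k)))\<^sup>2"
      unfolding B_def N_def using ip_conv_conv[OF uf] by simp
    also have "\<dots> \<le> ip (f (s k)) (f (s k)) * ip (B (s k)) (B (s k))" by (rule cauchy_schwarz[OF uf uB])
    also have "\<dots> \<le> ip (B (s k)) (B (s k))" using f(2) ip_nonneg[OF uB] ip_nonneg[OF uf] by (intro mult_left_le_one_le)
    finally show "norm (N (f (s k))) \<le> sqrt (ip (\<lambda>x. B (s k) x - g x) (\<lambda>x. B (s k) x - g x))"
      unfolding 0 by (simp add: real_le_rsqrt)
  next
    have "(\<lambda>k. sqrt (ip (\<lambda>x. B (s k) x - g x) (\<lambda>x. B (s k) x - g x))) \<longlonglongrightarrow> sqrt 0"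
      by (intro tendsto_intros gL2)
    then show "(\<lambda>k. sqrt (ip (\<lambda>x. B (s k) x - g x) (\<lambda>x. B (s k) x - g x))) \<longlonglongrightarrow> 0" by simp
  qed
  moreover have "(\<lambda>k. N (f (s k))) \<longlonglongrightarrow> m" using LIMSEQ_subseq_LIMSEQ[OF Nlim s] by (simp add: o_def)
  ultimately show False using LIMSEQ_unique me e by fastforce
qed

end

context totally_bounded_group
begin

text \<open>Homomorphisms into the orthogonal matrices of size \<open>n\<close>: with the equations for inverses and for
products, the transpose of the matrix is its inverse.\<close>

definition orthogonal_rep :: "nat \<Rightarrow> ('a \<Rightarrow> nat \<Rightarrow> nat \<Rightarrow> real) \<Rightarrow> bool" where
  "orthogonal_rep n \<rho> \<longleftrightarrow> (\<forall>i<n. \<forall>k<n. UC (\<lambda>a. \<rho> a i k) \<and> \<rho> \<one> i k = (if i = k then 1 else 0) \<and>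
     (\<forall>a\<in>carrier G. \<rho> (inv a) i k = \<rho> a k i \<and>
       (\<forall>b\<in>carrier G. \<rho> (a \<otimes> b) i k = (\<Sum>j<n. \<rho> a i j * \<rho> b j k))))"

end

context eigenspan
begin

text \<open>The matrix of right translation by \<open>a\<close> on the span, in the basis \<open>u\<close>.\<close>

definition rho :: "'a \<Rightarrow> nat \<Rightarrow> nat \<Rightarrow> real" where
  "rho a i k = ip (\<lambda>x. u k (x \<otimes> a)) (u i)"

lemma u_right:
  assumes "k < n" "x \<in> carrier G" "a \<in> carrier G"
  shows "u k (x \<otimes> a) = (\<Sum>i<n. rho a i k * u i x)"
  using u_right_in_span[OF assms] by (simp add: proj_def rho_def)

lemma rho_mult:
  assumes i: "i < n" and k: "k < n" and a: "a \<in> carrier G" and b: "b \<in> carrier G"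
  shows "rho (a \<otimes> b) i k = (\<Sum>j<n. rho a i j * rho b j k)"
proof -
  have "rho (a \<otimes> b) i k = ip (\<lambda>x. \<Sum>j<n. rho b j k * u j (x \<otimes> a)) (u i)"
    unfolding rho_def[of "a \<otimes> b"]
  proof (rule ip_cong)
    fix x assume x: "x \<in> carrier G"
    then show "u k (x \<otimes> (a \<otimes> b)) = (\<Sum>j<n. rho b j k * u j (x \<otimes> a))"
      using u_right[OF k, of "x \<otimes> a" b] a b by (simp add: m_assoc)
  qed (use i k a b in \<open>auto intro: UC_u UC_right\<close>)
  also have "\<dots> = (\<Sum>j<n. rho b j k * rho a i j)"
    unfolding rho_def[of a] using UC_u UC_right[OF UC_u a] i by (subst ip_combination_left) auto
  finally show ?thesis by (simp add: mult.commute)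
qed

lemma rho_one: "i < n \<Longrightarrow> k < n \<Longrightarrow> rho \<one> i k = (if i = k then 1 else 0)"
proof -
  assume ik: "i < n" "k < n"
  have "rho \<one> i k = ip (u k) (u i)"
    unfolding rho_def by (rule ip_cong) (use ik in \<open>auto intro: UC_u UC_right\<close>)
  then show ?thesis using orthonormal ik by auto
qed

lemma rho_inv:
  assumes i: "i < n" and k: "k < n" and a: "a \<in> carrier G"
  shows "rho (inv a) i k = rho a k i"
proof -
  have "rho (inv a) i k = ip (\<lambda>x. u k (x \<otimes> a \<otimes> inv a)) (\<lambda>x. u i (x \<otimes> a))"
    unfolding rho_def using ip_right[OF UC_right[OF UC_u[OF k]] UC_u[OF i] a, of "inv a"] a by simp
  also have "\<dots> = ip (u k) (\<lambda>x. u i (x \<otimes> a))"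
    by (rule ip_cong[symmetric]) (use i k a in \<open>auto intro: UC_u UC_right simp: m_assoc\<close>)
  also have "\<dots> = rho a k i" by (simp add: rho_def ip_commute)
  finally show ?thesis .
qed

lemma UC_rho:
  assumes i: "i < n" and k: "k < n"
  shows "UC (\<lambda>a. rho a i k)"
  unfolding UC_def
proof (intro allI impI)
  fix \<epsilon> :: real assume \<epsilon>: "\<epsilon> > 0"
  then obtain s where s: "s > 0"
    "\<And>x y. x \<in> carrier G \<Longrightarrow> y \<in> carrier G \<Longrightarrow> d x y < s \<Longrightarrow> \<bar>u k x - u k y\<bar> < \<epsilon> / 2"
    using UC_obtain[OF UC_u[OF k], of "\<epsilon>/2"] by auto
  show "\<exists>s>0. \<forall>a\<in>carrier G. \<forall>b\<in>carrier G. d a b < s \<longrightarrow> \<bar>rho a i k - rho b i k\<bar> < \<epsilon>"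
  proof (intro exI[of _ s] conjI ballI impI)
    fix a b assume ab: "a \<in> carrier G" "b \<in> carrier G" "d a b < s"
    have "\<bar>ip (\<lambda>x. u k (x \<otimes> a) - u k (x \<otimes> b)) (u i)\<bar> \<le> \<epsilon> / 2 * sqrt (ip (u i) (u i))"
    proof (rule abs_ip_le)
      fix x assume "x \<in> carrier G"
      then show "\<bar>u k (x \<otimes> a) - u k (x \<otimes> b)\<bar> \<le> \<epsilon> / 2"
        using s(2)[of "x \<otimes> a" "x \<otimes> b"] ab by (simp add: d_left)
    qed (intro UC_diff UC_right UC_u i k ab)+
    then show "\<bar>rho a i k - rho b i k\<bar> < \<epsilon>"
      using \<epsilon> i k ab orthonormal[OF i i] by (simp add: rho_def ip_diff_left UC_right UC_u)
  qed (rule s)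
qed

lemma orthogonal_rep_rho: "orthogonal_rep n rho"
  unfolding orthogonal_rep_def
  by (intro allI impI conjI ballI UC_rho rho_one rho_inv rho_mult)

text \<open>A function \<open>v\<close> of the span satisfies \<open>v x = v (\<one> \<otimes> x)\<close>, the
value at \<open>\<one>\<close> of its translate by \<open>x\<close>.\<close>

lemma combination_eq_coefficients:
  assumes "x \<in> carrier G"
  shows "(\<Sum>k<n. c k * u k x) = (\<Sum>i<n. \<Sum>k<n. (c k * u i \<one>) * rho x i k)"
proof -
  have "(\<Sum>k<n. c k * u k x) = (\<Sum>k<n. \<Sum>i<n. (c k * u i \<one>) * rho x i k)"
    using u_right[OF _ one_closed assms] assms by (intro sum.cong) (auto simp: sum_distrib_left mult_ac)
  also have "\<dots> = (\<Sum>i<n. \<Sum>k<n. (c k * u i \<one>) * rho x i k)" by (rule sum.swap)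
  finally show ?thesis .
qed

lemma conv_conv_proj:
  obtains c where "\<And>x. x \<in> carrier G \<Longrightarrow> conv r (conv r (proj f)) x = (\<Sum>i<n. c i * u i x)"
proof -
  have "\<forall>i. \<exists>\<mu>. i < n \<longrightarrow> eigenfunction r \<mu> (u i)" using family by (auto simp: eigenfamily_def)
  then obtain \<mu> where \<mu>: "\<And>i. i < n \<Longrightarrow> eigenfunction r (\<mu> i) (u i)" by metis
  have "conv r (conv r (proj f)) x = (\<Sum>i<n. (ip f (u i) * \<mu> i) * u i x)" if x: "x \<in> carrier G" for x
  proof -
    have "conv r (conv r (proj f)) x = conv r (\<lambda>z. \<Sum>i<n. ip f (u i) * conv r (u i) z) x"
    proof (rule conv_cong[OF UC_conv[OF UC_proj] _ x])
      fix z assume "z \<in> carrier G"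
      then show "conv r (proj f) z = (\<Sum>i<n. ip f (u i) * conv r (u i) z)"
        unfolding proj_def[abs_def] using UC_u by (subst conv_combination) auto
    qed
    also have "\<dots> = (\<Sum>i<n. ip f (u i) * conv r (conv r (u i)) x)"
      using x UC_u UC_conv by (subst conv_combination) auto
    also have "\<dots> = (\<Sum>i<n. (ip f (u i) * \<mu> i) * u i x)"
      using \<mu> x by (intro sum.cong) (auto simp: eigenfunction_def)
    finally show ?thesis .
  qed
  then show ?thesis by (rule that)
qed

lemma perp_diff_proj:
  assumes f: "UC f"
  shows "perp (\<lambda>x. f x - proj f x)" "ip (\<lambda>x. f x - proj f x) (\<lambda>x. f x - proj f x) \<le> ip f f"
proof -
  let ?w = "\<lambda>x. f x - proj f x"
  have uw: "UC ?w" using f UC_proj by (rule UC_diff)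
  show p: "perp ?w"
    unfolding perp_def using f UC_u UC_proj uw by (auto simp: ip_diff_left ip_proj_u)
  have pw: "ip (proj f) ?w = 0"
    unfolding proj_def[abs_def] using p uw UC_u
    by (subst ip_combination_left) (auto simp: ip_commute perp_def proj_def[abs_def])
  have "ip ?w ?w = ip f ?w" using f UC_proj uw pw by (simp add: ip_diff_left)
  also have "\<dots> = ip f f - ip (proj f) f" using f UC_proj by (simp add: ip_diff_left ip_commute[of f ?w])
  also have "ip (proj f) f = ip (proj f) (proj f)"
    using pw f UC_proj by (simp add: ip_commute[of "proj f" ?w] ip_diff_left ip_commute[of f])
  finally show "ip ?w ?w \<le> ip f f" using ip_nonneg[OF UC_proj] by simp
qed

end

context totally_bounded_group
begin

lemma conv_mass:
  assumes r: "r > 0"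
  obtains c where "c > 0" "\<And>x. x \<in> carrier G \<Longrightarrow> mean (bump r x) = c"
proof (rule that)
  show "mean (bump r \<one>) > 0"
    by (rule mean_pos[OF UC_bump[OF one_closed], of r \<one>]) (use r d_self in \<open>auto simp: bump_def\<close>)
  fix x assume x: "x \<in> carrier G"
  have "mean (bump r x) = mean (\<lambda>y. bump r x (y \<otimes> x))" using mean_right[OF UC_bump[OF x] x] by simp
  also have "\<dots> = mean (bump r \<one>)"
    by (rule mean_cong[OF UC_right[OF UC_bump[OF x] x]])
      (use d_right[of \<one> _ x] x in \<open>simp add: bump_def\<close>)
  finally show "mean (bump r x) = mean (bump r \<one>)" .
qed

lemma conv_abs_le:
  assumes g: "UC g" and B: "\<And>y. y \<in> carrier G \<Longrightarrow> \<bar>bump r x y * g y\<bar> \<le> bump r x y * B" and x: "x \<in> carrier G"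
  shows "\<bar>conv r g x\<bar> \<le> mean (bump r x) * B"
proof -
  have u1: "UC (\<lambda>y. bump r x y * g y)" and u2: "UC (\<lambda>y. bump r x y * B)"
    using g x by (auto intro: UC_mult UC_multc UC_bump)
  have "mean (\<lambda>y. bump r x y * g y) \<le> mean (\<lambda>y. bump r x y * B)"
    by (rule mean_mono[OF u1 u2]) (use B abs_le_iff in blast)
  moreover have "mean (\<lambda>y. - 1 * (bump r x y * g y)) \<le> mean (\<lambda>y. bump r x y * B)"
    by (rule mean_mono[OF UC_cmult[OF u1] u2]) (use B abs_le_iff in auto)
  then have "- 1 * mean (\<lambda>y. bump r x y * g y) \<le> mean (\<lambda>y. bump r x y * B)"
    by (simp only: mean_cmult[OF u1])
  ultimately show ?thesis using x by (simp add: conv_def ip_def abs_le_iff mean_multc UC_bump)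
qed

text \<open>With \<open>c\<close> the mass of the kernel, \<open>conv r (conv r f)\<close> is close to
\<open>c\<^sup>2 * f\<close> when \<open>r\<close> is within the modulus of continuity of
\<open>f\<close>. The two applications of the operator to the component of \<open>f\<close> orthogonal to
the span give a uniformly small function: the first is small in the inner product norm, and the second turns
this norm into a uniform bound.\<close>

lemma approx_by_eigenspan:
  assumes f: "UC f" and \<eta>: "\<eta> > 0"
  shows "\<exists>r e n u c. eigenspan G d r e n u \<and> (\<forall>x\<in>carrier G. \<bar>f x - (\<Sum>i<n. c i * u i x)\<bar> < \<eta>)"
proof -
  obtain r where r: "r > 0"
    "\<And>x y. x \<in> carrier G \<Longrightarrow> y \<in> carrier G \<Longrightarrow> d x y < r \<Longrightarrow> \<bar>f x - f y\<bar> < \<eta> / 4"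
    using UC_obtain[OF f, of "\<eta>/4"] \<eta> by auto
  obtain c where c: "c > 0" "\<And>x. x \<in> carrier G \<Longrightarrow> mean (bump r x) = c" using conv_mass[OF r(1)] by blast
  have A1: "\<bar>conv r f x - c * f x\<bar> \<le> c * (\<eta> / 4)" if x: "x \<in> carrier G" for x
  proof -
    have "conv r f x - c * f x = conv r (\<lambda>y. f y - f x) x"
      using c(2)[OF x] x f by (simp add: conv_diff) (simp add: conv_def ip_def mean_multc UC_bump)
    moreover have "\<bar>conv r (\<lambda>y. f y - f x) x\<bar> \<le> mean (bump r x) * (\<eta> / 4)"
    proof (rule conv_abs_le[OF UC_diff[OF f UC_const] _ x])
      fix y assume y: "y \<in> carrier G"
      show "\<bar>bump r x y * (f y - f x)\<bar> \<le> bump r x y * (\<eta> / 4)"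
      proof (cases "d x y < r")
        case True
        then have "\<bar>f y - f x\<bar> \<le> \<eta> / 4" using r(2)[OF x y] by (simp add: abs_minus_commute)
        moreover have "bump r x y \<ge> 0" by (simp add: bump_def)
        ultimately show ?thesis using mult_left_mono[of "\<bar>f y - f x\<bar>" "\<eta> / 4" "bump r x y"] by (simp add: abs_mult)
      qed (simp add: bump_def)
    qed
    ultimately show ?thesis using c(2)[OF x] by simp
  qed
  have A2: "\<bar>conv r (conv r f) x - c * (c * f x)\<bar> \<le> c * c * (\<eta> / 2)" if x: "x \<in> carrier G" for x
  proof -
    have ud: "UC (\<lambda>y. conv r f y - c * f y)" using f by (intro UC_diff UC_conv UC_cmult)
    have "conv r (\<lambda>y. conv r f y - c * f y) x = conv r (conv r f) x - c * conv r f x"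
      using f x by (simp add: conv_diff UC_conv UC_cmult conv_cmult)
    moreover have "\<bar>conv r (\<lambda>y. conv r f y - c * f y) x\<bar> \<le> mean (bump r x) * (c * (\<eta> / 4))"
    proof (rule conv_abs_le[OF ud _ x])
      fix y assume y: "y \<in> carrier G"
      have "bump r x y \<ge> 0" by (simp add: bump_def)
      then show "\<bar>bump r x y * (conv r f y - c * f y)\<bar> \<le> bump r x y * (c * (\<eta> / 4))"
        using mult_left_mono[OF A1[OF y], of "bump r x y"] by (simp add: abs_mult)
    qed
    ultimately have "\<bar>conv r (conv r f) x - c * conv r f x\<bar> \<le> c * c * (\<eta> / 4)" using c(2)[OF x] by simp
    moreover have "\<bar>c * conv r f x - c * (c * f x)\<bar> \<le> c * c * (\<eta> / 4)"
      using A1[OF x] c(1) by (simp add: abs_mult flip: right_diff_distrib)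
    ultimately show ?thesis by linarith
  qed
  \<comment> \<open>the lower bound \<open>e\<close> for the eigenvalues is chosen such that \<open>r * sqrt (e * ip f f) \<le> c\<^sup>2 * \<eta> / 4\<close>\<close>
  define q where "q = c * c * (\<eta> / 4) / r"
  have q: "q > 0" using c \<eta> r by (simp add: q_def)
  define e where "e = q\<^sup>2 / (ip f f + 1)"
  have ff: "ip f f \<ge> 0" using f by (rule ip_nonneg)
  have e: "e > 0" using q ff by (simp add: e_def)
  have ef: "e * ip f f \<le> q\<^sup>2" using ff q by (simp add: e_def pos_divide_le_eq mult_left_mono)
  have "\<exists>n u. eigenspan G d r e n u"
  proof (rule maximal_eigenfamily[of r e])
    fix n :: nat and u
    assume "eigenfamily r e n u"
      "\<And>v \<mu>. eigenfunction r \<mu> v \<Longrightarrow> \<mu> \<ge> e \<Longrightarrow> (\<And>i. i < n \<Longrightarrow> ip v (u i) = 0) \<Longrightarrow> ip v v = 0"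
    then have "eigenspan G d r e n u" using r e by unfold_locales auto
    then show ?thesis by blast
  qed (use r e in auto)
  then obtain n u where E: "eigenspan G d r e n u" by blast
  interpret E: eigenspan G d r e n u by (rule E)
  let ?w = "\<lambda>x. f x - E.proj f x"
  have uw: "UC ?w" using f E.UC_proj by (rule UC_diff)
  obtain b where b: "\<And>x. x \<in> carrier G \<Longrightarrow> conv r (conv r (E.proj f)) x = (\<Sum>i<n. b i * u i x)"
    using E.conv_conv_proj[of f] by blast
  have A3: "\<bar>conv r (conv r f) x - (\<Sum>i<n. b i * u i x)\<bar> \<le> c * c * (\<eta> / 4)" if x: "x \<in> carrier G" for x
  proof -
    have "conv r (conv r ?w) x = conv r (\<lambda>z. conv r f z - conv r (E.proj f) z) x"
      using f E.UC_proj uw x by (intro conv_cong UC_conv) (auto simp: conv_diff)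
    also have "\<dots> = conv r (conv r f) x - (\<Sum>i<n. b i * u i x)"
      using f E.UC_proj x b by (simp add: conv_diff UC_conv)
    finally have *: "conv r (conv r f) x - (\<Sum>i<n. b i * u i x) = conv r (conv r ?w) x" by simp
    have "\<bar>conv r (conv r ?w) x\<bar> \<le> r * sqrt (ip (conv r ?w) (conv r ?w))"
      using r uw x by (intro abs_conv_le UC_conv) auto
    also have "\<dots> \<le> r * sqrt (q\<^sup>2)"
    proof -
      have "ip (conv r ?w) (conv r ?w) \<le> e * ip ?w ?w" by (rule E.conv_perp_small[OF E.perp_diff_proj(1)[OF f]])
      also have "\<dots> \<le> e * ip f f" using E.perp_diff_proj(2)[OF f] e by (intro mult_left_mono) auto
      also note ef
      finally show ?thesis using r by (intro mult_left_mono real_sqrt_le_mono) auto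
    qed
    also have "\<dots> = r * q" using q by simp
    also have "\<dots> = c * c * (\<eta> / 4)" using r by (simp add: q_def)
    finally show ?thesis using * by simp
  qed
  have "\<bar>f x - (\<Sum>i<n. (b i / (c * c)) * u i x)\<bar> < \<eta>" if x: "x \<in> carrier G" for x
  proof -
    have cc: "c * c > 0" using c by simp
    have s: "(\<Sum>i<n. (b i / (c * c)) * u i x) = (\<Sum>i<n. b i * u i x) / (c * c)"
      by (simp add: sum_divide_distrib)
    have "\<bar>c * (c * f x) - (\<Sum>i<n. b i * u i x)\<bar> \<le> c * c * (3 * \<eta> / 4)"
      using A2[OF x] A3[OF x] by linarith
    also have "\<dots> < c * c * \<eta>" using cc \<eta> by simp
    finally have "\<bar>c * c * (f x - (\<Sum>i<n. b i * u i x) / (c * c))\<bar> < c * c * \<eta>"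
      using cc c(1) by (simp add: right_diff_distrib mult.assoc)
    then show ?thesis unfolding s using cc c(1) by (simp add: abs_mult)
  qed
  with E show ?thesis
    by (intro exI[of _ r] exI[of _ e] exI[of _ n] exI[of _ u] exI[of _ "\<lambda>i. b i / (c * c)"] conjI ballI)
qed

theorem coefficient_approximation:
  assumes f: "UC f" and \<eta>: "\<eta> > 0"
  shows "\<exists>n \<rho> C. orthogonal_rep n \<rho> \<and>
    (\<forall>x\<in>carrier G. \<bar>f x - (\<Sum>i<n. \<Sum>k<n. C i k * \<rho> x i k)\<bar> < \<eta>)"
proof -
  obtain r e n u c where *: "eigenspan G d r e n u \<and> (\<forall>x\<in>carrier G. \<bar>f x - (\<Sum>i<n. c i * u i x)\<bar> < \<eta>)"
    using approx_by_eigenspan[OF f \<eta>] by (elim exE) (rule that)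
  then have E: "eigenspan G d r e n u"
    and ap: "\<And>x. x \<in> carrier G \<Longrightarrow> \<bar>f x - (\<Sum>i<n. c i * u i x)\<bar> < \<eta>"
    by blast+
  have "\<forall>x\<in>carrier G. \<bar>f x - (\<Sum>i<n. \<Sum>k<n. c k * u i \<one> * eigenspan.rho G d u x i k)\<bar> < \<eta>"
  proof
    fix x assume x: "x \<in> carrier G"
    show "\<bar>f x - (\<Sum>i<n. \<Sum>k<n. c k * u i \<one> * eigenspan.rho G d u x i k)\<bar> < \<eta>"
      by (subst eigenspan.combination_eq_coefficients[OF E x, symmetric]) (rule ap[OF x])
  qed
  with eigenspan.orthogonal_rep_rho[OF E] show ?thesis
    by (intro exI[of _ n] exI[of _ "eigenspan.rho G d u"] exI[of _ "\<lambda>i k. c k * u i \<one>"] conjI)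
qed

end

section \<open>Almost periodic functions\<close>

lemma continuous_map_eps:
  fixes f :: "'a \<Rightarrow> 'b::metric_space"
  shows "continuous_map X euclidean f \<longleftrightarrow>
    (\<forall>x\<in>topspace X. \<forall>e>0. \<exists>U. openin X U \<and> x \<in> U \<and> (\<forall>y\<in>U. dist (f y) (f x) < e))"
proof
  assume c: "continuous_map X euclidean f"
  show "\<forall>x\<in>topspace X. \<forall>e>0. \<exists>U. openin X U \<and> x \<in> U \<and> (\<forall>y\<in>U. dist (f y) (f x) < e)"
  proof (intro ballI allI impI)
    fix x and e :: real assume x: "x \<in> topspace X" and e: "e > 0"
    have "openin X {y \<in> topspace X. f y \<in> ball (f x) e}"
      using c by (rule openin_continuous_map_preimage) simp
    then show "\<exists>U. openin X U \<and> x \<in> U \<and> (\<forall>y\<in>U. dist (f y) (f x) < e)"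
      using x e by (intro exI[of _ "{y \<in> topspace X. f y \<in> ball (f x) e}"]) (auto simp: dist_commute)
  qed
next
  assume r: "\<forall>x\<in>topspace X. \<forall>e>0. \<exists>U. openin X U \<and> x \<in> U \<and> (\<forall>y\<in>U. dist (f y) (f x) < e)"
  show "continuous_map X euclidean f"
    unfolding continuous_map_def
  proof (intro conjI allI impI)
    fix V :: "'b set" assume "openin euclidean V"
    then have V: "open V" by simp
    show "openin X {x \<in> topspace X. f x \<in> V}"
    proof (subst openin_subopen, intro ballI)
      fix x assume x: "x \<in> {x \<in> topspace X. f x \<in> V}"
      then obtain e where e: "e > 0" "\<And>z. dist z (f x) < e \<Longrightarrow> z \<in> V" using V by (auto simp: open_dist)
      obtain U where U: "openin X U" "x \<in> U" "\<forall>y\<in>U. dist (f y) (f x) < e" using r x e(1) by blast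
      then show "\<exists>T. openin X T \<and> x \<in> T \<and> T \<subseteq> {x \<in> topspace X. f x \<in> V}"
        using e(2) openin_subset[OF U(1)] by (intro exI[of _ U]) auto
    qed
  qed simp
qed

lemma AP_partition:
  assumes "f \<in> AP G" "\<epsilon> > 0"
  shows "\<exists>\<P>. finite \<P> \<and> \<Union>\<P> = carrier G \<and>
        (\<forall>P\<in>\<P>. \<forall>x\<in>P. \<forall>y\<in>P. \<forall>z\<in>carrier G. \<forall>w\<in>carrier G.
           cmod (f (z \<otimes>\<^bsub>G\<^esub> x \<otimes>\<^bsub>G\<^esub> w) - f (z \<otimes>\<^bsub>G\<^esub> y \<otimes>\<^bsub>G\<^esub> w)) < \<epsilon>)"
  using assms by (simp add: AP_def)

text \<open>A function whose variation is controlled by those of two almost periodic functions is almost periodic: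
intersect the decompositions.\<close>

lemma AP_I:
  assumes "g \<in> extensional (carrier G)" "continuous_map (topo G) euclidean g"
    and ex: "\<And>\<epsilon>. \<epsilon> > 0 \<Longrightarrow> \<exists>f1\<in>AP G. \<exists>f2\<in>AP G. \<exists>\<delta>>0. \<forall>x\<in>carrier G. \<forall>y\<in>carrier G.
      cmod (f1 x - f1 y) < \<delta> \<longrightarrow> cmod (f2 x - f2 y) < \<delta> \<longrightarrow> cmod (g x - g y) < \<epsilon>"
    and G: "group G"
  shows "g \<in> AP G"
proof -
  interpret group G by fact
  have "\<exists>\<P>. finite \<P> \<and> \<Union>\<P> = carrier G \<and>
        (\<forall>P\<in>\<P>. \<forall>x\<in>P. \<forall>y\<in>P. \<forall>z\<in>carrier G. \<forall>w\<in>carrier G.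
           cmod (g (z \<otimes>\<^bsub>G\<^esub> x \<otimes>\<^bsub>G\<^esub> w) - g (z \<otimes>\<^bsub>G\<^esub> y \<otimes>\<^bsub>G\<^esub> w)) < \<epsilon>)" if \<epsilon>: "\<epsilon> > 0" for \<epsilon>
  proof -
    obtain f1 f2 \<delta> where f: "f1 \<in> AP G" "f2 \<in> AP G" "\<delta> > 0" and
      close: "\<And>x y. x \<in> carrier G \<Longrightarrow> y \<in> carrier G \<Longrightarrow>
        cmod (f1 x - f1 y) < \<delta> \<Longrightarrow> cmod (f2 x - f2 y) < \<delta> \<Longrightarrow> cmod (g x - g y) < \<epsilon>"
      using ex[OF \<epsilon>] by blast
    obtain P1 where P1: "finite P1" "\<Union>P1 = carrier G" "\<forall>P\<in>P1. \<forall>x\<in>P. \<forall>y\<in>P.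
        \<forall>z\<in>carrier G. \<forall>w\<in>carrier G. cmod (f1 (z \<otimes>\<^bsub>G\<^esub> x \<otimes>\<^bsub>G\<^esub> w) - f1 (z \<otimes>\<^bsub>G\<^esub> y \<otimes>\<^bsub>G\<^esub> w)) < \<delta>"
      using AP_partition[OF f(1,3)] by (elim exE conjE) (rule that)
    obtain P2 where P2: "finite P2" "\<Union>P2 = carrier G" "\<forall>P\<in>P2. \<forall>x\<in>P. \<forall>y\<in>P.
        \<forall>z\<in>carrier G. \<forall>w\<in>carrier G. cmod (f2 (z \<otimes>\<^bsub>G\<^esub> x \<otimes>\<^bsub>G\<^esub> w) - f2 (z \<otimes>\<^bsub>G\<^esub> y \<otimes>\<^bsub>G\<^esub> w)) < \<delta>"
      using AP_partition[OF f(2,3)] by (elim exE conjE) (rule that)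
    let ?P = "(\<lambda>(A, B). A \<inter> B) ` (P1 \<times> P2)"
    show ?thesis
    proof (intro exI[of _ ?P] conjI ballI)
      show "finite ?P" using P1 P2 by simp
      show "\<Union>?P = carrier G" using P1(2) P2(2) by blast
      fix P x y z w assume P: "P \<in> ?P" and xy: "x \<in> P" "y \<in> P" and zw: "z \<in> carrier G" "w \<in> carrier G"
      obtain A B where AB: "A \<in> P1" "B \<in> P2" "P = A \<inter> B" using P by auto
      have "x \<in> carrier G" "y \<in> carrier G" using AB xy P1(2) by auto
      then show "cmod (g (z \<otimes>\<^bsub>G\<^esub> x \<otimes>\<^bsub>G\<^esub> w) - g (z \<otimes>\<^bsub>G\<^esub> y \<otimes>\<^bsub>G\<^esub> w)) < \<epsilon>"
        using AB xy zw P1(3) P2(3) by (intro close) auto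
    qed
  qed
  then show ?thesis using assms(1,2) by (simp add: AP_def)
qed

lemma AP_continuous: "f \<in> AP G \<Longrightarrow> continuous_map (topo G) euclidean f"
  by (simp add: AP_def)

lemma AP_restrict: "f \<in> AP G \<Longrightarrow> (\<lambda>x\<in>carrier G. f x) = f"
  by (simp add: AP_def extensional_restrict)

context topological_group
begin

lemma continuous_map_mult:
  assumes "continuous_map X (topo G) u" "continuous_map X (topo G) v"
  shows "continuous_map X (topo G) (\<lambda>x. u x \<otimes> v x)"
proof -
  have "continuous_map X (prod_topology (topo G) (topo G)) (\<lambda>x. (u x, v x))"
    using assms by (simp add: continuous_map_paired)
  from continuous_map_compose[OF this continuous_mult] show ?thesis by (simp add: o_def)
qed

lemma AP_bounded:
  assumes "f \<in> AP G"
  obtains B where "B > 0" "\<And>x. x \<in> carrier G \<Longrightarrow> cmod (f x) \<le> B"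
proof -
  have one: "(0::real) < 1" by simp
  obtain \<P> where P: "finite \<P>" "\<Union>\<P> = carrier G" "\<forall>P\<in>\<P>. \<forall>x\<in>P. \<forall>y\<in>P. \<forall>z\<in>carrier G. \<forall>w\<in>carrier G.
           cmod (f (z \<otimes> x \<otimes> w) - f (z \<otimes> y \<otimes> w)) < 1"
    using AP_partition[OF assms one] by (elim exE conjE) (rule that)
  define p where "p P = (SOME x. x \<in> P)" for P :: "'a set"
  have "cmod (f x) \<le> (\<Sum>P\<in>\<P>. cmod (f (p P))) + 1" if x: "x \<in> carrier G" for x
  proof -
    obtain Q where Q: "Q \<in> \<P>" "x \<in> Q" using P(2) x by blast
    have pQ: "p Q \<in> Q" unfolding p_def using Q(2) by (rule someI)
    have pG: "p Q \<in> carrier G" using P(2) Q pQ by blast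
    have "cmod (f (\<one> \<otimes> x \<otimes> \<one>) - f (\<one> \<otimes> p Q \<otimes> \<one>)) < 1" using P(3) Q pQ by blast
    then have "cmod (f x - f (p Q)) < 1" using x pG by simp
    moreover have "cmod (f (p Q)) \<le> (\<Sum>P\<in>\<P>. cmod (f (p P)))" using P(1) Q by (intro member_le_sum) auto
    moreover have "cmod (f x) \<le> cmod (f (p Q)) + cmod (f x - f (p Q))"
      using norm_triangle_ineq[of "f (p Q)" "f x - f (p Q)"] by simp
    ultimately show ?thesis by linarith
  qed
  moreover have "(\<Sum>P\<in>\<P>. cmod (f (p P))) + 1 > 0" by (simp add: add_nonneg_pos sum_nonneg)
  ultimately show ?thesis using that by blast
qed

lemma continuous_map_restrict_carrier:
  "continuous_map (topo G) Y f \<Longrightarrow> continuous_map (topo G) Y (\<lambda>x\<in>carrier G. f x)"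
  by (rule continuous_map_eq) (auto simp: topspace_topo)

lemma AP_const: "(\<lambda>x\<in>carrier G. c) \<in> AP G"
proof -
  have "continuous_map (topo G) euclidean (\<lambda>x\<in>carrier G. c)"
    by (rule continuous_map_restrict_carrier) simp
  moreover have "\<exists>\<P>. finite \<P> \<and> \<Union>\<P> = carrier G \<and>
        (\<forall>P\<in>\<P>. \<forall>x\<in>P. \<forall>y\<in>P. \<forall>z\<in>carrier G. \<forall>w\<in>carrier G.
           cmod ((\<lambda>x\<in>carrier G. c) (z \<otimes> x \<otimes> w) - (\<lambda>x\<in>carrier G. c) (z \<otimes> y \<otimes> w)) < \<epsilon>)" if "\<epsilon> > 0" for \<epsilon> :: real
    using that by (intro exI[of _ "{carrier G}"]) auto
  ultimately show ?thesis by (simp add: AP_def)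
qed

lemma AP_compose2:
  assumes f: "f \<in> AP G" and g: "g \<in> AP G" and \<Phi>: "continuous_on UNIV (\<lambda>(u, v). \<Phi> u v)"
  shows "(\<lambda>x\<in>carrier G. \<Phi> (f x) (g x)) \<in> AP G"
proof (rule AP_I)
  obtain B where B: "B > 0" "\<And>x. x \<in> carrier G \<Longrightarrow> cmod (f x) \<le> B" using AP_bounded[OF f] by blast
  obtain C where C: "C > 0" "\<And>x. x \<in> carrier G \<Longrightarrow> cmod (g x) \<le> C" using AP_bounded[OF g] by blast
  show "continuous_map (topo G) euclidean (\<lambda>x\<in>carrier G. \<Phi> (f x) (g x))"
  proof (rule continuous_map_restrict_carrier)
    have "continuous_map (topo G) euclidean (\<lambda>x. (f x, g x))"
      using AP_continuous[OF f] AP_continuous[OF g] continuous_map_paired[of "topo G" euclidean euclidean f g]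
      by (simp add: prod_topology_euclidean)
    from continuous_map_compose[OF this, of euclidean "\<lambda>(u, v). \<Phi> u v"] \<Phi>
    show "continuous_map (topo G) euclidean (\<lambda>x. \<Phi> (f x) (g x))" by (simp add: o_def)
  qed
  fix \<epsilon> :: real assume \<epsilon>: "\<epsilon> > 0"
  have "compact (cball (0::complex) B \<times> cball (0::complex) C)" by (intro compact_Times compact_cball)
  then have "uniformly_continuous_on (cball 0 B \<times> cball 0 C) (\<lambda>(u, v). \<Phi> u v)"
    using \<Phi> continuous_on_subset by (intro compact_uniformly_continuous) auto
  then obtain \<delta> where \<delta>: "\<delta> > 0" "\<And>p q. p \<in> cball 0 B \<times> cball 0 C \<Longrightarrow> q \<in> cball 0 B \<times> cball 0 C \<Longrightarrow>
      dist p q < \<delta> \<Longrightarrow> dist ((\<lambda>(u, v). \<Phi> u v) p) ((\<lambda>(u, v). \<Phi> u v) q) < \<epsilon>"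
    unfolding uniformly_continuous_on_def using \<epsilon> by metis
  have "cmod (\<Phi> (f x) (g x) - \<Phi> (f y) (g y)) < \<epsilon>"
    if xy: "x \<in> carrier G" "y \<in> carrier G" and d: "cmod (f x - f y) < \<delta>/2" "cmod (g x - g y) < \<delta>/2" for x y
  proof -
    have "dist (f x, g x) (f y, g y) \<le> dist (f x) (f y) + dist (g x) (g y)"
      unfolding dist_Pair_Pair by (rule sqrt_sum_squares_le_sum) auto
    also have "\<dots> < \<delta>" using d by (simp add: dist_norm)
    finally show ?thesis using \<delta>(2)[of "(f x, g x)" "(f y, g y)"] xy B C by (simp add: dist_norm)
  qed
  then show "\<exists>f1\<in>AP G. \<exists>f2\<in>AP G. \<exists>\<delta>>0. \<forall>x\<in>carrier G. \<forall>y\<in>carrier G.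
      cmod (f1 x - f1 y) < \<delta> \<longrightarrow> cmod (f2 x - f2 y) < \<delta> \<longrightarrow>
      cmod ((\<lambda>x\<in>carrier G. \<Phi> (f x) (g x)) x - (\<lambda>x\<in>carrier G. \<Phi> (f x) (g x)) y) < \<epsilon>"
    using f g \<delta>(1) by (intro bexI[of _ f] bexI[of _ g] exI[of _ "\<delta>/2"]) auto
qed (auto intro: is_group)

lemma AP_compose:
  assumes f: "f \<in> AP G" and \<Phi>: "continuous_on UNIV \<Phi>"
  shows "(\<lambda>x\<in>carrier G. \<Phi> (f x)) \<in> AP G"
proof (rule AP_compose2[OF f f, of "\<lambda>u v. \<Phi> u"])
  have "continuous_on UNIV (\<lambda>p :: complex \<times> complex. \<Phi> (fst p))"
    using \<Phi> continuous_on_compose2[OF \<Phi> continuous_on_fst[OF continuous_on_id], of UNIV] by auto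
  then show "continuous_on UNIV (\<lambda>(u :: complex, v :: complex). \<Phi> u)" by (simp add: case_prod_unfold)
qed

lemma AP_add: "f \<in> AP G \<Longrightarrow> g \<in> AP G \<Longrightarrow> (\<lambda>x\<in>carrier G. f x + g x) \<in> AP G"
  by (rule AP_compose2) (auto intro!: continuous_intros simp: case_prod_unfold)

lemma AP_diff: "f \<in> AP G \<Longrightarrow> g \<in> AP G \<Longrightarrow> (\<lambda>x\<in>carrier G. f x - g x) \<in> AP G"
  by (rule AP_compose2) (auto intro!: continuous_intros simp: case_prod_unfold)

lemma AP_cmult: "f \<in> AP G \<Longrightarrow> (\<lambda>x\<in>carrier G. c * f x) \<in> AP G"
  by (rule AP_compose) (auto intro!: continuous_intros)

lemma AP_uniform_limit:
  assumes "g \<in> extensional (carrier G)"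
    and ex: "\<And>\<epsilon>. \<epsilon> > 0 \<Longrightarrow> \<exists>f\<in>AP G. \<forall>x\<in>carrier G. cmod (g x - f x) < \<epsilon>"
  shows "g \<in> AP G"
proof (rule AP_I)
  have tri: "cmod (g x - g y) < \<epsilon>" if "cmod (g x - f x) < \<epsilon>/3" "cmod (g y - f y) < \<epsilon>/3" "cmod (f x - f y) < \<epsilon>/3"
    for \<epsilon> x y and f :: "'a \<Rightarrow> complex"
  proof -
    have "cmod (g x - g y) \<le> cmod (g x - f x + (f x - f y)) + cmod (g y - f y)"
      using norm_triangle_ineq4[of "(g x - f x) + (f x - f y)" "g y - f y"] by simp
    also have "cmod (g x - f x + (f x - f y)) \<le> cmod (g x - f x) + cmod (f x - f y)"
      by (rule norm_triangle_ineq)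
    finally have "cmod (g x - g y) \<le> cmod (g x - f x) + cmod (f x - f y) + cmod (g y - f y)" by simp
    then show ?thesis using that by linarith
  qed
  show "continuous_map (topo G) euclidean g"
    unfolding continuous_map_eps topspace_topo
  proof (intro ballI allI impI)
    fix x and \<epsilon> :: real assume x: "x \<in> carrier G" and \<epsilon>: "\<epsilon> > 0"
    obtain f where f: "f \<in> AP G" "\<forall>x\<in>carrier G. cmod (g x - f x) < \<epsilon>/3" using ex[of "\<epsilon>/3"] \<epsilon> by auto
    obtain U where U: "openin (topo G) U" "x \<in> U" "\<forall>y\<in>U. dist (f y) (f x) < \<epsilon>/3"
      using AP_continuous[OF f(1)] x \<epsilon> unfolding continuous_map_eps topspace_topo
      by (metis zero_less_divide_iff zero_less_numeral)
    have "U \<subseteq> carrier G" using openin_subset[OF U(1)] topspace_topo by simp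
    then show "\<exists>U. openin (topo G) U \<and> x \<in> U \<and> (\<forall>y\<in>U. dist (g y) (g x) < \<epsilon>)"
      using U f(2) x by (intro exI[of _ U]) (auto simp: dist_norm intro!: tri[of _ f])
  qed
  fix \<epsilon> :: real assume \<epsilon>: "\<epsilon> > 0"
  obtain f where f: "f \<in> AP G" "\<forall>x\<in>carrier G. cmod (g x - f x) < \<epsilon>/3" using ex[of "\<epsilon>/3"] \<epsilon> by auto
  show "\<exists>f1\<in>AP G. \<exists>f2\<in>AP G. \<exists>\<delta>>0. \<forall>x\<in>carrier G. \<forall>y\<in>carrier G.
      cmod (f1 x - f1 y) < \<delta> \<longrightarrow> cmod (f2 x - f2 y) < \<delta> \<longrightarrow> cmod (g x - g y) < \<epsilon>"
    using f \<epsilon> by (intro bexI[of _ f] exI[of _ "\<epsilon>/3"]) (auto intro!: tri[of _ f])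
qed (auto intro: is_group assms)

end

section \<open>Functionals with values in the range\<close>

text \<open>The form in which the non-vanishing hypothesis is used: \<open>\<phi> f\<close> is one of the values of
\<open>f\<close>, equivalently \<open>f - \<phi> f\<close> has a zero.\<close>

locale range_functional = topological_group G for G :: "'g topgroup" (structure) +
  fixes \<phi> :: "('g \<Rightarrow> complex) \<Rightarrow> complex"
  assumes in_range: "f \<in> AP G \<Longrightarrow> \<exists>x\<in>carrier G. \<phi> f = f x"
    and add: "f \<in> AP G \<Longrightarrow> g \<in> AP G \<Longrightarrow> \<phi> (\<lambda>x\<in>carrier G. f x + g x) = \<phi> f + \<phi> g"
    and cmult: "f \<in> AP G \<Longrightarrow> \<phi> (\<lambda>x\<in>carrier G. c * f x) = c * \<phi> f"
begin

lemma const: "\<phi> (\<lambda>x\<in>carrier G. c) = c"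
  using in_range[OF AP_const[of c]] by auto

lemma diff:
  assumes "f \<in> AP G" "g \<in> AP G" shows "\<phi> (\<lambda>x\<in>carrier G. f x - g x) = \<phi> f - \<phi> g"
proof -
  have "(\<lambda>x\<in>carrier G. f x - g x) = (\<lambda>x\<in>carrier G. f x + (\<lambda>x\<in>carrier G. (-1) * g x) x)" by (rule restrict_ext) simp
  then show ?thesis using assms by (simp only: add AP_cmult cmult) simp
qed

lemma bounded:
  assumes "f \<in> AP G" "\<And>x. x \<in> carrier G \<Longrightarrow> cmod (f x) \<le> B" shows "cmod (\<phi> f) \<le> B"
  using in_range[OF assms(1)] assms(2) by auto

text \<open>The value of \<open>\<phi>\<close> at \<open>a + \<i> * b\<close> is taken at a single point, and real
and imaginary parts can be compared because \<open>\<phi>\<close> is real on real functions.\<close>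

lemma two_real:
  assumes a: "(\<lambda>x\<in>carrier G. complex_of_real (a x)) \<in> AP G" and b: "(\<lambda>x\<in>carrier G. complex_of_real (b x)) \<in> AP G"
  shows "\<exists>x\<in>carrier G. \<phi> (\<lambda>x\<in>carrier G. complex_of_real (a x)) = a x \<and> \<phi> (\<lambda>x\<in>carrier G. complex_of_real (b x)) = b x"
proof -
  let ?a = "\<lambda>x\<in>carrier G. complex_of_real (a x)" and ?b = "\<lambda>x\<in>carrier G. complex_of_real (b x)"
  \<comment> \<open>the nested restrictions keep each summand an element of \<open>AP G\<close>\<close>
  let ?s = "\<lambda>x\<in>carrier G. ?a x + (\<lambda>x\<in>carrier G. \<i> * ?b x) x"
  have "\<phi> ?s = \<phi> ?a + \<i> * \<phi> ?b" using a b by (simp only: add AP_cmult cmult)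
  moreover obtain x where x: "x \<in> carrier G" "\<phi> ?s = ?s x" using in_range AP_add[OF a AP_cmult[OF b]] by blast
  moreover obtain p where "p \<in> carrier G" "\<phi> ?a = ?a p" using in_range a by blast
  moreover obtain q where "q \<in> carrier G" "\<phi> ?b = ?b q" using in_range b by blast
  ultimately have "complex_of_real (a x) + \<i> * complex_of_real (b x) = complex_of_real (a p) + \<i> * complex_of_real (b q)"
     "\<phi> ?a = a p" "\<phi> ?b = b q"
    by auto
  then show ?thesis using x(1) by (intro bexI[of _ x]) (auto simp: complex_eq_iff)
qed

lemma real_square:
  assumes a: "(\<lambda>x\<in>carrier G. complex_of_real (a x)) \<in> AP G" and 0: "\<phi> (\<lambda>x\<in>carrier G. complex_of_real (a x)) = 0"
  shows "(\<lambda>x\<in>carrier G. complex_of_real ((a x)\<^sup>2)) \<in> AP G" "\<phi> (\<lambda>x\<in>carrier G. complex_of_real ((a x)\<^sup>2)) = 0"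
proof -
  have eq: "(\<lambda>x\<in>carrier G. complex_of_real ((a x)\<^sup>2)) = (\<lambda>x\<in>carrier G. ((\<lambda>x\<in>carrier G. complex_of_real (a x)) x)\<^sup>2)"
    by (rule restrict_ext) simp
  show b: "(\<lambda>x\<in>carrier G. complex_of_real ((a x)\<^sup>2)) \<in> AP G"
    by (subst eq) (rule AP_compose[OF a], intro continuous_intros)
  show "\<phi> (\<lambda>x\<in>carrier G. complex_of_real ((a x)\<^sup>2)) = 0" using two_real[OF a b] 0 by auto
qed

lemma norm_square:
  assumes f: "f \<in> AP G" and 0: "\<phi> f = 0"
  shows "\<phi> (\<lambda>x\<in>carrier G. complex_of_real ((cmod (f x))\<^sup>2)) = 0"
proof -
  let ?a = "\<lambda>x\<in>carrier G. complex_of_real (Re (f x))" and ?b = "\<lambda>x\<in>carrier G. complex_of_real (Im (f x))"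
  have a: "?a \<in> AP G" and b: "?b \<in> AP G"
    by (rule AP_compose[OF f, of "\<lambda>z. complex_of_real (Re z)"], intro continuous_intros)
      (rule AP_compose[OF f, of "\<lambda>z. complex_of_real (Im z)"], intro continuous_intros)
  have "f = (\<lambda>x\<in>carrier G. f x)" by (rule AP_restrict[OF f, symmetric])
  also have "\<dots> = (\<lambda>x\<in>carrier G. ?a x + (\<lambda>x\<in>carrier G. \<i> * ?b x) x)"
    by (rule restrict_ext) (simp add: complex_eq_iff)
  finally have eq: "f = (\<lambda>x\<in>carrier G. ?a x + (\<lambda>x\<in>carrier G. \<i> * ?b x) x)" .
  have "\<phi> f = \<phi> (\<lambda>x\<in>carrier G. ?a x + (\<lambda>x\<in>carrier G. \<i> * ?b x) x)" using eq by (rule arg_cong)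
  also have "\<dots> = \<phi> ?a + \<phi> (\<lambda>x\<in>carrier G. \<i> * ?b x)" by (rule add[OF a AP_cmult[OF b]])
  also have "\<phi> (\<lambda>x\<in>carrier G. \<i> * ?b x) = \<i> * \<phi> ?b" by (rule cmult[OF b])
  finally have "\<phi> f = \<phi> ?a + \<i> * \<phi> ?b" .
  moreover obtain x where "\<phi> ?a = Re (f x)" "\<phi> ?b = Im (f x)" using two_real[OF a b] by blast
  ultimately have "\<phi> ?a = 0" "\<phi> ?b = 0" using 0 by (auto simp: complex_eq_iff)
  note a2 = real_square[OF a this(1)] and b2 = real_square[OF b this(2)]
  have "(\<lambda>x\<in>carrier G. complex_of_real ((cmod (f x))\<^sup>2)) =
     (\<lambda>x\<in>carrier G. (\<lambda>x\<in>carrier G. complex_of_real ((Re (f x))\<^sup>2)) x + (\<lambda>x\<in>carrier G. complex_of_real ((Im (f x))\<^sup>2)) x)"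
    by (rule restrict_ext) (simp add: cmod_power2)
  then have "\<phi> (\<lambda>x\<in>carrier G. complex_of_real ((cmod (f x))\<^sup>2)) = \<phi> \<dots>" by (rule arg_cong)
  also have "\<dots> = 0" by (simp only: add[OF a2(1) b2(1)] a2(2) b2(2) add_0)
  finally show ?thesis .
qed

end

text \<open>The function is \<open>\<Sum>n. w n * \<bar>f n - c n\<bar>\<^sup>2\<close> with weights that make
the series converge uniformly. A range functional with the values \<open>c n\<close> annihilates each term,
hence the partial sums, hence their uniform limit. In this form the lemma serves both for finding a point
from a functional and for finding a functional from a point.\<close>

lemma (in topological_group) common_zero_function:
  assumes f: "\<And>n :: nat. f n \<in> AP G"
  shows "\<exists>g\<in>AP G. (\<forall>x\<in>carrier G. g x = 0 \<longleftrightarrow> (\<forall>n. f n x = c n)) \<and>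
    (\<forall>\<phi>. range_functional G \<phi> \<longrightarrow> (\<forall>n. \<phi> (f n) = c n) \<longrightarrow> \<phi> g = 0)"
proof -
  define h where "h n = (\<lambda>x\<in>carrier G. f n x - (\<lambda>x\<in>carrier G. c n) x)" for n
  have h: "h n \<in> AP G" for n unfolding h_def by (intro AP_diff f AP_const)
  have "\<exists>B>0. \<forall>x\<in>carrier G. cmod (h n x) \<le> B" for n by (rule AP_bounded[OF h[of n]]) blast
  then obtain B where B: "\<And>n. B n > 0" "\<And>n x. x \<in> carrier G \<Longrightarrow> cmod (h n x) \<le> B n" by metis
  define w where "w n = (1/2)^n / (B n)\<^sup>2" for n
  have w: "w n > 0" for n using B(1)[of n] by (simp add: w_def)
  define t where "t n = (\<lambda>x\<in>carrier G. complex_of_real (w n) * (\<lambda>x\<in>carrier G. complex_of_real ((cmod (h n x))\<^sup>2)) x)" for n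
  have tx: "t n x = complex_of_real (w n * (cmod (h n x))\<^sup>2)" if "x \<in> carrier G" for n x
    using that by (simp add: t_def)
  have sq: "(\<lambda>x\<in>carrier G. complex_of_real ((cmod (h n x))\<^sup>2)) \<in> AP G" for n
    by (rule AP_compose[OF h, of "\<lambda>z. complex_of_real ((cmod z)\<^sup>2)"]) (intro continuous_intros)
  have t: "t n \<in> AP G" for n unfolding t_def by (intro AP_cmult sq)
  have le: "w n * (cmod (h n x))\<^sup>2 \<le> (1/2)^n" if "x \<in> carrier G" for n x
  proof -
    have "(cmod (h n x))\<^sup>2 \<le> (B n)\<^sup>2" using B(2)[OF that] by (intro power_mono) auto
    then have "w n * (cmod (h n x))\<^sup>2 \<le> w n * (B n)\<^sup>2" by (rule mult_left_mono[OF _ less_imp_le[OF w]])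
    also have "\<dots> = (1/2)^n" using B(1)[of n] by (simp add: w_def)
    finally show ?thesis .
  qed
  have nn: "0 \<le> w n * (cmod (h n x))\<^sup>2" for n x using w[of n] by simp
  have sm: "summable (\<lambda>n. w n * (cmod (h n x))\<^sup>2)" if "x \<in> carrier G" for x
    by (rule summable_comparison_test'[of "\<lambda>n. (1/2)^n" 0]) (use le[OF that] nn in \<open>auto simp: summable_geometric\<close>)
  define g where "g = (\<lambda>x\<in>carrier G. complex_of_real (\<Sum>n. w n * (cmod (h n x))\<^sup>2))"
  define s where "s = rec_nat (\<lambda>x\<in>carrier G. 0) (\<lambda>n r. \<lambda>x\<in>carrier G. r x + t n x)"
  have s0: "s 0 = (\<lambda>x\<in>carrier G. 0)" and sS: "s (Suc n) = (\<lambda>x\<in>carrier G. s n x + t n x)" for n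
    by (simp_all add: s_def)
  have s: "s n \<in> AP G" for n by (induction n) (simp_all only: s0 sS AP_const AP_add t)
  have sx: "s N x = complex_of_real (\<Sum>n<N. w n * (cmod (h n x))\<^sup>2)" if "x \<in> carrier G" for N x
    using that by (induction N) (simp_all add: s0 sS tx)
  have close: "cmod (g x - s N x) \<le> 2 * (1/2)^N" if x: "x \<in> carrier G" for N x
  proof -
    have "g x - s N x = complex_of_real ((\<Sum>n. w n * (cmod (h n x))\<^sup>2) - (\<Sum>n<N. w n * (cmod (h n x))\<^sup>2))"
      using x by (simp add: g_def sx)
    also have "(\<Sum>n. w n * (cmod (h n x))\<^sup>2) - (\<Sum>n<N. w n * (cmod (h n x))\<^sup>2) = (\<Sum>n. w (n + N) * (cmod (h (n + N) x))\<^sup>2)"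
      using suminf_minus_initial_segment[OF sm[OF x], of N] by simp
    finally have 1: "cmod (g x - s N x) = \<bar>\<Sum>n. w (n + N) * (cmod (h (n + N) x))\<^sup>2\<bar>" by (simp only: norm_of_real)
    have sm': "summable (\<lambda>n. w (n + N) * (cmod (h (n + N) x))\<^sup>2)" using summable_ignore_initial_segment[OF sm[OF x]] .
    have "(\<Sum>n. w (n + N) * (cmod (h (n + N) x))\<^sup>2) \<le> (\<Sum>n. (1/2)^N * (1/2)^n)"
    proof (rule suminf_le[OF _ sm'])
      show "w (n + N) * (cmod (h (n + N) x))\<^sup>2 \<le> (1/2)^N * (1/2)^n" for n
        using le[OF x, of "n + N"] by (simp add: power_add mult.commute)
      show "summable (\<lambda>n. (1/2)^N * (1/2::real)^n)" by (intro summable_mult summable_geometric) simp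
    qed
    also have "\<dots> = 2 * (1/2)^N" by (subst suminf_mult) (simp_all add: summable_geometric suminf_geometric)
    finally show ?thesis using 1 suminf_nonneg[OF sm' nn] by simp
  qed
  have lim0: "(\<lambda>N. 2 * (1/2::real)^N) \<longlonglongrightarrow> 0"
    by (rule tendsto_eq_intros LIMSEQ_power_zero | simp)+
    have gAP: "g \<in> AP G"
    proof (rule AP_uniform_limit)
      fix \<epsilon> :: real assume "\<epsilon> > 0"
      then obtain N where N: "2 * (1/2::real)^N < \<epsilon>"
        using order_tendstoD(2)[OF lim0] by (auto simp: eventually_sequentially)
      show "\<exists>f\<in>AP G. \<forall>x\<in>carrier G. cmod (g x - f x) < \<epsilon>"
        using s N close by (intro bexI[of _ "s N"]) (auto intro: le_less_trans)
    qed (simp add: g_def)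
  show ?thesis
  proof (intro bexI[OF _ gAP] conjI ballI allI impI)
    fix x assume x: "x \<in> carrier G"
    have "g x = 0 \<longleftrightarrow> (\<forall>n. w n * (cmod (h n x))\<^sup>2 = 0)"
      using suminf_eq_zero_iff[OF sm[OF x] nn] x by (simp add: g_def)
    also have "\<dots> \<longleftrightarrow> (\<forall>n. f n x = c n)" using w x by (simp add: h_def less_imp_neq[symmetric])
    finally show "g x = 0 \<longleftrightarrow> (\<forall>n. f n x = c n)" .
  next
    fix \<phi> assume \<phi>: "range_functional G \<phi>" and c: "\<forall>n. \<phi> (f n) = c n"
    interpret F: range_functional G \<phi> by (rule \<phi>)
    have "\<phi> (h n) = 0" for n unfolding h_def using c by (simp only: F.diff f AP_const F.const) simp
    then have "\<phi> (t n) = 0" for n unfolding t_def using F.norm_square[OF h] sq by (simp only: F.cmult) simp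
    then have s0': "\<phi> (s n) = 0" for n by (induction n) (simp_all only: s0 sS F.const F.add s t add_0)
    have "cmod (\<phi> g) \<le> 2 * (1/2)^N" for N
    proof -
      have "cmod (\<phi> (\<lambda>x\<in>carrier G. g x - s N x)) \<le> 2 * (1/2)^N"
        using close by (intro F.bounded AP_diff gAP s) auto
      then show ?thesis using F.diff[OF gAP s] s0' by simp
    qed
    then have "cmod (\<phi> g) \<le> 0" using lim0 by (intro LIMSEQ_le_const[OF lim0]) auto
    then show "\<phi> g = 0" by simp
  qed
qed

context range_functional
begin

lemma simultaneous:
  assumes f: "\<And>n :: nat. f n \<in> AP G"
  shows "\<exists>x\<in>carrier G. \<forall>n. \<phi> (f n) = f n x"
proof -
  obtain g where g: "g \<in> AP G" "\<forall>x\<in>carrier G. g x = 0 \<longleftrightarrow> (\<forall>n. f n x = \<phi> (f n))"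
    "\<forall>\<psi>. range_functional G \<psi> \<longrightarrow> (\<forall>n. \<psi> (f n) = \<phi> (f n)) \<longrightarrow> \<psi> g = 0"
    using common_zero_function[where f = f and c = "\<lambda>n. \<phi> (f n)", OF f] by (elim bexE conjE) (rule that)
  then have "\<phi> g = 0" using range_functional_axioms by simp
  obtain x where "x \<in> carrier G" "\<phi> g = g x" using in_range[OF g(1)] by blast
  then show ?thesis using g(2) \<open>\<phi> g = 0\<close> by (intro bexI[of _ x]) auto
qed

text \<open>The common source of the point \<open>t h\<close>, with \<open>X\<close> the group itself or its Bohr
compactification. If no point \<open>p\<close> worked, the open sets
\<open>{p. F p \<noteq> \<phi> (F \<circ> e)}\<close> would cover \<open>X\<close>; but the image of
a point that represents \<open>\<phi>\<close> on the functions of a countable subcover is not covered.\<close>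

lemma represented:
  assumes X: "Lindelof_space X" and e: "e ` carrier G \<subseteq> topspace X"
    and F: "\<And>F. F \<in> \<F> \<Longrightarrow> continuous_map X euclidean F \<and> (\<lambda>x\<in>carrier G. F (e x)) \<in> AP G"
  shows "\<exists>p\<in>topspace X. \<forall>F\<in>\<F>. \<phi> (\<lambda>x\<in>carrier G. F (e x)) = F p"
proof (rule ccontr)
  assume neg: "\<not> ?thesis"
  define U where "U F = {p \<in> topspace X. F p \<noteq> \<phi> (\<lambda>x\<in>carrier G. F (e x))}" for F
  have op: "openin X (U F)" if "F \<in> \<F>" for F
  proof -
    have "openin X {p \<in> topspace X. F p \<in> - {\<phi> (\<lambda>x\<in>carrier G. F (e x))}}"
      using F[OF that] by (intro openin_continuous_map_preimage[of _ euclidean]) auto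
    then show ?thesis by (simp add: U_def)
  qed
  have "topspace X \<subseteq> \<Union>(U ` \<F>)"
  proof
    fix p assume p: "p \<in> topspace X"
    then have "\<not> (\<forall>F\<in>\<F>. \<phi> (\<lambda>x\<in>carrier G. F (e x)) = F p)" using neg by blast
    then obtain F where F: "F \<in> \<F>" "\<phi> (\<lambda>x\<in>carrier G. F (e x)) \<noteq> F p" by blast
    have "p \<in> U F" unfolding U_def using p F(2) by (intro CollectI conjI) (rule p, rule not_sym)
    then show "p \<in> \<Union>(U ` \<F>)" using F(1) by blast
  qed
  then have cov: "\<Union>(U ` \<F>) = topspace X" by (auto simp: U_def)
  have "\<exists>\<V>. countable \<V> \<and> \<V> \<subseteq> U ` \<F> \<and> \<Union>\<V> = topspace X"
    by (rule Lindelof_spaceD[OF X _ cov]) (use op in blast)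
  then obtain \<V> where V: "countable \<V>" "\<V> \<subseteq> U ` \<F>" "\<Union>\<V> = topspace X"
    by (elim exE conjE) (rule that)
  obtain \<F>' where F': "countable \<F>'" "\<F>' \<subseteq> \<F>" "\<V> = U ` \<F>'"
    using V(1,2) by (metis countable_subset_image)
  have "topspace X \<noteq> {}" using e one_closed by blast
  then have "\<F>' \<noteq> {}" unfolding V(3)[symmetric] F'(3) by blast
  define q where "q = from_nat_into \<F>'"
  have q: "range q = \<F>'" unfolding q_def using \<open>\<F>' \<noteq> {}\<close> F'(1) by (rule range_from_nat_into)
  define f where "f n = (\<lambda>x\<in>carrier G. q n (e x))" for n
  have "f n \<in> AP G" for n unfolding f_def using F F'(2) q by blast
  from simultaneous[of f, OF this] obtain x where x: "x \<in> carrier G" "\<forall>n. \<phi> (f n) = f n x" by blast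
  have "e x \<in> \<Union>\<V>" using V(3) e x(1) by auto
  then obtain F where "F \<in> \<F>'" "e x \<in> U F" using F'(3) by auto
  moreover obtain n where "F = q n" using q \<open>F \<in> \<F>'\<close> by blast
  ultimately show False using x by (simp add: U_def f_def)
qed

end

lemma sigma_compact_imp_Lindelof: "sigma_compact_space X \<Longrightarrow> Lindelof_space X"
proof -
  assume "sigma_compact_space X"
  then obtain C :: "nat \<Rightarrow> 'a set" where C: "\<And>n. compactin X (C n)" "topspace X = (\<Union>n. C n)"
    by (auto simp: sigma_compact_space_def)
  have "Lindelof_space (subtopology X (C n))" for n
    using C(1) by (simp add: compact_imp_Lindelof_space compact_space_subtopology)
  then have "Lindelof_space (subtopology X (\<Union>(range C)))"
    by (intro Lindelof_space_Union) auto
  then show ?thesis using C(2) by (metis subtopology_topspace)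
qed

section \<open>The pseudometric of an almost periodic function\<close>

definition translation_dist :: "'g topgroup \<Rightarrow> ('g \<Rightarrow> complex) \<Rightarrow> 'g \<Rightarrow> 'g \<Rightarrow> real" where
  "translation_dist G f x y =
     (SUP (z, w) \<in> carrier G \<times> carrier G. cmod (f (z \<otimes>\<^bsub>G\<^esub> x \<otimes>\<^bsub>G\<^esub> w) - f (z \<otimes>\<^bsub>G\<^esub> y \<otimes>\<^bsub>G\<^esub> w)))"

locale ap_function = topological_group G for G :: "'g topgroup" (structure) +
  fixes f :: "'g \<Rightarrow> complex"
  assumes f: "f \<in> AP G"
begin

abbreviation td where "td \<equiv> translation_dist G f"

lemma td_upper:
  assumes "x \<in> carrier G" "y \<in> carrier G" "z \<in> carrier G" "w \<in> carrier G"
  shows "cmod (f (z \<otimes> x \<otimes> w) - f (z \<otimes> y \<otimes> w)) \<le> td x y"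
proof -
  obtain B where B: "\<And>x. x \<in> carrier G \<Longrightarrow> cmod (f x) \<le> B" by (rule AP_bounded[OF f]) blast
  have "bdd_above ((\<lambda>(z, w). cmod (f (z \<otimes> x \<otimes> w) - f (z \<otimes> y \<otimes> w))) ` (carrier G \<times> carrier G))"
  proof (rule bdd_aboveI2)
    fix p assume "p \<in> carrier G \<times> carrier G"
    then obtain z w where p: "p = (z, w)" "z \<in> carrier G" "w \<in> carrier G" by auto
    have "cmod (f (z \<otimes> x \<otimes> w) - f (z \<otimes> y \<otimes> w)) \<le> cmod (f (z \<otimes> x \<otimes> w)) + cmod (f (z \<otimes> y \<otimes> w))"
      by (rule norm_triangle_ineq4)
    also have "\<dots> \<le> B + B" using p assms by (intro add_mono B) auto
    finally show "(case p of (z, w) \<Rightarrow> cmod (f (z \<otimes> x \<otimes> w) - f (z \<otimes> y \<otimes> w))) \<le> B + B" using p by simp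
  qed
  from cSUP_upper[OF _ this, of "(z, w)"] assms show ?thesis by (simp add: translation_dist_def)
qed

lemma td_least:
  assumes "\<And>z w. z \<in> carrier G \<Longrightarrow> w \<in> carrier G \<Longrightarrow> cmod (f (z \<otimes> x \<otimes> w) - f (z \<otimes> y \<otimes> w)) \<le> c"
  shows "td x y \<le> c"
  unfolding translation_dist_def
proof (rule cSUP_least)
  show "carrier G \<times> carrier G \<noteq> {}" using one_closed by blast
qed (use assms in auto)

lemma td_norm: "x \<in> carrier G \<Longrightarrow> y \<in> carrier G \<Longrightarrow> cmod (f x - f y) \<le> td x y"
  using td_upper[of x y \<one> \<one>] by simp

lemma td_left_le:
  assumes "x \<in> carrier G" "y \<in> carrier G" "a \<in> carrier G"
  shows "td (a \<otimes> x) (a \<otimes> y) \<le> td x y"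
proof (rule td_least)
  fix z w assume zw: "z \<in> carrier G" "w \<in> carrier G"
  have "cmod (f ((z \<otimes> a) \<otimes> x \<otimes> w) - f ((z \<otimes> a) \<otimes> y \<otimes> w)) \<le> td x y"
    using assms zw by (intro td_upper) auto
  then show "cmod (f (z \<otimes> (a \<otimes> x) \<otimes> w) - f (z \<otimes> (a \<otimes> y) \<otimes> w)) \<le> td x y"
    using assms zw by (simp add: m_assoc)
qed

lemma td_right_le:
  assumes "x \<in> carrier G" "y \<in> carrier G" "a \<in> carrier G"
  shows "td (x \<otimes> a) (y \<otimes> a) \<le> td x y"
proof (rule td_least)
  fix z w assume zw: "z \<in> carrier G" "w \<in> carrier G"
  have "cmod (f (z \<otimes> x \<otimes> (a \<otimes> w)) - f (z \<otimes> y \<otimes> (a \<otimes> w))) \<le> td x y"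
    using assms zw by (intro td_upper) auto
  then show "cmod (f (z \<otimes> (x \<otimes> a) \<otimes> w) - f (z \<otimes> (y \<otimes> a) \<otimes> w)) \<le> td x y"
    using assms zw by (simp add: m_assoc)
qed

sublocale totally_bounded_group G "translation_dist G f"
proof unfold_locales
  show self: "td x x = 0" if "x \<in> carrier G" for x
    using td_least[of x x 0] td_norm[OF that that] by simp
  show "td x y = td y x" for x y
    by (simp add: translation_dist_def norm_minus_commute)
  show "td x z \<le> td x y + td y z" if "x \<in> carrier G" "y \<in> carrier G" "z \<in> carrier G" for x y z
  proof (rule td_least)
    fix p q assume pq: "p \<in> carrier G" "q \<in> carrier G"
    have "cmod (f (p \<otimes> x \<otimes> q) - f (p \<otimes> z \<otimes> q)) \<le>
      cmod (f (p \<otimes> x \<otimes> q) - f (p \<otimes> y \<otimes> q)) + cmod (f (p \<otimes> y \<otimes> q) - f (p \<otimes> z \<otimes> q))"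
      using norm_triangle_ineq[of "f (p \<otimes> x \<otimes> q) - f (p \<otimes> y \<otimes> q)" "f (p \<otimes> y \<otimes> q) - f (p \<otimes> z \<otimes> q)"] by simp
    also have "\<dots> \<le> td x y + td y z" using that pq by (intro add_mono td_upper)
    finally show "cmod (f (p \<otimes> x \<otimes> q) - f (p \<otimes> z \<otimes> q)) \<le> td x y + td y z" .
  qed
  show "td (z \<otimes> x) (z \<otimes> y) = td x y" if "x \<in> carrier G" "y \<in> carrier G" "z \<in> carrier G" for x y z
  proof (rule antisym[OF td_left_le])
    have "td (inv z \<otimes> (z \<otimes> x)) (inv z \<otimes> (z \<otimes> y)) \<le> td (z \<otimes> x) (z \<otimes> y)"
      using that by (intro td_left_le) auto
    then show "td x y \<le> td (z \<otimes> x) (z \<otimes> y)" using that by (simp flip: m_assoc)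
  qed (use that in auto)
  show "td (x \<otimes> z) (y \<otimes> z) = td x y" if "x \<in> carrier G" "y \<in> carrier G" "z \<in> carrier G" for x y z
  proof (rule antisym[OF td_right_le])
    have "td (x \<otimes> z \<otimes> inv z) (y \<otimes> z \<otimes> inv z) \<le> td (x \<otimes> z) (y \<otimes> z)"
      using that by (intro td_right_le) auto
    then show "td x y \<le> td (x \<otimes> z) (y \<otimes> z)" using that by (simp add: m_assoc)
  qed (use that in auto)
  show "\<exists>F. finite F \<and> F \<subseteq> carrier G \<and> (\<forall>x\<in>carrier G. \<exists>a\<in>F. td x a < e)" if e: "e > 0" for e
  proof -
    have "e / 2 > 0" using e by simp
    from AP_partition[OF f this]
    obtain \<P> where P: "finite \<P>" "\<Union>\<P> = carrier G" "\<forall>P\<in>\<P>. \<forall>x\<in>P. \<forall>y\<in>P. \<forall>z\<in>carrier G. \<forall>w\<in>carrier G.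
           cmod (f (z \<otimes> x \<otimes> w) - f (z \<otimes> y \<otimes> w)) < e / 2"
      by (elim exE conjE) (rule that)
    define p where "p P = (SOME x. x \<in> P)" for P :: "'g set"
    have p: "p P \<in> P" if "x \<in> P" for x P unfolding p_def using that by (rule someI)
    show ?thesis
    proof (intro exI[of _ "p ` (\<P> - {{}})"] conjI ballI)
      show "finite (p ` (\<P> - {{}}))" using P(1) by simp
      show "p ` (\<P> - {{}}) \<subseteq> carrier G" using P(2) p by blast
      fix x assume "x \<in> carrier G"
      then obtain Q where Q: "Q \<in> \<P>" "x \<in> Q" using P(2) by blast
      have "td x (p Q) \<le> e / 2"
        using P(3) Q p[OF Q(2)] by (intro td_least less_imp_le) blast
      then have "td x (p Q) < e" using e by simp
      then show "\<exists>a\<in>p ` (\<P> - {{}}). td x a < e" using Q by blast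
    qed
  qed
qed

text \<open>By bi-invariance, the supremum over all \<open>z\<close> and \<open>w\<close> differs little from a maximum
over the points of a finite net, and a finite maximum is continuous.\<close>

lemma td_open:
  assumes x: "x \<in> carrier G" and e: "e > 0"
  shows "\<exists>U. openin (topo G) U \<and> x \<in> U \<and> (\<forall>y\<in>U. td x y < e)"
proof -
  have "e / 8 > 0" using e by simp
  from tb[OF this] obtain F where F: "finite F" "F \<subseteq> carrier G" "\<forall>x\<in>carrier G. \<exists>a\<in>F. td x a < e / 8"
    by (elim exE conjE) (rule that)
  have "continuous_map (topo G) euclidean (\<lambda>y. f (a \<otimes> y \<otimes> b))" if ab: "a \<in> carrier G" "b \<in> carrier G" for a b
  proof -
    have "continuous_map (topo G) (topo G) (\<lambda>y. a \<otimes> y \<otimes> b)"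
      using ab by (intro continuous_map_mult continuous_map_id[unfolded id_def]) (auto simp: topspace_topo)
    from continuous_map_compose[OF this AP_continuous[OF f]] show ?thesis by (simp add: o_def)
  qed
  then have nb: "\<exists>U. openin (topo G) U \<and> x \<in> U \<and> (\<forall>y\<in>U. cmod (f (a \<otimes> y \<otimes> b) - f (a \<otimes> x \<otimes> b)) < e / 4)"
    if "a \<in> carrier G" "b \<in> carrier G" for a b
  proof -
    have "\<forall>x\<in>carrier G. \<forall>e>0. \<exists>U. openin (topo G) U \<and> x \<in> U \<and>
        (\<forall>y\<in>U. cmod (f (a \<otimes> y \<otimes> b) - f (a \<otimes> x \<otimes> b)) < e)"
      using \<open>\<And>a b. a \<in> carrier G \<Longrightarrow> b \<in> carrier G \<Longrightarrow>
        continuous_map (topo G) euclidean (\<lambda>y. f (a \<otimes> y \<otimes> b))\<close>[OF that]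
      unfolding continuous_map_eps topspace_topo dist_norm .
    moreover have "e / 4 > 0" using e by simp
    ultimately show ?thesis using x by blast
  qed
  have "\<forall>p\<in>F \<times> F. \<exists>U. openin (topo G) U \<and> x \<in> U \<and>
     (\<forall>y\<in>U. cmod (f (fst p \<otimes> y \<otimes> snd p) - f (fst p \<otimes> x \<otimes> snd p)) < e / 4)"
  proof
    fix p assume "p \<in> F \<times> F"
    then have "fst p \<in> carrier G" "snd p \<in> carrier G" using F(2) by auto
    then show "\<exists>U. openin (topo G) U \<and> x \<in> U \<and>
     (\<forall>y\<in>U. cmod (f (fst p \<otimes> y \<otimes> snd p) - f (fst p \<otimes> x \<otimes> snd p)) < e / 4)" by (rule nb)
  qed
  then obtain U where U: "\<And>p. p \<in> F \<times> F \<Longrightarrow> openin (topo G) (U p) \<and> x \<in> U p \<and>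
     (\<forall>y\<in>U p. cmod (f (fst p \<otimes> y \<otimes> snd p) - f (fst p \<otimes> x \<otimes> snd p)) < e / 4)"
    by metis
  define V where "V = carrier G \<inter> \<Inter>(U ` (F \<times> F))"
  have "openin (topo G) V"
  proof -
    have "openin (topo G) (topspace (topo G) \<inter> \<Inter>(U ` (F \<times> F)))"
      using F(1) U by (intro openin_Int_Inter) auto
    then show ?thesis by (simp add: V_def topspace_topo)
  qed
  moreover have "x \<in> V" using x U by (auto simp: V_def)
  moreover have "td x y < e" if y: "y \<in> V" for y
  proof -
    have yG: "y \<in> carrier G" using y by (simp add: V_def)
    have "td x y \<le> 3 * e / 4"
    proof (rule td_least)
      fix z w assume zw: "z \<in> carrier G" "w \<in> carrier G"
      obtain a where a: "a \<in> F" "td z a < e / 8" using F(3) zw by blast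
      obtain b where b: "b \<in> F" "td w b < e / 8" using F(3) zw by blast
      have ab: "a \<in> carrier G" "b \<in> carrier G" using a b F(2) by auto
      have near: "cmod (f (z \<otimes> s \<otimes> w) - f (a \<otimes> s \<otimes> b)) \<le> e / 4" if s: "s \<in> carrier G" for s
      proof -
        have "cmod (f (z \<otimes> s \<otimes> w) - f (a \<otimes> s \<otimes> b)) \<le> td (z \<otimes> s \<otimes> w) (a \<otimes> s \<otimes> b)"
          using zw ab s by (intro td_norm) auto
        also have "\<dots> \<le> td (z \<otimes> s \<otimes> w) (a \<otimes> s \<otimes> w) + td (a \<otimes> s \<otimes> w) (a \<otimes> s \<otimes> b)"
          using zw ab s by (intro d_tri) auto
        also have "\<dots> = td z a + td w b" using zw ab s by (simp add: d_left d_right)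
        finally show ?thesis using a b by linarith
      qed
      have mid: "cmod (f (a \<otimes> x \<otimes> b) - f (a \<otimes> y \<otimes> b)) < e / 4"
        using U[of "(a, b)"] a b y by (auto simp: V_def norm_minus_commute)
      have tri: "cmod (p + q - s) \<le> cmod p + cmod q + cmod s" for p q s :: complex
        using norm_triangle_ineq4[of "p + q" s] norm_triangle_ineq[of p q] by linarith
      have "cmod (f (z \<otimes> x \<otimes> w) - f (z \<otimes> y \<otimes> w)) \<le> cmod (f (z \<otimes> x \<otimes> w) - f (a \<otimes> x \<otimes> b))
         + cmod (f (a \<otimes> x \<otimes> b) - f (a \<otimes> y \<otimes> b)) + cmod (f (z \<otimes> y \<otimes> w) - f (a \<otimes> y \<otimes> b))"
        using tri[of "f (z \<otimes> x \<otimes> w) - f (a \<otimes> x \<otimes> b)" "f (a \<otimes> x \<otimes> b) - f (a \<otimes> y \<otimes> b)"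
          "f (z \<otimes> y \<otimes> w) - f (a \<otimes> y \<otimes> b)"] by simp
      then show "cmod (f (z \<otimes> x \<otimes> w) - f (z \<otimes> y \<otimes> w)) \<le> 3 * e / 4"
        using near[OF x] near[OF yG] mid by linarith
    qed
    then show ?thesis using e by linarith
  qed
  ultimately show ?thesis by blast
qed

lemma UC_continuous:
  assumes g: "UC g" shows "continuous_map (topo G) euclidean g"
  unfolding continuous_map_eps topspace_topo
proof (intro ballI allI impI)
  fix x and e :: real assume x: "x \<in> carrier G" and e: "e > 0"
  obtain r where r: "r > 0" "\<And>x y. x \<in> carrier G \<Longrightarrow> y \<in> carrier G \<Longrightarrow> td x y < r \<Longrightarrow> \<bar>g x - g y\<bar> < e"
    using UC_obtain[OF g e] by blast
  obtain U where U: "openin (topo G) U" "x \<in> U" "\<forall>y\<in>U. td x y < r" using td_open[OF x r(1)] by blast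
  have "U \<subseteq> carrier G" using openin_subset[OF U(1)] topspace_topo by simp
  then show "\<exists>U. openin (topo G) U \<and> x \<in> U \<and> (\<forall>y\<in>U. dist (g y) (g x) < e)"
    using U r(2)[OF x] by (intro exI[of _ U]) (auto simp: dist_real_def abs_minus_commute)
qed

lemma UC_AP:
  assumes g: "UC g" shows "(\<lambda>x\<in>carrier G. complex_of_real (g x)) \<in> AP G"
proof -
  have "continuous_map (topo G) euclidean (\<lambda>x. complex_of_real (g x))"
    using continuous_map_compose[OF UC_continuous[OF g], of euclidean complex_of_real]
    by (simp add: o_def continuous_on_of_real)
  then have c: "continuous_map (topo G) euclidean (\<lambda>x\<in>carrier G. complex_of_real (g x))"
    by (rule continuous_map_restrict_carrier)
  have "\<exists>\<P>. finite \<P> \<and> \<Union>\<P> = carrier G \<and>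
        (\<forall>P\<in>\<P>. \<forall>x\<in>P. \<forall>y\<in>P. \<forall>z\<in>carrier G. \<forall>w\<in>carrier G.
           cmod ((\<lambda>x\<in>carrier G. complex_of_real (g x)) (z \<otimes> x \<otimes> w)
             - (\<lambda>x\<in>carrier G. complex_of_real (g x)) (z \<otimes> y \<otimes> w)) < e)" if e: "e > 0" for e :: real
  proof -
    obtain r where r: "r > 0" "\<And>x y. x \<in> carrier G \<Longrightarrow> y \<in> carrier G \<Longrightarrow> td x y < r \<Longrightarrow> \<bar>g x - g y\<bar> < e"
      using UC_obtain[OF g e] by blast
    have "r / 2 > 0" using r by simp
    from tb[OF this] obtain F where F: "finite F" "F \<subseteq> carrier G" "\<forall>x\<in>carrier G. \<exists>a\<in>F. td x a < r / 2"
      by (elim exE conjE) (rule that)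
    define Q where "Q a = {x \<in> carrier G. td x a < r / 2}" for a
    show ?thesis
    proof (intro exI[of _ "Q ` F"] conjI ballI)
      show "finite (Q ` F)" using F by simp
      show "\<Union>(Q ` F) = carrier G" using F(3) by (auto simp: Q_def)
      fix P x y z w assume P: "P \<in> Q ` F" "x \<in> P" "y \<in> P" and zw: "z \<in> carrier G" "w \<in> carrier G"
      then obtain a where a: "a \<in> F" "x \<in> Q a" "y \<in> Q a" by blast
      have xy: "x \<in> carrier G" "y \<in> carrier G" "a \<in> carrier G" "td x a < r / 2" "td y a < r / 2"
        using a F(2) by (auto simp: Q_def)
      have "td (z \<otimes> x \<otimes> w) (z \<otimes> y \<otimes> w) = td x y" using xy zw by (simp add: d_left d_right)
      also have "\<dots> \<le> td x a + td a y" using xy by (intro d_tri) auto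
      also have "\<dots> < r" using xy d_sym[of a y] by simp
      finally have "\<bar>g (z \<otimes> x \<otimes> w) - g (z \<otimes> y \<otimes> w)\<bar> < e" using xy zw by (intro r(2)) auto
      then show "cmod ((\<lambda>x\<in>carrier G. complex_of_real (g x)) (z \<otimes> x \<otimes> w)
             - (\<lambda>x\<in>carrier G. complex_of_real (g x)) (z \<otimes> y \<otimes> w)) < e"
        using xy zw by (simp flip: of_real_diff)
    qed
  qed
  then show ?thesis using c by (simp add: AP_def)
qed

lemma Re_UC: "UC (\<lambda>x. Re (f x))"
proof (rule UC_lipschitz[of _ 1])
  fix x y assume xy: "x \<in> carrier G" "y \<in> carrier G"
  have "\<bar>Re (f x) - Re (f y)\<bar> \<le> cmod (f x - f y)" using abs_Re_le_cmod[of "f x - f y"] by simp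
  then show "\<bar>Re (f x) - Re (f y)\<bar> \<le> 1 * td x y" using td_norm[OF xy] by simp
qed

end

section \<open>Coefficients of unitary representations\<close>

text \<open>Reduces continuity into a unitary group to that of the matrix entries.\<close>

lemma cont_map_unitary_iff:
  "continuous_map X (topo (unitary_group n)) D \<longleftrightarrow>
     D ` topspace X \<subseteq> unitary_mats n \<and> (\<forall>p\<in>{..<n} \<times> {..<n}. continuous_map X euclidean (\<lambda>x. D x $$ p))"
proof -
  let ?e = "\<lambda>A :: complex mat. \<lambda>p\<in>{..<n} \<times> {..<n}. A $$ p"
  let ?P = "product_topology (\<lambda>_. euclidean) ({..<n} \<times> {..<n}) :: (nat \<times> nat \<Rightarrow> complex) topology"
  have top: "topo (unitary_group n) = pullback_topology (unitary_mats n) ?e ?P" by (simp add: unitary_group_def)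
  have comp: "continuous_map X ?P (?e \<circ> D) \<longleftrightarrow> (\<forall>p\<in>{..<n} \<times> {..<n}. continuous_map X euclidean (\<lambda>x. D x $$ p))"
    by (auto simp: continuous_map_componentwise o_def)
  show ?thesis
  proof
    assume c: "continuous_map X (topo (unitary_group n)) D"
    have "topspace (topo (unitary_group n)) \<subseteq> unitary_mats n"
      unfolding top by (simp add: topspace_pullback_topology)
    then have "D ` topspace X \<subseteq> unitary_mats n" using continuous_map_image_subset_topspace[OF c] by blast
    moreover have "continuous_map (topo (unitary_group n)) ?P ?e"
      using continuous_map_pullback[OF continuous_map_id, of "unitary_mats n" ?e ?P] by (simp add: top)
    from continuous_map_compose[OF c this] comp
    have "\<forall>p\<in>{..<n} \<times> {..<n}. continuous_map X euclidean (\<lambda>x. D x $$ p)" by simp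
    ultimately show "D ` topspace X \<subseteq> unitary_mats n \<and> (\<forall>p\<in>{..<n} \<times> {..<n}. continuous_map X euclidean (\<lambda>x. D x $$ p))"
      by blast
  next
    assume "D ` topspace X \<subseteq> unitary_mats n \<and> (\<forall>p\<in>{..<n} \<times> {..<n}. continuous_map X euclidean (\<lambda>x. D x $$ p))"
    then show "continuous_map X (topo (unitary_group n)) D"
      unfolding top using comp by (intro continuous_map_pullback') auto
  qed
qed

lemma Rep_iff:
  assumes "topological_group G"
  shows "D \<in> Rep n G \<longleftrightarrow> (\<forall>x\<in>carrier G. D x \<in> unitary_mats n) \<and>
     (\<forall>x\<in>carrier G. \<forall>y\<in>carrier G. D (x \<otimes>\<^bsub>G\<^esub> y) = D x * D y) \<and>
     (\<forall>i<n. \<forall>k<n. continuous_map (topo G) euclidean (\<lambda>x. D x $$ (i, k)))"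
  using topological_group.topspace_topo[OF assms]
  by (auto simp: Rep_def cont_hom_def cont_map_unitary_iff hom_def unitary_group_def[THEN arg_cong, of carrier]
      unitary_group_def[THEN arg_cong, of mult])

context ap_function
begin

lemma orthogonal_rep_Rep:
  assumes \<rho>: "orthogonal_rep n \<rho>"
  shows "(\<lambda>a. mat n n (\<lambda>(i, k). complex_of_real (\<rho> a i k))) \<in> Rep n G"
proof -
  define D where "D a = mat n n (\<lambda>(i, k). complex_of_real (\<rho> a i k))" for a
  have uc: "UC (\<lambda>a. \<rho> a i k)" and one: "\<rho> \<one> i k = (if i = k then 1 else 0)"
    and iv: "a \<in> carrier G \<Longrightarrow> \<rho> (inv a) i k = \<rho> a k i"
    and mul: "a \<in> carrier G \<Longrightarrow> b \<in> carrier G \<Longrightarrow> \<rho> (a \<otimes> b) i k = (\<Sum>j<n. \<rho> a i j * \<rho> b j k)"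
    if "i < n" "k < n" for i k a b
    using \<rho> that unfolding orthogonal_rep_def by blast+
  have D: "D a \<in> carrier_mat n n" for a by (simp add: D_def)
  have Dmul: "D (a \<otimes> b) = D a * D b" if ab: "a \<in> carrier G" "b \<in> carrier G" for a b
    by (rule eq_matI) (use mul ab in \<open>auto simp: D_def scalar_prod_def lessThan_atLeast0\<close>)
  have D1: "D \<one> = 1\<^sub>m n" by (rule eq_matI) (use one in \<open>auto simp: D_def\<close>)
  have Dadj: "mat_adjoint (D a) = D (inv a)" if a: "a \<in> carrier G" for a
    by (rule eq_matI) (use iv a in \<open>auto simp: D_def mat_adjoint_def mat_of_rows_def\<close>)
  have "D a \<in> unitary_mats n" if a: "a \<in> carrier G" for a
    using a D D1 Dmul[of a "inv a"] Dmul[of "inv a" a] by (simp add: unitary_mats_def Dadj)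
  moreover have "continuous_map (topo G) euclidean (\<lambda>a. D a $$ (i, k))" if ik: "i < n" "k < n" for i k
    using continuous_map_compose[OF UC_continuous[OF uc[OF ik]], of euclidean complex_of_real] ik
    by (simp add: o_def continuous_on_of_real D_def)
  ultimately have "D \<in> Rep n G"
    unfolding Rep_iff[OF topological_group_axioms] using Dmul by blast
  then show ?thesis by (simp add: D_def[abs_def])
qed

lemma Re_approximation:
  assumes "\<eta> > 0"
  shows "\<exists>n D C. D \<in> Rep n G \<and> (\<forall>i<n. \<forall>k<n. (\<lambda>x\<in>carrier G. D x $$ (i, k)) \<in> AP G) \<and>
    (\<forall>x\<in>carrier G. cmod (complex_of_real (Re (f x)) - (\<Sum>i<n. \<Sum>k<n. C i k * D x $$ (i, k))) < \<eta>)"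
proof -
  obtain n \<rho> C where \<rho>: "orthogonal_rep n \<rho>"
    and C: "\<forall>x\<in>carrier G. \<bar>Re (f x) - (\<Sum>i<n. \<Sum>k<n. C i k * \<rho> x i k)\<bar> < \<eta>"
    using coefficient_approximation[OF Re_UC assms] by (elim exE conjE) (rule that)
  define D where "D a = mat n n (\<lambda>(i, k). complex_of_real (\<rho> a i k))" for a
  have "D \<in> Rep n G" using orthogonal_rep_Rep[OF \<rho>] by (simp add: D_def[abs_def])
  moreover have "(\<lambda>x\<in>carrier G. D x $$ (i, k)) \<in> AP G" if ik: "i < n" "k < n" for i k
  proof -
    have "UC (\<lambda>a. \<rho> a i k)" using \<rho> ik unfolding orthogonal_rep_def by blast
    from UC_AP[OF this] show ?thesis using ik by (simp add: D_def)
  qed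
  moreover have "cmod (complex_of_real (Re (f x)) - (\<Sum>i<n. \<Sum>k<n. complex_of_real (C i k) * D x $$ (i, k))) < \<eta>"
    if x: "x \<in> carrier G" for x
  proof -
    have "(\<Sum>i<n. \<Sum>k<n. complex_of_real (C i k) * D x $$ (i, k)) = complex_of_real (\<Sum>i<n. \<Sum>k<n. C i k * \<rho> x i k)"
      by (simp add: D_def)
    then have "complex_of_real (Re (f x)) - (\<Sum>i<n. \<Sum>k<n. complex_of_real (C i k) * D x $$ (i, k))
       = complex_of_real (Re (f x) - (\<Sum>i<n. \<Sum>k<n. C i k * \<rho> x i k))" by simp
    then show ?thesis using C x by (simp only: norm_of_real)
  qed
  ultimately show ?thesis
    by (intro exI[of _ n] exI[of _ D] exI[of _ "\<lambda>i k. complex_of_real (C i k)"]) blast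
qed

end

context topological_group
begin

lemma open_left_translate:
  assumes U: "openin (topo G) U" and g: "g \<in> carrier G"
  shows "openin (topo G) {x \<in> carrier G. g \<otimes> x \<in> U}"
proof -
  have "continuous_map (topo G) (topo G) (\<lambda>x. g \<otimes> x)"
    using g by (intro continuous_map_mult continuous_map_id[unfolded id_def]) (simp add: topspace_topo)
  from openin_continuous_map_preimage[OF this U] show ?thesis by (simp add: topspace_topo)
qed

lemma open_subset_carrier: "openin (topo G) U \<Longrightarrow> U \<subseteq> carrier G"
  using openin_subset topspace_topo by metis

lemma square_nbhd:
  assumes U: "openin (topo G) U" and g: "g \<in> U"
  obtains W where "openin (topo G) W" "\<one> \<in> W" "\<And>v w. v \<in> W \<Longrightarrow> w \<in> W \<Longrightarrow> g \<otimes> v \<otimes> w \<in> U"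
proof -
  have gG: "g \<in> carrier G" using open_subset_carrier[OF U] g by blast
  let ?V = "{x \<in> carrier G. g \<otimes> x \<in> U}"
  have V: "openin (topo G) ?V" using U gG by (rule open_left_translate)
  define Z where "Z = {p \<in> topspace (prod_topology (topo G) (topo G)). (\<lambda>(x, y). x \<otimes> y) p \<in> ?V}"
  have "openin (prod_topology (topo G) (topo G)) Z"
    unfolding Z_def using continuous_mult V by (rule openin_continuous_map_preimage)
  moreover have "(\<one>, \<one>) \<in> Z" unfolding Z_def using g gG by (simp add: topspace_topo)
  ultimately have "\<exists>A B. openin (topo G) A \<and> openin (topo G) B \<and> \<one> \<in> A \<and> \<one> \<in> B \<and> A \<times> B \<subseteq> Z"
    unfolding openin_prod_topology_alt by blast
  then obtain A B where AB: "openin (topo G) A" "openin (topo G) B" "\<one> \<in> A" "\<one> \<in> B" "A \<times> B \<subseteq> Z"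
    by blast
  show ?thesis
  proof (rule that)
    show "openin (topo G) (A \<inter> B)" using AB by (intro openin_Int)
    show "\<one> \<in> A \<inter> B" using AB by simp
    fix v w assume vw: "v \<in> A \<inter> B" "w \<in> A \<inter> B"
    then have "(v, w) \<in> A \<times> B" by blast
    then have "v \<otimes> w \<in> ?V" using AB(5) by (auto simp: Z_def)
    moreover have "v \<in> carrier G" "w \<in> carrier G" using vw open_subset_carrier AB(1) by auto
    ultimately show "g \<otimes> v \<otimes> w \<in> U" using gG by (simp add: m_assoc)
  qed
qed

lemma quotient_nbhd:
  assumes U: "openin (topo G) U" and one: "\<one> \<in> U"
  obtains V where "openin (topo G) V" "\<one> \<in> V" "\<And>v w. v \<in> V \<Longrightarrow> w \<in> V \<Longrightarrow> inv v \<otimes> w \<in> U"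
proof -
  obtain W where W: "openin (topo G) W" "\<one> \<in> W" "\<And>v w. v \<in> W \<Longrightarrow> w \<in> W \<Longrightarrow> \<one> \<otimes> v \<otimes> w \<in> U"
    using square_nbhd[OF U one] by blast
  let ?I = "{x \<in> carrier G. inv x \<in> W}"
  have "openin (topo G) ?I"
    using openin_continuous_map_preimage[OF continuous_inv W(1)] by (simp add: topspace_topo)
  then have o: "openin (topo G) (W \<inter> ?I)" using W(1) by (intro openin_Int)
  show ?thesis
  proof (rule that[OF o])
    show "\<one> \<in> W \<inter> ?I" using W(2) by simp
    fix v w assume "v \<in> W \<inter> ?I" "w \<in> W \<inter> ?I"
    then show "inv v \<otimes> w \<in> U" using W(3)[of "inv v" w] by simp
  qed
qed

end

section \<open>Compact groups\<close>

locale compact_topgroup = topological_group K for K :: "'k topgroup" (structure) +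
  assumes compact: "compact_space (topo K)"
begin

lemma translates_cover:
  assumes V: "openin (topo K) V" and ne: "V \<noteq> {}"
  shows "\<exists>S. finite S \<and> S \<subseteq> carrier K \<and> (\<forall>x\<in>carrier K. \<exists>s\<in>S. s \<otimes> x \<in> V)"
proof -
  define P where "P s = {x \<in> carrier K. s \<otimes> x \<in> V}" for s
  obtain v where v: "v \<in> V" "v \<in> carrier K" using ne open_subset_carrier[OF V] by blast
  have "carrier K \<subseteq> \<Union>(P ` carrier K)"
  proof
    fix x assume x: "x \<in> carrier K"
    then have "x \<in> P (v \<otimes> inv x)" using v by (simp add: P_def m_assoc)
    then show "x \<in> \<Union>(P ` carrier K)" using x v(2) by (intro UN_I[of "v \<otimes> inv x"]) auto
  qed
  moreover have "openin (topo K) W" if "W \<in> P ` carrier K" for W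
    using that open_left_translate[OF V] by (auto simp: P_def)
  ultimately obtain \<F> where F: "finite \<F>" "\<F> \<subseteq> P ` carrier K" "carrier K \<subseteq> \<Union>\<F>"
    using compact unfolding compact_space_def compactin_def topspace_topo by meson
  obtain S where S: "S \<subseteq> carrier K" "finite S" "\<F> = P ` S" using finite_subset_image[OF F(1,2)] by blast
  then show ?thesis using F(3) by (intro exI[of _ S]) (auto simp: P_def)
qed

text \<open>A counting substitute for Haar measure. Let \<open>N\<close> be the least number of translates of a small
neighbourhood that cover the group. If \<open>n\<close> translates of \<open>A U \<subseteq> U\<close>
cover the group, then at least \<open>N / n\<close> of the translates of a least cover meet
\<open>A U\<close>. A small translate cannot meet the sets of two different members of the family, so the
family has at most \<open>n\<close> members.\<close>

lemma disjoint_open_bound: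
  fixes \<U> :: "'k set set"
  assumes fin: "finite \<U>" and disj: "disjoint \<U>"
    and ne: "\<And>U. U \<in> \<U> \<Longrightarrow> g U \<in> carrier K \<and> openin (topo K) (W U) \<and> \<one> \<in> W U \<and>
       (\<forall>v\<in>W U. \<forall>w\<in>W U. g U \<otimes> v \<otimes> w \<in> U)"
    and C: "\<And>U. U \<in> \<U> \<Longrightarrow> finite (C U) \<and> C U \<subseteq> carrier K \<and> card (C U) \<le> n \<and>
       (\<forall>x\<in>carrier K. \<exists>c\<in>C U. inv (g U) \<otimes> (c \<otimes> x) \<in> W U)"
  shows "card \<U> \<le> n"
proof -
  define I where "I = carrier K \<inter> \<Inter>(W ` \<U>)"
  have "openin (topo K) (topspace (topo K) \<inter> \<Inter>(W ` \<U>))" using fin ne by (intro openin_Int_Inter) auto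
  then have I: "openin (topo K) I" "\<one> \<in> I" using ne by (auto simp: I_def topspace_topo)
  obtain V where V: "openin (topo K) V" "\<one> \<in> V" "\<And>v w. v \<in> V \<Longrightarrow> w \<in> V \<Longrightarrow> inv v \<otimes> w \<in> I"
    using quotient_nbhd[OF I] by blast
  \<comment> \<open>a cover of the group by as few sets \<open>{x. s \<otimes> x \<in> V}\<close> as possible\<close>
  define cov where "cov S \<longleftrightarrow> finite S \<and> S \<subseteq> carrier K \<and> (\<forall>x\<in>carrier K. \<exists>s\<in>S. s \<otimes> x \<in> V)" for S
  obtain S0 where "cov S0" using translates_cover[OF V(1)] V(2) unfolding cov_def by blast
  then obtain S where S: "cov S" "\<And>S'. cov S' \<Longrightarrow> card S \<le> card S'"
    using ex_has_least_nat[of cov S0 card] by blast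
  have Sf: "finite S" "S \<subseteq> carrier K" "\<And>x. x \<in> carrier K \<Longrightarrow> \<exists>s\<in>S. s \<otimes> x \<in> V" using S(1) by (auto simp: cov_def)
  \<comment> \<open>\<open>A U\<close> is the translate of \<open>W U\<close> by \<open>g U\<close>, and \<open>R U\<close> collects the members of the cover that meet it\<close>
  define A where "A U = {x \<in> carrier K. inv (g U) \<otimes> x \<in> W U}" for U
  define R where "R U = {s \<in> S. \<exists>x\<in>A U. s \<otimes> x \<in> V}" for U
  have le: "card S \<le> n * card (R U)" if U: "U \<in> \<U>" for U
  proof -
    let ?S' = "(\<lambda>(c, s). s \<otimes> c) ` (C U \<times> R U)"
    have "cov ?S'" unfolding cov_def
    proof (intro conjI ballI)
      show "finite ?S'" using C[OF U] Sf by (simp add: R_def)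
      show "?S' \<subseteq> carrier K" using C[OF U] Sf by (auto simp: R_def)
      fix x assume x: "x \<in> carrier K"
      obtain c where c: "c \<in> C U" "inv (g U) \<otimes> (c \<otimes> x) \<in> W U" using C[OF U] x by blast
      have cG: "c \<in> carrier K" using c C[OF U] by blast
      then have cA: "c \<otimes> x \<in> A U" using c x by (simp add: A_def)
      obtain s where s: "s \<in> S" "s \<otimes> (c \<otimes> x) \<in> V" using Sf(3)[of "c \<otimes> x"] cG x by auto
      then have "s \<in> R U" using cA by (auto simp: R_def)
      moreover have "s \<otimes> c \<otimes> x \<in> V" using s x cG Sf(2) by (simp add: m_assoc subset_eq)
      ultimately show "\<exists>s\<in>?S'. s \<otimes> x \<in> V" using c(1) by (intro bexI[of _ "s \<otimes> c"]) auto
    qed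
    then have "card S \<le> card ?S'" by (rule S(2))
    also have "\<dots> \<le> card (C U \<times> R U)" using C[OF U] Sf by (intro card_image_le) (simp add: R_def)
    also have "\<dots> \<le> n * card (R U)" using C[OF U] by (simp add: card_cartesian_product)
    finally show ?thesis .
  qed
  have dR: "R U \<inter> R U' = {}" if U: "U \<in> \<U>" "U' \<in> \<U>" "U \<noteq> U'" for U U'
  proof (rule ccontr)
    assume "R U \<inter> R U' \<noteq> {}"
    then obtain s x y where s: "s \<in> S" and x: "x \<in> A U" "s \<otimes> x \<in> V" and y: "y \<in> A U'" "s \<otimes> y \<in> V"
      by (auto simp: R_def)
    have G: "s \<in> carrier K" "x \<in> carrier K" "y \<in> carrier K" using s Sf(2) x y by (auto simp: A_def)
    have inU: "z \<in> U" if "z \<in> A U" "U \<in> \<U>" for z U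
    proof -
      have "g U \<otimes> (inv (g U) \<otimes> z) \<otimes> \<one> \<in> U" using that ne[OF that(2)] by (auto simp: A_def)
      then show ?thesis using that ne[OF that(2)] by (simp add: A_def flip: m_assoc)
    qed
    have "inv (s \<otimes> x) \<otimes> (s \<otimes> y) \<in> I" using V(3) x y by blast
    moreover have "inv (s \<otimes> x) \<otimes> (s \<otimes> y) = inv x \<otimes> y"
      using G by (simp add: inv_mult_group m_assoc) (simp flip: m_assoc)
    ultimately have "inv x \<otimes> y \<in> W U" using U by (simp add: I_def)
    then have "g U \<otimes> (inv (g U) \<otimes> x) \<otimes> (inv x \<otimes> y) \<in> U" using ne[OF U(1)] x(1) by (auto simp: A_def)
    moreover have "g U \<otimes> (inv (g U) \<otimes> x) = x" using ne[OF U(1)] G by (simp flip: m_assoc)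
    moreover have "x \<otimes> (inv x \<otimes> y) = y" using G by (simp flip: m_assoc)
    ultimately have "y \<in> U" by simp
    moreover have "y \<in> U'" using inU[OF y(1) U(2)] .
    ultimately show False using disj U unfolding disjoint_def by blast
  qed
  have "card \<U> * card S = (\<Sum>U\<in>\<U>. card S)" by simp
  also have "\<dots> \<le> (\<Sum>U\<in>\<U>. n * card (R U))" by (intro sum_mono le)
  also have "\<dots> = n * card (\<Union>(R ` \<U>))"
    using fin dR Sf(1) by (subst card_UN_disjoint) (auto simp: R_def sum_distrib_left)
  also have "\<dots> \<le> n * card S" using Sf(1) by (intro mult_left_mono card_mono) (auto simp: R_def)
  finally have "card \<U> * card S \<le> n * card S" .
  moreover have "card S > 0" using Sf(3)[OF one_closed] Sf(1) by (auto simp: card_gt_0_iff)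
  ultimately show ?thesis by simp
qed

text \<open>The countable chain condition: for each \<open>n\<close>, at most \<open>n\<close> members of the family
contain a set as in \<open>disjoint_open_bound\<close> of which \<open>n\<close> translates cover the group.\<close>

lemma disjoint_open_countable:
  assumes disj: "disjoint \<U>" and op: "\<And>U. U \<in> \<U> \<Longrightarrow> openin (topo K) U \<and> U \<noteq> {}"
  shows "countable \<U>"
proof -
  define Q where "Q U g W C \<longleftrightarrow> g \<in> carrier K \<and> openin (topo K) W \<and> \<one> \<in> W \<and>
     (\<forall>v\<in>W. \<forall>w\<in>W. g \<otimes> v \<otimes> w \<in> U) \<and>
     finite C \<and> C \<subseteq> carrier K \<and> (\<forall>x\<in>carrier K. \<exists>c\<in>C. inv g \<otimes> (c \<otimes> x) \<in> W)" for U g W C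
  have "\<exists>g W C. Q U g W C" if U: "U \<in> \<U>" for U
  proof -
    obtain g where g: "g \<in> U" using op[OF U] by blast
    have gG: "g \<in> carrier K" using g op[OF U] open_subset_carrier by blast
    have "\<exists>W. openin (topo K) W \<and> \<one> \<in> W \<and> (\<forall>v\<in>W. \<forall>w\<in>W. g \<otimes> v \<otimes> w \<in> U)"
      by (rule square_nbhd[of U g]) (use op[OF U] g in blast)+
    then obtain W where W: "openin (topo K) W" "\<one> \<in> W" "\<forall>v\<in>W. \<forall>w\<in>W. g \<otimes> v \<otimes> w \<in> U" by blast
    have "openin (topo K) {x \<in> carrier K. inv g \<otimes> x \<in> W}" using W(1) gG by (intro open_left_translate) auto
    moreover have "g \<in> {x \<in> carrier K. inv g \<otimes> x \<in> W}" using gG W by simp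
    ultimately have "\<exists>C. finite C \<and> C \<subseteq> carrier K \<and>
        (\<forall>x\<in>carrier K. \<exists>c\<in>C. c \<otimes> x \<in> {x \<in> carrier K. inv g \<otimes> x \<in> W})"
      by (intro translates_cover) auto
    then obtain C where C: "finite C" "C \<subseteq> carrier K"
      "\<forall>x\<in>carrier K. \<exists>c\<in>C. c \<otimes> x \<in> {x \<in> carrier K. inv g \<otimes> x \<in> W}"
      by (elim exE conjE) (rule that)
    have "\<forall>x\<in>carrier K. \<exists>c\<in>C. inv g \<otimes> (c \<otimes> x) \<in> W" using C(3) by (simp add: Bex_def) blast
    then have "Q U g W C" unfolding Q_def using gG W C(1,2) by (intro conjI)
    then show ?thesis by (intro exI)
  qed
  then obtain g W C where gWC: "\<And>U. U \<in> \<U> \<Longrightarrow> Q U (g U) (W U) (C U)" by metis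
  define \<V> where "\<V> n = {U \<in> \<U>. card (C U) \<le> n}" for n
  have "finite (\<V> n)" for n
  proof (rule ccontr)
    assume "infinite (\<V> n)"
    then obtain F where F: "F \<subseteq> \<V> n" "finite F" "card F = Suc n"
      using infinite_arbitrarily_large by blast
    have FU: "F \<subseteq> \<U>" "\<And>U. U \<in> F \<Longrightarrow> card (C U) \<le> n" using F(1) by (auto simp: \<V>_def)
    have "card F \<le> n"
    proof (rule disjoint_open_bound[OF F(2), of g W C])
      show "disjoint F" using disj FU(1) unfolding disjoint_def by blast
      show "g U \<in> carrier K \<and> openin (topo K) (W U) \<and> \<one> \<in> W U \<and> (\<forall>v\<in>W U. \<forall>w\<in>W U. g U \<otimes> v \<otimes> w \<in> U)"
        if "U \<in> F" for U using gWC[of U] that FU(1) unfolding Q_def by (simp add: subset_eq)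
      show "finite (C U) \<and> C U \<subseteq> carrier K \<and> card (C U) \<le> n \<and>
          (\<forall>x\<in>carrier K. \<exists>c\<in>C U. inv (g U) \<otimes> (c \<otimes> x) \<in> W U)"
        if "U \<in> F" for U using gWC[of U] that FU(1) FU(2)[OF that] unfolding Q_def by (simp add: subset_eq)
    qed
    then show False using F(3) by simp
  qed
  then have "countable (\<Union>n. \<V> n)" by (intro countable_UN) (auto intro: countable_finite)
  moreover have "\<U> \<subseteq> (\<Union>n. \<V> n)" by (auto simp: \<V>_def)
  ultimately show ?thesis by (rule countable_subset[rotated])
qed

text \<open>Take a maximal disjoint family of open sets \<open>A\<close> that stay inside \<open>U\<close> when
translated by a neighbourhood \<open>W A\<close> of the identity. Its union is dense in \<open>U\<close>,
and it is countable by the chain condition. An element \<open>w\<close> of all \<open>W A\<close>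
translates the union into \<open>U\<close>, hence the closure of \<open>U\<close> into itself.\<close>

lemma closure_of_open_translation:
  assumes U: "openin (topo K) U"
  shows "\<exists>\<W>. countable \<W> \<and> (\<forall>W\<in>\<W>. openin (topo K) W \<and> \<one> \<in> W) \<and>
    (\<forall>y\<in>topo K closure_of U. \<forall>w\<in>carrier K \<inter> \<Inter>\<W>. y \<otimes> w \<in> topo K closure_of U)"
proof -
  define good where "good O' W \<longleftrightarrow> openin (topo K) O' \<and> O' \<noteq> {} \<and> openin (topo K) W \<and> \<one> \<in> W \<and>
    (\<forall>x\<in>O'. \<forall>w\<in>W. x \<otimes> w \<in> U)" for O' W
  define \<D> where "\<D> = {\<A>. (\<forall>A\<in>\<A>. \<exists>W. good A W) \<and> disjoint \<A>}"
  have "\<exists>M\<in>\<D>. \<forall>X\<in>\<D>. M \<subseteq> X \<longrightarrow> X = M"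
  proof (rule subset_Zorn_nonempty)
    show "\<D> \<noteq> {}" by (auto simp: \<D>_def intro!: exI[of _ "{}"])
    fix \<C> assume C: "\<C> \<noteq> {}" "subset.chain \<D> \<C>"
    have "disjoint (\<Union>\<C>)" unfolding disjoint_def
    proof (intro ballI impI)
      fix a b assume "a \<in> \<Union>\<C>" "b \<in> \<Union>\<C>" "a \<noteq> b"
      then obtain A B where AB: "A \<in> \<C>" "B \<in> \<C>" "a \<in> A" "b \<in> B" by blast
      then have "A \<subseteq> B \<or> B \<subseteq> A" using C(2) by (auto simp: subset_chain_def)
      moreover have "disjoint A" "disjoint B" using AB C(2) by (auto simp: subset_chain_def \<D>_def)
      ultimately show "a \<inter> b = {}" using AB \<open>a \<noteq> b\<close> unfolding disjoint_def by blast
    qed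
    moreover have "\<forall>A\<in>\<Union>\<C>. \<exists>W. good A W" using C(2) by (auto simp: subset_chain_def \<D>_def)
    ultimately show "\<Union>\<C> \<in> \<D>" by (simp add: \<D>_def)
  qed
  then obtain M where M0: "M \<in> \<D>" "\<forall>X\<in>\<D>. M \<subseteq> X \<longrightarrow> X = M" by (elim bexE) (rule that)
  then have M: "\<forall>A\<in>M. \<exists>W. good A W" "disjoint M" by (simp_all add: \<D>_def)
  have max: "X = M" if "X \<in> \<D>" "M \<subseteq> X" for X using M0(2) that by blast
  obtain W where W: "\<And>A. A \<in> M \<Longrightarrow> good A (W A)" using M(1) by metis
  have cM: "countable M"
    by (rule disjoint_open_countable[OF M(2)]) (use W in \<open>auto simp: good_def\<close>)
  have MU: "\<Union>M \<subseteq> U"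
  proof
    fix x assume "x \<in> \<Union>M"
    then obtain A where A: "A \<in> M" "x \<in> A" by blast
    have "x \<otimes> \<one> \<in> U" using W[OF A(1)] A(2) by (simp add: good_def)
    moreover have "x \<in> carrier K" using W[OF A(1)] A(2) open_subset_carrier by (auto simp: good_def)
    ultimately show "x \<in> U" by simp
  qed
  have UM: "U \<subseteq> topo K closure_of (\<Union>M)"
  proof (rule ccontr)
    assume "\<not> ?thesis"
    then obtain x where x: "x \<in> U" "x \<notin> topo K closure_of (\<Union>M)" by blast
    then obtain T where T: "openin (topo K) T" "x \<in> T" "T \<inter> \<Union>M = {}"
      using open_subset_carrier[OF U] topspace_topo unfolding in_closure_of by blast
    have "openin (topo K) (U \<inter> T)" using U T(1) by (rule openin_Int)
    moreover have "x \<in> U \<inter> T" using x T by simp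
    ultimately have "\<exists>V. openin (topo K) V \<and> \<one> \<in> V \<and> (\<forall>v\<in>V. \<forall>w\<in>V. x \<otimes> v \<otimes> w \<in> U \<inter> T)"
      by (rule square_nbhd) blast
    then obtain V where V: "openin (topo K) V" "\<one> \<in> V" "\<forall>v\<in>V. \<forall>w\<in>V. x \<otimes> v \<otimes> w \<in> U \<inter> T" by blast
    have xG: "x \<in> carrier K" using x(1) open_subset_carrier[OF U] by blast
    define A where "A = {z \<in> carrier K. inv x \<otimes> z \<in> V}"
    have oA: "openin (topo K) A" unfolding A_def using V(1) xG by (intro open_left_translate) auto
    have xA: "x \<in> A" using xG V(2) by (simp add: A_def)
    have AUT: "z \<otimes> w \<in> U \<inter> T" if "z \<in> A" "w \<in> V" for z w
    proof -
      have "x \<otimes> (inv x \<otimes> z) \<otimes> w \<in> U \<inter> T" using that V(3) by (simp add: A_def)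
      then show ?thesis using that xG by (simp add: A_def flip: m_assoc)
    qed
    have "good A V" using oA xA V AUT by (auto simp: good_def)
    have AT: "A \<subseteq> T"
    proof
      fix z assume z: "z \<in> A"
      have "z \<otimes> \<one> \<in> U \<inter> T" using z V(2) by (rule AUT)
      then show "z \<in> T" using z by (simp add: A_def)
    qed
    have "insert A M \<in> \<D>"
      using M \<open>good A V\<close> AT T(3) unfolding \<D>_def disjoint_def by blast
    then have "A \<in> M" using max[of "insert A M"] by blast
    then show False using AT T(3) xA by blast
  qed
  have cl: "topo K closure_of U = topo K closure_of (\<Union>M)"
    by (intro antisym closure_of_mono[OF MU] closure_of_minimal[OF UM] closedin_closure_of)
  show ?thesis
  proof (intro exI[of _ "W ` M"] conjI ballI)
    show "countable (W ` M)" using cM by simp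
    show "openin (topo K) V" "\<one> \<in> V" if "V \<in> W ` M" for V using that W by (auto simp: good_def)
    fix y w assume y: "y \<in> topo K closure_of U" and w: "w \<in> carrier K \<inter> \<Inter>(W ` M)"
    have "continuous_map (topo K) (topo K) (\<lambda>x. x \<otimes> w)"
      using w by (intro continuous_map_mult continuous_map_id[unfolded id_def]) (simp add: topspace_topo)
    then have 1: "(\<lambda>x. x \<otimes> w) ` (topo K closure_of (\<Union>M)) \<subseteq> topo K closure_of ((\<lambda>x. x \<otimes> w) ` \<Union>M)"
      by (rule continuous_map_image_closure_subset)
    have "(\<lambda>x. x \<otimes> w) ` \<Union>M \<subseteq> U"
    proof
      fix z assume "z \<in> (\<lambda>x. x \<otimes> w) ` \<Union>M"
      then obtain A x where A: "A \<in> M" "x \<in> A" "z = x \<otimes> w" by blast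
      have "w \<in> W A" using w A(1) by blast
      then show "z \<in> U" using W[OF A(1)] A(2,3) by (simp add: good_def)
    qed
    then have 2: "topo K closure_of ((\<lambda>x. x \<otimes> w) ` \<Union>M) \<subseteq> topo K closure_of U" by (rule closure_of_mono)
    have "y \<otimes> w \<in> (\<lambda>x. x \<otimes> w) ` (topo K closure_of (\<Union>M))" using y unfolding cl by (rule imageI)
    then show "y \<otimes> w \<in> topo K closure_of U" using 1 2 by (meson subsetD)
  qed
qed

end

section \<open>Realcompactness and the completion\<close>

text \<open>Let \<open>F\<close> be the trace on \<open>A\<close> of the neighbourhood filter of \<open>y\<close>. A
continuous real function \<open>q\<close> on \<open>A\<close> converges along \<open>F\<close>: if
\<open>y\<close> were in the closures of both \<open>{q < a}\<close> and \<open>{q > c}\<close> with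
\<open>a < c\<close>, so would be all its translates by some \<open>G\<^sub>\<delta>\<close> neighbourhood
of the identity, one of which is in the image of \<open>A\<close>; and infinite limits are excluded as
\<open>{\<bar>q\<bar> > n}\<close> for all \<open>n\<close> would give a \<open>G\<^sub>\<delta>\<close>
set around \<open>y\<close> that misses \<open>A\<close>. So the embedding of \<open>A\<close> as a closed
subspace of a power of the line converges along \<open>F\<close>, coordinate by coordinate, to a point of
the subspace. Thus \<open>F\<close> converges in \<open>A\<close>, and the image of the limit can only be
\<open>y\<close>.\<close>

lemma (in compact_topgroup) realcompact_dense:
  assumes b: "b ` A \<subseteq> carrier K" and dense: "topo K closure_of (b ` A) = carrier K"
    and real: "realcompact_space (pullback_topology A b (topo K))"
    and y: "y \<in> carrier K"
    and Gd: "\<And>O' :: nat \<Rightarrow> 'k set. (\<And>n. openin (topo K) (O' n) \<and> y \<in> O' n) \<Longrightarrow> \<exists>x\<in>A. \<forall>n. b x \<in> O' n"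
  shows "y \<in> b ` A"
proof -
  let ?X = "pullback_topology A b (topo K)"
  define F where "F = inf (filtercomap b (nhdsin (topo K) y)) (principal A)"
  have evF: "eventually P F \<longleftrightarrow> (\<exists>O'. openin (topo K) O' \<and> y \<in> O' \<and> (\<forall>x\<in>A. b x \<in> O' \<longrightarrow> P x))" for P
    unfolding F_def eventually_inf_principal eventually_filtercomap
    using y by (auto simp: eventually_nhdsin topspace_topo)
  have nt: "F \<noteq> bot"
  proof
    assume "F = bot"
    then have "eventually (\<lambda>_. False) F" by simp
    then obtain O' where O': "openin (topo K) O'" "y \<in> O'" "\<forall>x\<in>A. b x \<notin> O'" unfolding evF by blast
    have "y \<in> topo K closure_of (b ` A)" using dense y by simp
    then show False using O' unfolding in_closure_of by blast
  qed
  have Gd': "\<exists>x\<in>A. \<forall>O'\<in>\<O>. b x \<in> O'" if c: "countable \<O>" and o: "\<And>O'. O' \<in> \<O> \<Longrightarrow> openin (topo K) O' \<and> y \<in> O'" for \<O>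
  proof -
    have y': "openin (topo K) (carrier K)" using topspace_topo openin_topspace[of "topo K"] by simp
    define e where "e = from_nat_into (insert (carrier K) \<O>)"
    have e: "range e = insert (carrier K) \<O>" unfolding e_def using c by (intro range_from_nat_into) auto
    have "openin (topo K) (e n) \<and> y \<in> e n" for n
    proof -
      have "e n \<in> insert (carrier K) \<O>" using e by blast
      then show ?thesis using o y y' by auto
    qed
    then obtain x where "x \<in> A" "\<forall>n. b x \<in> e n" using Gd by blast
    moreover have "\<exists>n. O' = e n" if "O' \<in> \<O>" for O' using e that by blast
    ultimately show ?thesis by metis
  qed
  have clX: "topo K closure_of U = topo K closure_of (U \<inter> b ` A)" if U: "openin (topo K) U" for U
  proof (rule antisym[OF closure_of_minimal[OF _ closedin_closure_of] closure_of_mono])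
    show "U \<subseteq> topo K closure_of (U \<inter> b ` A)"
    proof
      fix z assume z: "z \<in> U"
      have zG: "z \<in> topspace (topo K)" using z openin_subset[OF U] by blast
      have zc: "z \<in> topo K closure_of (b ` A)" using dense zG topspace_topo by simp
      show "z \<in> topo K closure_of (U \<inter> b ` A)"
        unfolding in_closure_of
      proof (intro conjI allI impI zG)
        fix T assume T: "z \<in> T \<and> openin (topo K) T"
        then have "openin (topo K) (U \<inter> T)" "z \<in> U \<inter> T" using U z by (auto intro: openin_Int)
        then obtain p where "p \<in> b ` A" "p \<in> U \<inter> T" using zc unfolding in_closure_of by blast
        then show "\<exists>p. p \<in> U \<inter> b ` A \<and> p \<in> T" by blast
      qed
    qed
  qed auto
  have dich: "eventually (\<lambda>x. q x \<ge> a) F \<or> eventually (\<lambda>x. q x \<le> c) F"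
    if q: "continuous_map ?X euclideanreal q" and ac: "a < c" for q a c
  proof (rule ccontr)
    assume neg: "\<not> ?thesis"
    have tX: "topspace ?X = A" using b by (auto simp: topspace_pullback_topology topspace_topo)
    have opq: "\<exists>U. openin (topo K) U \<and> {x \<in> A. q x \<in> R} = b -` U \<inter> A" if "open R" for R
    proof -
      have "openin ?X {x \<in> topspace ?X. q x \<in> R}"
        using q by (rule openin_continuous_map_preimage) (use that in simp)
      then show ?thesis unfolding tX openin_pullback_topology by blast
    qed
    obtain U where U: "openin (topo K) U" "{x \<in> A. q x < a} = b -` U \<inter> A" using opq[of "{..<a}"] by auto
    obtain V where V: "openin (topo K) V" "{x \<in> A. q x > c} = b -` V \<inter> A" using opq[of "{c<..}"] by auto
    have inU: "x \<in> A \<Longrightarrow> b x \<in> U \<longleftrightarrow> q x < a" and inV: "x \<in> A \<Longrightarrow> b x \<in> V \<longleftrightarrow> q x > c" for x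
      using U(2) V(2) by blast+
    have yU: "y \<in> topo K closure_of U"
    proof (rule ccontr)
      assume "\<not> ?thesis"
      then obtain T where T: "openin (topo K) T" "y \<in> T" "T \<inter> U = {}"
        using y topspace_topo unfolding in_closure_of by blast
      have "\<forall>x\<in>A. b x \<in> T \<longrightarrow> q x \<ge> a"
      proof (intro ballI impI)
        fix x assume "x \<in> A" "b x \<in> T"
        then show "q x \<ge> a" using T(3) inU[of x] by (auto simp: not_less)
      qed
      then show False using T neg evF by blast
    qed
    have yV: "y \<in> topo K closure_of V"
    proof (rule ccontr)
      assume "\<not> ?thesis"
      then obtain T where T: "openin (topo K) T" "y \<in> T" "T \<inter> V = {}"
        using y topspace_topo unfolding in_closure_of by blast
      have "\<forall>x\<in>A. b x \<in> T \<longrightarrow> q x \<le> c"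
      proof (intro ballI impI)
        fix x assume "x \<in> A" "b x \<in> T"
        then show "q x \<le> c" using T(3) inV[of x] by (auto simp: not_less)
      qed
      then show False using T neg evF by blast
    qed
    obtain \<W>1 where W1: "countable \<W>1" "\<forall>W\<in>\<W>1. openin (topo K) W \<and> \<one> \<in> W"
      "\<forall>y\<in>topo K closure_of U. \<forall>w\<in>carrier K \<inter> \<Inter>\<W>1. y \<otimes> w \<in> topo K closure_of U"
      using closure_of_open_translation[OF U(1)] by (elim exE conjE) (rule that)
    obtain \<W>2 where W2: "countable \<W>2" "\<forall>W\<in>\<W>2. openin (topo K) W \<and> \<one> \<in> W"
      "\<forall>y\<in>topo K closure_of V. \<forall>w\<in>carrier K \<inter> \<Inter>\<W>2. y \<otimes> w \<in> topo K closure_of V"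
      using closure_of_open_translation[OF V(1)] by (elim exE conjE) (rule that)
    \<comment> \<open>\<open>tr W\<close> is the translate of \<open>W\<close> by \<open>y\<close>, a neighbourhood of \<open>y\<close>\<close>
    define tr where "tr W = {x \<in> carrier K. inv y \<otimes> x \<in> W}" for W
    have "\<exists>x\<in>A. \<forall>O'\<in>tr ` (\<W>1 \<union> \<W>2). b x \<in> O'"
    proof (rule Gd')
      show "countable (tr ` (\<W>1 \<union> \<W>2))" using W1(1) W2(1) by simp
      fix O' assume "O' \<in> tr ` (\<W>1 \<union> \<W>2)"
      then obtain W where W: "O' = tr W" "W \<in> \<W>1 \<union> \<W>2" by blast
      then have W': "openin (topo K) W" "\<one> \<in> W" using W1(2) W2(2) by auto
      show "openin (topo K) O' \<and> y \<in> O'"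
        using open_left_translate[OF W'(1), of "inv y"] W'(2) y by (simp add: W(1) tr_def)
    qed
    then obtain x where x: "x \<in> A" "\<forall>W\<in>\<W>1 \<union> \<W>2. b x \<in> tr W" by blast
    have bx: "b x \<in> carrier K" using b x(1) by blast
    have w: "inv y \<otimes> b x \<in> carrier K \<inter> \<Inter>\<W>1" "inv y \<otimes> b x \<in> carrier K \<inter> \<Inter>\<W>2"
      using x(2) bx y by (auto simp: tr_def)
    have yw: "y \<otimes> (inv y \<otimes> b x) = b x" using y bx by (simp flip: m_assoc)
    have xU: "b x \<in> topo K closure_of U" using W1(3) yU w(1) yw by (metis (no_types, lifting))
    have xV: "b x \<in> topo K closure_of V" using W2(3) yV w(2) yw by (metis (no_types, lifting))
    show False
    proof (cases "q x < c")
      case True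
      obtain T where T: "openin (topo K) T" "{x \<in> A. q x < c} = b -` T \<inter> A" using opq[of "{..<c}"] by auto
      have "b x \<in> T" using T(2) x(1) True by blast
      moreover have "b x \<in> topo K closure_of (V \<inter> b ` A)" using xV clX[OF V(1)] by simp
      ultimately obtain p where "p \<in> V \<inter> b ` A" "p \<in> T" using T(1) unfolding in_closure_of by blast
      then obtain x' where "x' \<in> A" "b x' \<in> V" "b x' \<in> T" by blast
      then show False using inV[of x'] T(2) by force
    next
      case False
      then have "q x > a" using ac by simp
      obtain T where T: "openin (topo K) T" "{x \<in> A. q x > a} = b -` T \<inter> A" using opq[of "{a<..}"] by auto
      have "b x \<in> T" using T(2) x(1) \<open>q x > a\<close> by blast
      moreover have "b x \<in> topo K closure_of (U \<inter> b ` A)" using xU clX[OF U(1)] by simp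
      ultimately obtain p where "p \<in> U \<inter> b ` A" "p \<in> T" using T(1) unfolding in_closure_of by blast
      then obtain x' where "x' \<in> A" "b x' \<in> U" "b x' \<in> T" by blast
      then show False using inU[of x'] T(2) by force
    qed
  qed
  have conv: "\<exists>l. (q \<longlongrightarrow> l) F" if q: "continuous_map ?X euclideanreal q" for q
  proof -
    have up: "\<exists>n :: nat. eventually (\<lambda>x. q x \<le> real n) F"
    proof (rule ccontr)
      assume "\<not> ?thesis"
      then have "\<And>n :: nat. eventually (\<lambda>x. q x \<ge> real n) F" using dich[OF q] by (metis lessI of_nat_less_iff)
      then have "\<forall>n :: nat. \<exists>O'. openin (topo K) O' \<and> y \<in> O' \<and> (\<forall>x\<in>A. b x \<in> O' \<longrightarrow> q x \<ge> real n)"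
        unfolding evF by blast
      then obtain O' :: "nat \<Rightarrow> 'k set" where O': "\<And>n. openin (topo K) (O' n) \<and> y \<in> O' n \<and> (\<forall>x\<in>A. b x \<in> O' n \<longrightarrow> q x \<ge> real n)"
        by metis
      then obtain x where x: "x \<in> A" "\<forall>n. b x \<in> O' n" using Gd[of O'] by blast
      obtain n where "q x < real n" using reals_Archimedean2 by blast
      then show False using O'[of n] x by fastforce
    qed
    have low: "\<exists>n :: nat. eventually (\<lambda>x. q x \<ge> - real n) F"
    proof (rule ccontr)
      assume "\<not> ?thesis"
      then have "\<And>n :: nat. eventually (\<lambda>x. q x \<le> - real n) F"
        using dich[OF q] by (metis lessI of_nat_less_iff neg_less_iff_less)
      then have "\<forall>n :: nat. \<exists>O'. openin (topo K) O' \<and> y \<in> O' \<and> (\<forall>x\<in>A. b x \<in> O' \<longrightarrow> q x \<le> - real n)"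
        unfolding evF by blast
      then obtain O' :: "nat \<Rightarrow> 'k set" where O': "\<And>n. openin (topo K) (O' n) \<and> y \<in> O' n \<and> (\<forall>x\<in>A. b x \<in> O' n \<longrightarrow> q x \<le> - real n)"
        by metis
      then obtain x where x: "x \<in> A" "\<forall>n. b x \<in> O' n" using Gd[of O'] by blast
      obtain n where "- q x < real n" using reals_Archimedean2 by blast
      then show False using O'[of n] x by fastforce
    qed
    obtain N1 :: nat where N1: "eventually (\<lambda>x. q x \<le> real N1) F" using up by blast
    obtain N2 :: nat where N2: "eventually (\<lambda>x. q x \<ge> - real N2) F" using low by blast
    define S where "S = {a. eventually (\<lambda>x. q x \<ge> a) F}"
    have Sub: "a \<le> real N1" if "a \<in> S" for a
    proof -
      have "eventually (\<lambda>x. q x \<ge> a) F" using that by (simp add: S_def)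
      with N1 have "eventually (\<lambda>x. a \<le> real N1) F" by eventually_elim linarith
      then show ?thesis using nt by (simp add: eventually_const)
    qed
    have Sne: "S \<noteq> {}" using N2 by (auto simp: S_def)
    have Sbd: "bdd_above S" using Sub by (rule bdd_aboveI)
    have lo: "eventually (\<lambda>x. q x > Sup S - \<epsilon>) F" if \<epsilon>: "\<epsilon> > 0" for \<epsilon>
    proof -
      obtain a where a: "a \<in> S" "Sup S - \<epsilon> < a" using less_cSup_iff[OF Sne Sbd, of "Sup S - \<epsilon>"] \<epsilon> by auto
      have "eventually (\<lambda>x. q x \<ge> a) F" using a(1) by (simp add: S_def)
      then show ?thesis by eventually_elim (use a(2) in linarith)
    qed
    have hi: "eventually (\<lambda>x. q x < Sup S + \<epsilon>) F" if \<epsilon>: "\<epsilon> > 0" for \<epsilon>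
    proof -
      have "\<not> eventually (\<lambda>x. q x \<ge> Sup S + \<epsilon> / 3) F"
      proof
        assume "eventually (\<lambda>x. q x \<ge> Sup S + \<epsilon> / 3) F"
        then have "Sup S + \<epsilon> / 3 \<le> Sup S" by (intro cSup_upper Sbd) (simp add: S_def)
        then show False using \<epsilon> by simp
      qed
      then have "eventually (\<lambda>x. q x \<le> Sup S + \<epsilon> / 2) F"
        using dich[OF q, of "Sup S + \<epsilon> / 3" "Sup S + \<epsilon> / 2"] \<epsilon> by auto
      then show ?thesis by eventually_elim (use \<epsilon> in linarith)
    qed
    have "(q \<longlongrightarrow> Sup S) F"
      unfolding tendsto_iff dist_real_def
    proof (intro allI impI)
      fix \<epsilon> :: real assume "\<epsilon> > 0"
      from lo[OF this] hi[OF this] show "eventually (\<lambda>x. \<bar>q x - Sup S\<bar> < \<epsilon>) F"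
        by eventually_elim linarith
    qed
    then show ?thesis by blast
  qed
  obtain I S where cS: "closedin (product_topology (\<lambda>_. euclideanreal) (I :: ('a \<Rightarrow> real) set)) S"
    and hS: "?X homeomorphic_space subtopology (product_topology (\<lambda>_. euclideanreal) I) S"
    using real unfolding realcompact_space_def by (elim exE conjE) (rule that)
  let ?P = "product_topology (\<lambda>_. euclideanreal) I"
  obtain h h' where hh: "homeomorphic_maps ?X (subtopology ?P S) h h'"
    using hS unfolding homeomorphic_space_def by (elim exE) (rule that)
  have ch: "continuous_map ?X (subtopology ?P S) h" and ch': "continuous_map (subtopology ?P S) ?X h'"
    and h'h: "\<And>x. x \<in> topspace ?X \<Longrightarrow> h' (h x) = x"
    using hh by (auto simp: homeomorphic_maps_def)
  have tX: "topspace ?X = A" using b by (auto simp: topspace_pullback_topology topspace_topo)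
  have hP: "continuous_map ?X ?P h" using ch by (simp add: continuous_map_in_subtopology)
  have hA: "h x \<in> S \<inter> topspace ?P" if "x \<in> A" for x
    using continuous_map_image_subset_topspace[OF ch] that tX by auto
  have evA: "eventually (\<lambda>x. x \<in> A) F" by (simp add: F_def eventually_inf_principal)
  have "\<forall>i\<in>I. \<exists>l. ((\<lambda>x. h x i) \<longlongrightarrow> l) F"
  proof
    fix i assume "i \<in> I"
    then have "continuous_map ?X euclideanreal (\<lambda>x. h x i)"
      using hP by (simp add: continuous_map_componentwise)
    then show "\<exists>l. ((\<lambda>x. h x i) \<longlongrightarrow> l) F" by (rule conv)
  qed
  then obtain l where l: "\<And>i. i \<in> I \<Longrightarrow> ((\<lambda>x. h x i) \<longlongrightarrow> l i) F" by metis
  define L where "L = restrict l I"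
  have lim: "limitin ?P h L F"
    unfolding limitin_componentwise
  proof (intro conjI ballI)
    show "L \<in> extensional I" by (simp add: L_def)
    show "eventually (\<lambda>x. h x \<in> topspace ?P) F"
      using evA by eventually_elim (use hA in blast)
    show "limitin euclideanreal (\<lambda>x. h x i) (L i) F" if "i \<in> I" for i
      using l that by (simp add: L_def)
  qed
  have "L \<in> S"
    by (rule limitin_closedin[OF lim cS _ nt]) (use evA hA in \<open>auto elim: eventually_mono\<close>)
  then have "limitin (subtopology ?P S) h L F"
    unfolding limitin_subtopology using lim evA hA by (auto elim: eventually_mono)
  then have limX: "limitin ?X (h' \<circ> h) (h' L) F" by (rule continuous_map_limit[OF ch'])
  have "continuous_map ?X (topo K) b"
    using continuous_map_pullback[OF continuous_map_id, of A b "topo K"] by simp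
  then have "limitin (topo K) (b \<circ> (h' \<circ> h)) (b (h' L)) F" using limX by (rule continuous_map_limit)
  then have lim1: "limitin (topo K) b (b (h' L)) F"
  proof (rule limitin_transform_eventually[rotated])
    show "eventually (\<lambda>x. (b \<circ> (h' \<circ> h)) x = b x) F"
      using evA by eventually_elim (use h'h tX in auto)
  qed
  have lim2: "limitin (topo K) b y F"
    unfolding limitin_def using y topspace_topo evF by blast
  have "b (h' L) = y" using limitin_Hausdorff_unique[OF lim1 lim2 nt Hausdorff] .
  moreover have "h' L \<in> A"
    using limitin_topspace[OF limX] unfolding tX .
  ultimately show ?thesis by (metis imageI)
qed

section \<open>The unitary groups\<close>

lemma unitary_group_simps [simp]:
  "carrier (unitary_group n) = unitary_mats n" "mult (unitary_group n) = (*)" "one (unitary_group n) = 1\<^sub>m n"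
  by (simp_all add: unitary_group_def)

lemma unitary_matsD:
  assumes "A \<in> unitary_mats n"
  shows "A \<in> carrier_mat n n" "A * mat_adjoint A = 1\<^sub>m n" "mat_adjoint A * A = 1\<^sub>m n"
  using assms by (auto simp: unitary_mats_def)

lemma mat_adjoint_index: "A \<in> carrier_mat n n \<Longrightarrow> i < n \<Longrightarrow> k < n \<Longrightarrow> mat_adjoint A $$ (i, k) = cnj (A $$ (k, i))"
  by (auto simp: mat_adjoint_def mat_of_rows_def)

lemma mat_adjoint_carrier: "(A :: complex mat) \<in> carrier_mat n n \<Longrightarrow> mat_adjoint A \<in> carrier_mat n n"
  by (auto simp: mat_adjoint_def)

lemma mat_mult_index:
  "A \<in> carrier_mat n n \<Longrightarrow> B \<in> carrier_mat n n \<Longrightarrow> i < n \<Longrightarrow> k < n \<Longrightarrow>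
    (A * B) $$ (i, k) = (\<Sum>j<n. A $$ (i, j) * B $$ (j, k))"
  by (simp add: times_mat_def scalar_prod_def lessThan_atLeast0)

lemma mat_adjoint_mult_square:
  assumes A: "(A :: complex mat) \<in> carrier_mat n n" and B: "B \<in> carrier_mat n n"
  shows "mat_adjoint (A * B) = mat_adjoint B * mat_adjoint A"
proof (rule eq_matI)
  note AB = mult_carrier_mat[OF A B]
  note c = mat_adjoint_carrier[OF A] mat_adjoint_carrier[OF B] mat_adjoint_carrier[OF AB]
  fix i k assume "i < dim_row (mat_adjoint B * mat_adjoint A)" "k < dim_col (mat_adjoint B * mat_adjoint A)"
  then have ik: "i < n" "k < n" using c by auto
  show "mat_adjoint (A * B) $$ (i, k) = (mat_adjoint B * mat_adjoint A) $$ (i, k)"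
    using ik by (simp add: mat_adjoint_index[OF AB] mat_mult_index[OF A B] mat_mult_index[OF c(2,1)]
        mat_adjoint_index[OF A] mat_adjoint_index[OF B] mult.commute)
qed (use mat_adjoint_carrier[OF A] mat_adjoint_carrier[OF B] mat_adjoint_carrier[OF mult_carrier_mat[OF A B]] in auto)

lemma mat_adjoint_adjoint:
  assumes A: "(A :: complex mat) \<in> carrier_mat n n" shows "mat_adjoint (mat_adjoint A) = A"
proof -
  note c = mat_adjoint_carrier[OF A]
  show ?thesis
    using A c mat_adjoint_carrier[OF c]
    by (intro eq_matI) (auto simp: mat_adjoint_index[OF c] mat_adjoint_index[OF A])
qed

lemma unitary_mult:
  assumes A: "A \<in> unitary_mats n" and B: "B \<in> unitary_mats n" shows "A * B \<in> unitary_mats n"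
proof -
  note a = unitary_matsD[OF A] and b = unitary_matsD[OF B]
  note c = mat_adjoint_carrier[OF a(1)] mat_adjoint_carrier[OF b(1)]
  have "B * (mat_adjoint B * mat_adjoint A) = mat_adjoint A"
    using assoc_mult_mat[OF b(1) c(2) c(1), symmetric] b(2) c(1) by simp
  then have 1: "(A * B) * (mat_adjoint B * mat_adjoint A) = 1\<^sub>m n"
    using assoc_mult_mat[OF a(1) b(1) mult_carrier_mat[OF c(2) c(1)]] a(2) by simp
  have "mat_adjoint A * (A * B) = B"
    using assoc_mult_mat[OF c(1) a(1) b(1), symmetric] a(3) b(1) by simp
  then have 2: "(mat_adjoint B * mat_adjoint A) * (A * B) = 1\<^sub>m n"
    using assoc_mult_mat[OF c(2) c(1) mult_carrier_mat[OF a(1) b(1)]] b(3) by simp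
  show ?thesis
    using 1 2 mult_carrier_mat[OF a(1) b(1)] by (simp add: unitary_mats_def mat_adjoint_mult_square[OF a(1) b(1)])
qed

lemma mat_adjoint_one: "mat_adjoint (1\<^sub>m n :: complex mat) = 1\<^sub>m n"
  using mat_adjoint_carrier[OF one_carrier_mat[of n]]
  by (intro eq_matI) (auto simp: mat_adjoint_index[of _ n])

lemma unitary_adjoint: "A \<in> unitary_mats n \<Longrightarrow> mat_adjoint A \<in> unitary_mats n"
  by (auto simp: unitary_mats_def mat_adjoint_adjoint mat_adjoint_carrier)

lemma group_unitary: "group (unitary_group n)"
proof (rule groupI)
  fix A assume "A \<in> carrier (unitary_group n)"
  then have A: "A \<in> unitary_mats n" by simp
  then show "\<exists>B\<in>carrier (unitary_group n). B \<otimes>\<^bsub>unitary_group n\<^esub> A = \<one>\<^bsub>unitary_group n\<^esub>"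
    using unitary_adjoint[OF A] unitary_matsD(3)[OF A] by auto
  show "\<one>\<^bsub>unitary_group n\<^esub> \<otimes>\<^bsub>unitary_group n\<^esub> A = A" using unitary_matsD(1)[OF A] by simp
  fix B assume "B \<in> carrier (unitary_group n)"
  then have B: "B \<in> unitary_mats n" by simp
  show "A \<otimes>\<^bsub>unitary_group n\<^esub> B \<in> carrier (unitary_group n)" using unitary_mult[OF A B] by simp
  fix C assume "C \<in> carrier (unitary_group n)"
  then show "A \<otimes>\<^bsub>unitary_group n\<^esub> B \<otimes>\<^bsub>unitary_group n\<^esub> C
     = A \<otimes>\<^bsub>unitary_group n\<^esub> (B \<otimes>\<^bsub>unitary_group n\<^esub> C)"
    using A B by (simp add: assoc_mult_mat[OF unitary_matsD(1) unitary_matsD(1) unitary_matsD(1)])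
next
  show "\<one>\<^bsub>unitary_group n\<^esub> \<in> carrier (unitary_group n)"
    by (simp add: unitary_mats_def mat_adjoint_one)
qed

lemma inv_unitary: "A \<in> unitary_mats n \<Longrightarrow> inv\<^bsub>unitary_group n\<^esub> A = mat_adjoint A"
  by (rule group.inv_equality[OF group_unitary]) (auto simp: unitary_matsD unitary_adjoint)

lemma topspace_unitary: "topspace (topo (unitary_group n)) = unitary_mats n"
  by (auto simp: unitary_group_def topspace_pullback_topology)

lemma unitary_entry_continuous:
  "i < n \<Longrightarrow> k < n \<Longrightarrow> continuous_map (topo (unitary_group n)) euclidean (\<lambda>A. A $$ (i, k))"
  using cont_map_unitary_iff[of "topo (unitary_group n)" n "\<lambda>A. A"] continuous_map_id[of "topo (unitary_group n)"]
  by (simp add: id_def)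

lemma unitary_entry_le:
  assumes A: "A \<in> unitary_mats n" and ik: "i < n" "k < n" shows "cmod (A $$ (i, k)) \<le> 1"
proof -
  note a = unitary_matsD[OF A]
  have "1 = (A * mat_adjoint A) $$ (i, i)" using a(2) ik by simp
  also have "\<dots> = (\<Sum>j<n. A $$ (i, j) * cnj (A $$ (i, j)))"
    using a(1) ik mat_adjoint_carrier[OF a(1)]
    by (simp add: times_mat_def scalar_prod_def mat_adjoint_index[OF a(1)] lessThan_atLeast0)
  also have "\<dots> = complex_of_real (\<Sum>j<n. (cmod (A $$ (i, j)))\<^sup>2)"
    unfolding of_real_sum complex_norm_square ..
  finally have "(\<Sum>j<n. (cmod (A $$ (i, j)))\<^sup>2) = 1" by (metis of_real_eq_1_iff)
  moreover have "(cmod (A $$ (i, k)))\<^sup>2 \<le> (\<Sum>j<n. (cmod (A $$ (i, j)))\<^sup>2)"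
    using ik by (intro member_le_sum) auto
  ultimately show ?thesis by (simp add: power_le_one_iff abs_square_le_1)
qed

lemma continuous_map_complex_sum:
  fixes f :: "'i \<Rightarrow> 'a \<Rightarrow> complex"
  assumes "\<And>i. i \<in> I \<Longrightarrow> continuous_map X euclidean (f i)"
  shows "continuous_map X euclidean (\<lambda>x. \<Sum>i\<in>I. f i x)"
  using assms unfolding continuous_map_atin limitin_canonical_iff by (auto intro: tendsto_sum)

lemma continuous_map_complex_mult:
  fixes f g :: "'a \<Rightarrow> complex"
  assumes "continuous_map X euclidean f" "continuous_map X euclidean g"
  shows "continuous_map X euclidean (\<lambda>x. f x * g x)"
  using assms unfolding continuous_map_atin limitin_canonical_iff by (auto intro: tendsto_mult)

text \<open>By the entries, the unitary matrices correspond to the subset of a power of the unit disc that is cut out by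
the equations of unitarity.\<close>

lemma compact_group_unitary: "compact_group (unitary_group n)"
proof -
  interpret group "unitary_group n" by (rule group_unitary)
  let ?U = "unitary_group n"
  let ?T = "topo ?U"
  let ?I = "{..<n} \<times> {..<n}"
  let ?e = "\<lambda>A :: complex mat. \<lambda>p\<in>?I. A $$ p"
  let ?P = "product_topology (\<lambda>_. euclidean) ?I :: (nat \<times> nat \<Rightarrow> complex) topology"
  have top: "?T = pullback_topology (unitary_mats n) ?e ?P" by (simp add: unitary_group_def)
  have ce: "continuous_map ?T ?P ?e"
    using continuous_map_pullback[OF continuous_map_id, of "unitary_mats n" ?e ?P] by (simp add: top)
  have inj: "inj_on ?e (unitary_mats n)"
  proof (rule inj_onI)
    fix A B assume AB: "A \<in> unitary_mats n" "B \<in> unitary_mats n" and eq: "?e A = ?e B"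
    have "A $$ (i, k) = B $$ (i, k)" if "i < n" "k < n" for i k
      using fun_cong[OF eq, of "(i, k)"] that by simp
    then show "A = B" using unitary_matsD(1)[OF AB(1)] unitary_matsD(1)[OF AB(2)] by (intro eq_matI) auto
  qed
  have "topological_group ?U"
  proof
    show "topspace ?T = carrier ?U" by (simp add: topspace_unitary)
    show "Hausdorff_space ?T"
      by (rule Hausdorff_space_injective_preimage[OF _ ce])
        (use inj in \<open>auto simp: topspace_unitary Hausdorff_space_product_topology\<close>)
    show "continuous_map (prod_topology ?T ?T) ?T (\<lambda>(A, B). A \<otimes>\<^bsub>?U\<^esub> B)"
      unfolding cont_map_unitary_iff
    proof (intro conjI ballI)
      show "(\<lambda>(A, B). A \<otimes>\<^bsub>?U\<^esub> B) ` topspace (prod_topology ?T ?T) \<subseteq> unitary_mats n"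
        by (auto simp: topspace_unitary unitary_mult)
      fix p assume "p \<in> ?I"
      then obtain i k where p: "p = (i, k)" "i < n" "k < n" by auto
      have "continuous_map (prod_topology ?T ?T) euclidean (\<lambda>q. \<Sum>j<n. fst q $$ (i, j) * snd q $$ (j, k))"
      proof (intro continuous_map_complex_sum continuous_map_complex_mult)
        fix j assume "j \<in> {..<n}"
        then show "continuous_map (prod_topology ?T ?T) euclidean (\<lambda>q. fst q $$ (i, j))"
          "continuous_map (prod_topology ?T ?T) euclidean (\<lambda>q. snd q $$ (j, k))"
          using p continuous_map_compose[OF continuous_map_fst unitary_entry_continuous, of i n j ?T]
            continuous_map_compose[OF continuous_map_snd unitary_entry_continuous, of j n k ?T]
          by (auto simp: o_def)
      qed
      then show "continuous_map (prod_topology ?T ?T) euclidean (\<lambda>x. (case x of (A, B) \<Rightarrow> A \<otimes>\<^bsub>?U\<^esub> B) $$ p)"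
      proof (rule continuous_map_eq)
        fix q assume "q \<in> topspace (prod_topology ?T ?T)"
        then obtain A B where q: "q = (A, B)" "A \<in> unitary_mats n" "B \<in> unitary_mats n"
          by (auto simp: topspace_unitary)
        then show "(\<Sum>j<n. fst q $$ (i, j) * snd q $$ (j, k)) = (case q of (A, B) \<Rightarrow> A \<otimes>\<^bsub>?U\<^esub> B) $$ p"
          using p unitary_matsD(1)[OF q(2)] unitary_matsD(1)[OF q(3)]
          by (simp add: times_mat_def scalar_prod_def lessThan_atLeast0)
      qed
    qed
    show "continuous_map ?T ?T (\<lambda>A. inv\<^bsub>?U\<^esub> A)"
      unfolding cont_map_unitary_iff
    proof (intro conjI ballI)
      show "(\<lambda>A. inv\<^bsub>?U\<^esub> A) ` topspace ?T \<subseteq> unitary_mats n"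
        by (auto simp: topspace_unitary inv_unitary unitary_adjoint)
      fix p assume "p \<in> ?I"
      then obtain i k where p: "p = (i, k)" "i < n" "k < n" by auto
      have "continuous_map ?T euclidean (cnj \<circ> (\<lambda>A. A $$ (k, i)))"
        by (rule continuous_map_compose[OF unitary_entry_continuous[OF p(3,2)]]) (simp add: continuous_on_cnj)
      then show "continuous_map ?T euclidean (\<lambda>A. (inv\<^bsub>?U\<^esub> A) $$ p)"
        by (rule continuous_map_eq)
          (use p in \<open>auto simp: topspace_unitary inv_unitary mat_adjoint_index[OF unitary_matsD(1)]\<close>)
    qed
  qed
  moreover have "compact_space ?T"
  proof -
    let ?C = "\<Pi>\<^sub>E p\<in>?I. cball (0 :: complex) 1"
    have cC: "compactin ?P ?C" by (simp add: compactin_PiE)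
    define M where "M v = mat n n v" for v :: "nat \<times> nat \<Rightarrow> complex"
    define Z where "Z = {v \<in> topspace ?P. \<forall>i<n. \<forall>k<n.
        (\<Sum>j<n. v (i, j) * cnj (v (k, j))) = (if i = k then 1 else 0) \<and>
        (\<Sum>j<n. cnj (v (j, i)) * v (j, k)) = (if i = k then 1 else 0)}"
    have im: "?e ` unitary_mats n = ?C \<inter> Z"
    proof
      show "?e ` unitary_mats n \<subseteq> ?C \<inter> Z"
      proof
        fix v assume "v \<in> ?e ` unitary_mats n"
        then obtain A where A: "A \<in> unitary_mats n" "v = ?e A" by blast
        note a = unitary_matsD[OF A(1)]
        have "(\<Sum>j<n. A $$ (i, j) * cnj (A $$ (k, j))) = (if i = k then 1 else 0)"
          "(\<Sum>j<n. cnj (A $$ (j, i)) * A $$ (j, k)) = (if i = k then 1 else 0)" if ik: "i < n" "k < n" for i k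
        proof -
          have "(A * mat_adjoint A) $$ (i, k) = (\<Sum>j<n. A $$ (i, j) * cnj (A $$ (k, j)))"
            "(mat_adjoint A * A) $$ (i, k) = (\<Sum>j<n. cnj (A $$ (j, i)) * A $$ (j, k))"
            using a(1) ik mat_adjoint_carrier[OF a(1)]
            by (simp_all add: times_mat_def scalar_prod_def mat_adjoint_index[OF a(1)] lessThan_atLeast0)
          then show "(\<Sum>j<n. A $$ (i, j) * cnj (A $$ (k, j))) = (if i = k then 1 else 0)"
            "(\<Sum>j<n. cnj (A $$ (j, i)) * A $$ (j, k)) = (if i = k then 1 else 0)"
            using a ik by simp_all
        qed
        then have "v \<in> Z" by (auto simp: Z_def A(2))
        moreover have "v \<in> ?C" using unitary_entry_le[OF A(1)] by (auto simp: A(2))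
        ultimately show "v \<in> ?C \<inter> Z" by blast
      qed
      show "?C \<inter> Z \<subseteq> ?e ` unitary_mats n"
      proof
        fix v assume v: "v \<in> ?C \<inter> Z"
        have m: "M v \<in> carrier_mat n n" by (simp add: M_def)
        have "M v * mat_adjoint (M v) = 1\<^sub>m n"
        proof (rule eq_matI)
          fix i k assume "i < dim_row (1\<^sub>m n)" "k < dim_col (1\<^sub>m n)"
          then have ik: "i < n" "k < n" by auto
          then show "(M v * mat_adjoint (M v)) $$ (i, k) = 1\<^sub>m n $$ (i, k)"
            using v m mat_adjoint_carrier[OF m]
            by (simp add: times_mat_def scalar_prod_def mat_adjoint_index[OF m] lessThan_atLeast0 Z_def)
              (simp add: M_def lessThan_atLeast0)
        qed (use m mat_adjoint_carrier[OF m] in auto)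
        moreover have "mat_adjoint (M v) * M v = 1\<^sub>m n"
        proof (rule eq_matI)
          fix i k assume "i < dim_row (1\<^sub>m n)" "k < dim_col (1\<^sub>m n)"
          then have ik: "i < n" "k < n" by auto
          then show "(mat_adjoint (M v) * M v) $$ (i, k) = 1\<^sub>m n $$ (i, k)"
            using v m mat_adjoint_carrier[OF m]
            by (simp add: times_mat_def scalar_prod_def mat_adjoint_index[OF m] lessThan_atLeast0 Z_def)
              (simp add: M_def lessThan_atLeast0)
        qed (use m mat_adjoint_carrier[OF m] in auto)
        ultimately have "M v \<in> unitary_mats n" using m by (simp add: unitary_mats_def)
        moreover have "?e (M v) = v"
        proof
          fix p show "?e (M v) p = v p"
          proof (cases "p \<in> ?I")
            case False
            have "v \<in> ?C" using v by blast
            then have "v p = undefined" using False by (rule PiE_arb)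
            then show ?thesis by (simp only: restrict_def False if_False)
          qed (auto simp: M_def)
        qed
        ultimately show "v \<in> ?e ` unitary_mats n" by (metis imageI)
      qed
    qed
    have proj: "continuous_map ?P euclidean (\<lambda>v. v p)" if "p \<in> ?I" for p
      using continuous_map_product_projection[OF that, of "\<lambda>_. euclidean"] by simp
    have cproj: "continuous_map ?P euclidean (\<lambda>v. cnj (v p))" if "p \<in> ?I" for p
      using continuous_map_compose[OF proj[OF that], of euclidean cnj] by (simp add: o_def continuous_on_cnj)
    have cl: "closedin ?P {v \<in> topspace ?P. g v \<in> {c}}" if "continuous_map ?P euclidean g" for g and c :: complex
      using that by (rule closedin_continuous_map_preimage) simp
    define Z1 where "Z1 p = {v \<in> topspace ?P.
        (\<Sum>j<n. v (fst p, j) * cnj (v (snd p, j))) \<in> {if fst p = snd p then 1 else 0}}" for p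
    define Z2 where "Z2 p = {v \<in> topspace ?P.
        (\<Sum>j<n. cnj (v (j, fst p)) * v (j, snd p)) \<in> {if fst p = snd p then 1 else 0}}" for p
    have cl12: "closedin ?P (Z1 p \<inter> Z2 p)" if p: "p \<in> ?I" for p
    proof -
      have ik: "(fst p, j) \<in> ?I" "(snd p, j) \<in> ?I" "(j, fst p) \<in> ?I" "(j, snd p) \<in> ?I" if "j \<in> {..<n}" for j
        using p that by auto
      show ?thesis unfolding Z1_def Z2_def
        by (intro closedin_Int cl continuous_map_complex_sum continuous_map_complex_mult proj cproj ik)
    qed
    have Zeq: "Z = topspace ?P \<inter> \<Inter>((\<lambda>p. Z1 p \<inter> Z2 p) ` ?I)"
    proof (rule subset_antisym; rule subsetI)
      fix v assume "v \<in> Z"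
      then show "v \<in> topspace ?P \<inter> \<Inter>((\<lambda>p. Z1 p \<inter> Z2 p) ` ?I)"
        unfolding Z_def Z1_def Z2_def by (simp only: mem_Collect_eq Int_iff INT_iff singleton_iff) auto
    next
      fix v assume v: "v \<in> topspace ?P \<inter> \<Inter>((\<lambda>p. Z1 p \<inter> Z2 p) ` ?I)"
      have "v \<in> Z1 (i, k)" "v \<in> Z2 (i, k)" if "i < n" "k < n" for i k using v that by blast+
      then show "v \<in> Z" using v unfolding Z_def Z1_def Z2_def by simp
    qed
    have "closedin ?P Z"
    proof (cases "?I = {}")
      case True
      then show ?thesis unfolding Zeq by (metis Inf_empty Int_UNIV_right closedin_topspace image_empty)
    next
      case False
      then show ?thesis unfolding Zeq by (intro closedin_Int closedin_topspace closedin_INT cl12)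
    qed
    then have cim: "compactin ?P (?e ` unitary_mats n)"
      unfolding im by (rule compact_Int_closedin[OF cC])
    have "continuous_map (subtopology ?P (?e ` unitary_mats n)) ?T M"
      unfolding cont_map_unitary_iff
    proof (intro conjI ballI)
      have Me: "M (?e A) = A" if "A \<in> unitary_mats n" for A
        using unitary_matsD(1)[OF that] by (intro eq_matI) (auto simp: M_def)
      show "M ` topspace (subtopology ?P (?e ` unitary_mats n)) \<subseteq> unitary_mats n"
        using Me by auto
      fix p assume p: "p \<in> ?I"
      have "continuous_map (subtopology ?P (?e ` unitary_mats n)) euclidean (\<lambda>v. v p)"
        using proj[OF p] by (rule continuous_map_from_subtopology)
      then show "continuous_map (subtopology ?P (?e ` unitary_mats n)) euclidean (\<lambda>v. M v $$ p)"
        using p by (auto simp: M_def)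
    qed
    from image_compactin[OF _ this, of "?e ` unitary_mats n"] cim
    have "compactin ?T (M ` ?e ` unitary_mats n)" by (simp add: compactin_subtopology)
    moreover have "M ` ?e ` unitary_mats n = topspace ?T"
    proof -
      have "M (?e A) = A" if "A \<in> unitary_mats n" for A
        using unitary_matsD(1)[OF that] by (intro eq_matI) (auto simp: M_def)
      then show ?thesis by (simp add: topspace_unitary image_image)
    qed
    ultimately show ?thesis by (simp add: compact_space_def)
  qed
  ultimately show ?thesis by (simp add: compact_group_def)
qed

section \<open>Almost periodic functions from compact groups\<close>

text \<open>The two-sided uniform continuity of \<open>F\<close>: by the tube lemma for the compact factor of all
\<open>(z, w)\<close>, each point \<open>x\<close> has a neighbourhood on which \<open>F (z v w)\<close>
is close to \<open>F (z x w)\<close> for all \<open>z\<close> and \<open>w\<close> at once. Finitely many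
of these neighbourhoods give the decomposition.\<close>

lemma AP_from_compact:
  assumes G: "topological_group G" and K: "compact_group K" and b: "b \<in> cont_hom G K"
    and F: "continuous_map (topo K) euclidean (F :: 'k \<Rightarrow> complex)"
  shows "(\<lambda>x\<in>carrier G. F (b x)) \<in> AP G"
proof -
  interpret G: topological_group G by fact
  interpret K: topological_group K using K by (simp add: compact_group_def)
  have cK: "compact_space (topo K)" using K by (simp add: compact_group_def)
  have bh: "b \<in> hom G K" and bc: "continuous_map (topo G) (topo K) b" using b by (auto simp: cont_hom_def)
  have bG: "b x \<in> carrier K" if "x \<in> carrier G" for x using bh that by (auto simp: hom_def)
  have bm: "b (z \<otimes>\<^bsub>G\<^esub> x \<otimes>\<^bsub>G\<^esub> w) = b z \<otimes>\<^bsub>K\<^esub> b x \<otimes>\<^bsub>K\<^esub> b w"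
    if "x \<in> carrier G" "z \<in> carrier G" "w \<in> carrier G" for x z w using bh that by (simp add: hom_mult)
  have "continuous_map (topo G) euclidean (\<lambda>x. F (b x))"
    using continuous_map_compose[OF bc F] by (simp add: o_def)
  then have c: "continuous_map (topo G) euclidean (\<lambda>x\<in>carrier G. F (b x))"
    by (rule G.continuous_map_restrict_carrier)
  have "\<exists>\<P>. finite \<P> \<and> \<Union>\<P> = carrier G \<and>
        (\<forall>P\<in>\<P>. \<forall>x\<in>P. \<forall>y\<in>P. \<forall>z\<in>carrier G. \<forall>w\<in>carrier G.
           cmod ((\<lambda>x\<in>carrier G. F (b x)) (z \<otimes>\<^bsub>G\<^esub> x \<otimes>\<^bsub>G\<^esub> w)
             - (\<lambda>x\<in>carrier G. F (b x)) (z \<otimes>\<^bsub>G\<^esub> y \<otimes>\<^bsub>G\<^esub> w)) < e)" if e: "e > 0" for e :: real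
  proof -
    let ?Y = "prod_topology (topo K) (topo K)"
    have cY: "compactin ?Y (carrier K \<times> carrier K)"
      using cK K.topspace_topo by (simp add: compactin_Times compact_space_def)
    have nb: "\<exists>V. openin (topo K) V \<and> x \<in> V \<and> (\<forall>v\<in>V. \<forall>z\<in>carrier K. \<forall>w\<in>carrier K.
        cmod (F (z \<otimes>\<^bsub>K\<^esub> v \<otimes>\<^bsub>K\<^esub> w) - F (z \<otimes>\<^bsub>K\<^esub> x \<otimes>\<^bsub>K\<^esub> w)) < e / 2)" if x: "x \<in> carrier K" for x
    proof -
      let ?X = "prod_topology ?Y (topo K)"
      have p1: "continuous_map ?X (topo K) (\<lambda>q. fst (fst q))" "continuous_map ?X (topo K) (\<lambda>q. snd (fst q))"
        "continuous_map ?X (topo K) (\<lambda>q. snd q)"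
        using continuous_map_compose[OF continuous_map_fst continuous_map_fst, of "topo K" "topo K" "topo K"]
          continuous_map_compose[OF continuous_map_fst continuous_map_snd, of "topo K" "topo K" "topo K"]
          continuous_map_snd[of ?Y "topo K"] by (simp_all add: o_def)
      have cx: "continuous_map ?X (topo K) (\<lambda>q. x)" using x K.topspace_topo by simp
      have F1: "continuous_map ?X euclidean (\<lambda>q. F (fst (fst q) \<otimes>\<^bsub>K\<^esub> snd q \<otimes>\<^bsub>K\<^esub> snd (fst q)))"
        using continuous_map_compose[OF K.continuous_map_mult[OF K.continuous_map_mult[OF p1(1) p1(3)] p1(2)] F]
        by (simp add: o_def)
      have F2: "continuous_map ?X euclidean (\<lambda>q. F (fst (fst q) \<otimes>\<^bsub>K\<^esub> x \<otimes>\<^bsub>K\<^esub> snd (fst q)))"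
        using continuous_map_compose[OF K.continuous_map_mult[OF K.continuous_map_mult[OF p1(1) cx] p1(2)] F]
        by (simp add: o_def)
      define D where "D q = cmod (F (fst (fst q) \<otimes>\<^bsub>K\<^esub> snd q \<otimes>\<^bsub>K\<^esub> snd (fst q)) - F (fst (fst q) \<otimes>\<^bsub>K\<^esub> x \<otimes>\<^bsub>K\<^esub> snd (fst q)))" for q
      have "continuous_map ?X euclidean D"
        using F1 F2 unfolding continuous_map_atin limitin_canonical_iff D_def by (auto intro!: tendsto_intros)
      then have "openin ?X {q \<in> topspace ?X. D q \<in> {..<e/2}}" by (rule openin_continuous_map_preimage) simp
      then have "\<exists>U V. openin ?Y U \<and> openin (topo K) V \<and> carrier K \<times> carrier K \<subseteq> U \<and> x \<in> V \<and>
          U \<times> V \<subseteq> {q \<in> topspace ?X. D q \<in> {..<e/2}}"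
      proof (rule tube_lemma_left[OF _ cY])
        show "x \<in> topspace (topo K)" using x K.topspace_topo by simp
        show "(carrier K \<times> carrier K) \<times> {x} \<subseteq> {q \<in> topspace ?X. D q \<in> {..<e/2}}"
          using x e K.topspace_topo by (auto simp: D_def)
      qed
      then obtain U V where UV: "openin ?Y U" "openin (topo K) V" "carrier K \<times> carrier K \<subseteq> U" "x \<in> V"
        "U \<times> V \<subseteq> {q \<in> topspace ?X. D q \<in> {..<e/2}}"
        by (elim exE conjE) (rule that)
      have "cmod (F (z \<otimes>\<^bsub>K\<^esub> v \<otimes>\<^bsub>K\<^esub> w) - F (z \<otimes>\<^bsub>K\<^esub> x \<otimes>\<^bsub>K\<^esub> w)) < e / 2"
        if "v \<in> V" "z \<in> carrier K" "w \<in> carrier K" for v z w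
      proof -
        have "((z, w), v) \<in> U \<times> V" using that UV(3) by auto
        then have "D ((z, w), v) < e / 2" using UV(5) by auto
        then show ?thesis by (simp add: D_def)
      qed
      then show ?thesis using UV(2,4) by blast
    qed
    define N where "N x V \<longleftrightarrow> openin (topo K) V \<and> x \<in> V \<and> (\<forall>v\<in>V. \<forall>z\<in>carrier K. \<forall>w\<in>carrier K.
        cmod (F (z \<otimes>\<^bsub>K\<^esub> v \<otimes>\<^bsub>K\<^esub> w) - F (z \<otimes>\<^bsub>K\<^esub> x \<otimes>\<^bsub>K\<^esub> w)) < e / 2)" for x V
    have "\<forall>x\<in>carrier K. \<exists>V. N x V" unfolding N_def using nb by (intro ballI)
    then obtain V where N: "\<forall>x\<in>carrier K. N x (V x)" by metis
    have V: "cmod (F (z \<otimes>\<^bsub>K\<^esub> v \<otimes>\<^bsub>K\<^esub> w) - F (z \<otimes>\<^bsub>K\<^esub> x \<otimes>\<^bsub>K\<^esub> w)) < e / 2"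
      if "x \<in> carrier K" "v \<in> V x" "z \<in> carrier K" "w \<in> carrier K" for x v z w
      using N that by (simp add: N_def)
    have "\<And>W. W \<in> V ` carrier K \<Longrightarrow> openin (topo K) W" "carrier K \<subseteq> \<Union>(V ` carrier K)"
      using N by (auto simp: N_def)
    then have "\<exists>\<F>. finite \<F> \<and> \<F> \<subseteq> V ` carrier K \<and> carrier K \<subseteq> \<Union>\<F>"
      using cK unfolding compact_space_def compactin_def K.topspace_topo by meson
    then obtain S where S: "finite S" "S \<subseteq> carrier K" "carrier K \<subseteq> \<Union>(V ` S)"
      by (metis finite_subset_image)
    define Q where "Q s = {x \<in> carrier G. b x \<in> V s}" for s
    show ?thesis
    proof (intro exI[of _ "Q ` S"] conjI ballI)
      show "finite (Q ` S)" using S by simp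
      show "\<Union>(Q ` S) = carrier G" using S(3) bG by (auto simp: Q_def)
      fix P x y z w assume P: "P \<in> Q ` S" "x \<in> P" "y \<in> P" and zw: "z \<in> carrier G" "w \<in> carrier G"
      obtain s where s: "s \<in> S" "P = Q s" using P(1) by blast
      have sK: "s \<in> carrier K" using s S(2) by blast
      have xy: "x \<in> carrier G" "y \<in> carrier G" "b x \<in> V s" "b y \<in> V s" using P s by (auto simp: Q_def)
      have "cmod (F (b z \<otimes>\<^bsub>K\<^esub> b x \<otimes>\<^bsub>K\<^esub> b w) - F (b z \<otimes>\<^bsub>K\<^esub> s \<otimes>\<^bsub>K\<^esub> b w)) < e / 2"
        "cmod (F (b z \<otimes>\<^bsub>K\<^esub> b y \<otimes>\<^bsub>K\<^esub> b w) - F (b z \<otimes>\<^bsub>K\<^esub> s \<otimes>\<^bsub>K\<^esub> b w)) < e / 2"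
        by (intro V[OF sK] xy bG zw)+
      then have "cmod (F (b z \<otimes>\<^bsub>K\<^esub> b x \<otimes>\<^bsub>K\<^esub> b w) - F (b z \<otimes>\<^bsub>K\<^esub> b y \<otimes>\<^bsub>K\<^esub> b w)) < e"
        using norm_triangle_ineq4[of "F (b z \<otimes>\<^bsub>K\<^esub> b x \<otimes>\<^bsub>K\<^esub> b w) - F (b z \<otimes>\<^bsub>K\<^esub> s \<otimes>\<^bsub>K\<^esub> b w)"
          "F (b z \<otimes>\<^bsub>K\<^esub> b y \<otimes>\<^bsub>K\<^esub> b w) - F (b z \<otimes>\<^bsub>K\<^esub> s \<otimes>\<^bsub>K\<^esub> b w)"] by simp
      then show "cmod ((\<lambda>x\<in>carrier G. F (b x)) (z \<otimes>\<^bsub>G\<^esub> x \<otimes>\<^bsub>G\<^esub> w)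
             - (\<lambda>x\<in>carrier G. F (b x)) (z \<otimes>\<^bsub>G\<^esub> y \<otimes>\<^bsub>G\<^esub> w)) < e"
        using xy zw by (simp add: bm)
    qed
  qed
  then show ?thesis using c by (simp add: AP_def)
qed

text \<open>Urysohn's lemma, in the complex form in which the function can be composed into \<open>AP\<close>.\<close>

lemma (in compact_topgroup) vanishing_function:
  assumes O': "openin (topo K) O'" and p: "p \<in> O'"
  obtains F :: "'k \<Rightarrow> complex" where "continuous_map (topo K) euclidean F" "F p = 0"
    "\<And>q. q \<in> carrier K \<Longrightarrow> q \<notin> O' \<Longrightarrow> F q = 1"
proof -
  have pK: "p \<in> topspace (topo K)" using openin_subset[OF O'] p by blast
  have "normal_space (topo K)"
    using compact Hausdorff by (intro compact_Hausdorff_or_regular_imp_normal_space) auto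
  moreover have "closedin (topo K) {p}" using Hausdorff pK by (simp add: closedin_Hausdorff_singleton)
  moreover have "closedin (topo K) (topspace (topo K) - O')" using O' by blast
  moreover have "disjnt {p} (topspace (topo K) - O')" using p by (simp add: disjnt_def)
  ultimately obtain f where f: "continuous_map (topo K) euclideanreal f" "f ` {p} \<subseteq> {0}"
    "f ` (topspace (topo K) - O') \<subseteq> {1}"
    by (rule Urysohn_lemma_alt)
  show ?thesis
  proof (rule that)
    show "continuous_map (topo K) euclidean (\<lambda>q. complex_of_real (f q))"
      using continuous_map_compose[OF f(1), of euclidean complex_of_real] by (simp add: o_def continuous_on_of_real)
    show "complex_of_real (f p) = 0" using f(2) by simp
    show "complex_of_real (f q) = 1" if "q \<in> carrier K" "q \<notin> O'" for q
      using f(3) that topspace_topo by auto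
  qed
qed

lemma (in compact_topgroup) Lindelof: "Lindelof_space (topo K)"
  using compact by (rule compact_imp_Lindelof_space)

lemma (in topological_group) evaluation_range_functional:
  "x \<in> carrier G \<Longrightarrow> range_functional G (\<lambda>f. f x)"
  by unfold_locales auto

lemma (in range_functional) simultaneous_countable:
  assumes "countable \<A>" "\<A> \<subseteq> AP G"
  shows "\<exists>x\<in>carrier G. \<forall>f\<in>\<A>. \<phi> f = f x"
proof (cases "\<A> = {}")
  case True
  then show ?thesis using one_closed by blast
next
  case False
  then have r: "range (from_nat_into \<A>) = \<A>" using assms(1) by (rule range_from_nat_into)
  have "from_nat_into \<A> n \<in> AP G" for n using assms(2) False from_nat_into[of \<A>] by blast
  then obtain x where x: "x \<in> carrier G" "\<forall>n. \<phi> (from_nat_into \<A> n) = from_nat_into \<A> n x"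
    using simultaneous[of "from_nat_into \<A>"] by blast
  have "\<phi> f = f x" if "f \<in> \<A>" for f
  proof -
    have "f \<in> range (from_nat_into \<A>)" unfolding r by (rule that)
    then obtain n where "f = from_nat_into \<A> n" by (rule rangeE)
    then show ?thesis using x(2) by simp
  qed
  then show ?thesis using x(1) by blast
qed

lemma Rep_coefficient_AP:
  assumes G: "topological_group G" and D: "D \<in> Rep n G" and ik: "i < n" "k < n"
  shows "(\<lambda>x\<in>carrier G. D x $$ (i, k)) \<in> AP G"
  by (rule AP_from_compact[OF G compact_group_unitary _ unitary_entry_continuous[OF ik]])
    (use D in \<open>simp add: Rep_def\<close>)

text \<open>For a fixed precision, \<open>\<phi>\<close> evaluates the function and the finitely many coefficients of an
approximation at one point \<open>y\<close>; as the coefficients agree at \<open>x\<close> and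
\<open>y\<close>, so do the functions, up to that precision.\<close>

lemma (in range_functional) determined_by_coefficients:
  assumes x: "x \<in> carrier G"
    and eq: "\<And>n D i k. D \<in> Rep n G \<Longrightarrow> i < n \<Longrightarrow> k < n \<Longrightarrow>
      \<phi> (\<lambda>x\<in>carrier G. D x $$ (i, k)) = D x $$ (i, k)"
    and f: "f \<in> AP G"
  shows "\<phi> f = f x"
proof -
  have Re_eq: "Re (\<phi> g) = Re (g x)" if g: "g \<in> AP G" for g
  proof -
    interpret g: ap_function G g by unfold_locales (rule g)
    have "\<bar>Re (\<phi> g) - Re (g x)\<bar> \<le> 0 + \<eta>" if \<eta>: "\<eta> > 0" for \<eta>
    proof -
      have "\<eta> / 2 > 0" using \<eta> by simp
      from g.Re_approximation[OF this] obtain n D C where D: "D \<in> Rep n G" and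
        C: "\<forall>x\<in>carrier G. cmod (complex_of_real (Re (g x)) - (\<Sum>i<n. \<Sum>k<n. C i k * D x $$ (i, k))) < \<eta> / 2"
        by (elim exE conjE) (rule that)
      define co where "co p = (\<lambda>x\<in>carrier G. D x $$ p)" for p
      have co: "co (i, k) \<in> AP G" if "i < n" "k < n" for i k
        unfolding co_def using Rep_coefficient_AP[OF topological_group_axioms D that] .
      have "countable (insert g (co ` ({..<n} \<times> {..<n})))" by simp
      moreover have "insert g (co ` ({..<n} \<times> {..<n})) \<subseteq> AP G" using g co by auto
      ultimately obtain y where y: "y \<in> carrier G"
        "\<forall>h\<in>insert g (co ` ({..<n} \<times> {..<n})). \<phi> h = h y"
        using simultaneous_countable by blast
      have "D y $$ (i, k) = D x $$ (i, k)" if ik: "i < n" "k < n" for i k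
      proof -
        have "\<phi> (co (i, k)) = co (i, k) y" using y(2) ik by blast
        moreover have "\<phi> (co (i, k)) = D x $$ (i, k)" unfolding co_def by (rule eq[OF D ik])
        ultimately show ?thesis using y(1) by (simp add: co_def)
      qed
      then have s: "(\<Sum>i<n. \<Sum>k<n. C i k * D y $$ (i, k)) = (\<Sum>i<n. \<Sum>k<n. C i k * D x $$ (i, k))" by simp
      define s where "s = (\<Sum>i<n. \<Sum>k<n. C i k * D x $$ (i, k))"
      have 1: "cmod (complex_of_real (Re (g y)) - s) < \<eta> / 2" and 2: "cmod (complex_of_real (Re (g x)) - s) < \<eta> / 2"
        using C y(1) x s by (auto simp: s_def)
      have "cmod (complex_of_real (Re (g y)) - complex_of_real (Re (g x))) < \<eta>"
        using norm_triangle_ineq4[of "complex_of_real (Re (g y)) - s" "complex_of_real (Re (g x)) - s"] 1 2 by simp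
      then have "\<bar>Re (g y) - Re (g x)\<bar> < \<eta>" by (simp only: of_real_diff[symmetric] norm_of_real)
      then show ?thesis using y(2) by simp
    qed
    then have "\<bar>Re (\<phi> g) - Re (g x)\<bar> \<le> 0" by (rule field_le_epsilon)
    then show ?thesis by simp
  qed
  have "Re (\<phi> (\<lambda>x\<in>carrier G. (- \<i>) * f x)) = Re ((\<lambda>x\<in>carrier G. (- \<i>) * f x) x)"
    by (rule Re_eq[OF AP_cmult[OF f]])
  then have "Im (\<phi> f) = Im (f x)" using x by (simp only: cmult[OF f]) simp
  then show ?thesis using Re_eq[OF f] by (simp add: complex_eq_iff)
qed

section \<open>Maximally almost periodic groups\<close>

locale map_group = topological_group G for G :: "'g topgroup" (structure) +
  assumes map: "maximally_almost_periodic G"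
begin

abbreviation "B \<equiv> bohr_group G"
abbreviation "b \<equiv> bohr_map G"

lemma bohr: "compact_group B" "b \<in> cont_hom G B" "topo B closure_of (b ` carrier G) = carrier B"
  using bohr_is_bohr[OF topological_group_axioms] by (auto simp: is_bohr_compactification_def)

sublocale B: compact_topgroup B
  using bohr(1) by (auto simp: compact_group_def compact_topgroup_def compact_topgroup_axioms_def)

lemma b_closed: "x \<in> carrier G \<Longrightarrow> b x \<in> carrier B"
  using bohr(2) by (auto simp: cont_hom_def hom_def)

lemma b_continuous: "continuous_map (topo G) (topo B) b"
  using bohr(2) by (simp add: cont_hom_def)

lemma b_inj: "inj_on b (carrier G)"
  using map by (simp add: maximally_almost_periodic_def)

lemma AP_bohr:
  "continuous_map (topo B) euclidean F \<Longrightarrow> (\<lambda>x\<in>carrier G. F (b x)) \<in> AP G"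
  by (rule AP_from_compact[OF topological_group_axioms bohr(1,2)])

text \<open>This is where injectivity of the Bohr map enters.\<close>

lemma AP_separates:
  assumes x: "x \<in> carrier G" and y: "y \<in> carrier G" and eq: "\<And>f. f \<in> AP G \<Longrightarrow> f x = f y"
  shows "x = y"
proof (rule ccontr)
  assume "x \<noteq> y"
  then have ne: "b x \<noteq> b y" using b_inj x y by (auto simp: inj_on_def)
  have "closedin (topo B) {b y}" using B.Hausdorff b_closed[OF y] B.topspace_topo
    by (simp add: closedin_Hausdorff_singleton)
  then have "openin (topo B) (carrier B - {b y})" using B.topspace_topo by (metis openin_diff openin_topspace)
  moreover have "b x \<in> carrier B - {b y}" using ne b_closed[OF x] by simp
  ultimately obtain F :: "'g set set \<Rightarrow> complex" where F: "continuous_map (topo B) euclidean F" "F (b x) = 0"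
    "\<And>q. q \<in> carrier B \<Longrightarrow> q \<notin> carrier B - {b y} \<Longrightarrow> F q = 1"
    by (rule B.vanishing_function) blast
  have "F (b y) = 1" using F(3)[of "b y"] b_closed[OF y] by simp
  then show False using eq[OF AP_bohr[OF F(1)]] F(2) x y by simp
qed

lemma Rep_separates:
  assumes x: "x \<in> carrier G" and y: "y \<in> carrier G"
    and eq: "\<And>n D i k. D \<in> Rep n G \<Longrightarrow> i < n \<Longrightarrow> k < n \<Longrightarrow> D x $$ (i, k) = D y $$ (i, k)"
  shows "x = y"
proof (rule AP_separates[OF x y])
  fix f assume f: "f \<in> AP G"
  interpret range_functional G "\<lambda>f. f x" by (rule evaluation_range_functional[OF x])
  show "f x = f y"
  proof (rule determined_by_coefficients[OF y _ f])
    fix n D i k assume "D \<in> Rep n G" "i < n" "k < n"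
    then show "(\<lambda>x\<in>carrier G. D x $$ (i, k)) x = D y $$ (i, k)" using eq x by simp
  qed
qed

lemma topspace_bohr: "topspace (bohr_topology G) = carrier G"
  using b_closed B.topspace_topo by (auto simp: bohr_topology_def topspace_pullback_topology)

lemma bohr_continuous_b: "continuous_map (bohr_topology G) (topo B) b"
  using continuous_map_pullback[OF continuous_map_id, of "carrier G" b "topo B"] by (simp add: bohr_topology_def)

lemma Hausdorff_bohr: "Hausdorff_space (bohr_topology G)"
  by (rule Hausdorff_space_injective_preimage[OF B.Hausdorff bohr_continuous_b])
    (use b_inj topspace_bohr in simp)

lemma compactin_imp_closedin_bohr:
  assumes "compactin (topo G) C" shows "closedin (bohr_topology G) C"
proof -
  have "continuous_map (topo G) (bohr_topology G) id"
    unfolding bohr_topology_def using b_continuous topspace_topo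
    by (intro continuous_map_pullback') auto
  from image_compactin[OF assms this] have "compactin (bohr_topology G) C" by simp
  then show ?thesis using Hausdorff_bohr by (rule compactin_imp_closedin[rotated])
qed

text \<open>In the realcompact case the functional is first found to be evaluation at a point of the compactification,
on functions that factor through it. The point comes from \<open>G\<close>, and the coefficients of
representations are such functions, because the unitary groups are compact; they determine the functional on
all of \<open>AP G\<close>.\<close>

lemma functional_is_evaluation:
  assumes \<phi>: "range_functional G \<phi>"
    and alt: "sigma_compact_space (topo G) \<or> realcompact_space (bohr_topology G)"
  shows "\<exists>x\<in>carrier G. \<forall>f\<in>AP G. \<phi> f = f x"
proof -
  interpret range_functional G \<phi> by (rule \<phi>)
  from alt show ?thesis
  proof
    assume "sigma_compact_space (topo G)"
    then have L: "Lindelof_space (topo G)" by (rule sigma_compact_imp_Lindelof)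
    have "\<exists>p\<in>topspace (topo G). \<forall>F\<in>AP G. \<phi> (\<lambda>x\<in>carrier G. F ((\<lambda>x. x) x)) = F p"
      by (rule represented[OF L]) (simp_all add: topspace_topo AP_continuous AP_restrict)
    then show ?thesis by (simp add: topspace_topo AP_restrict)
  next
    assume rc: "realcompact_space (bohr_topology G)"
    have "\<exists>p\<in>topspace (topo B). \<forall>F\<in>{F. continuous_map (topo B) euclidean F}. \<phi> (\<lambda>x\<in>carrier G. F (b x)) = F p"
      by (rule represented[OF B.Lindelof]) (use b_closed B.topspace_topo AP_bohr in auto)
    then obtain p where p: "p \<in> carrier B"
      and pF: "\<And>F. continuous_map (topo B) euclidean F \<Longrightarrow> \<phi> (\<lambda>x\<in>carrier G. F (b x)) = F p"
      unfolding B.topspace_topo by blast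
    have "p \<in> b ` carrier G"
    proof (rule B.realcompact_dense[OF _ bohr(3) _ p])
      show "b ` carrier G \<subseteq> carrier B" using b_closed by blast
      show "realcompact_space (pullback_topology (carrier G) b (topo B))"
        using rc by (simp add: bohr_topology_def)
      fix O' :: "nat \<Rightarrow> 'g set set set" assume O': "\<And>n. openin (topo B) (O' n) \<and> p \<in> O' n"
      have "\<exists>F :: 'g set set \<Rightarrow> complex. continuous_map (topo B) euclidean F \<and> F p = 0 \<and>
          (\<forall>q\<in>carrier B. q \<notin> O' n \<longrightarrow> F q = 1)" for n
        by (rule B.vanishing_function[of "O' n" p]) (use O' in blast)+
      then obtain F :: "nat \<Rightarrow> 'g set set \<Rightarrow> complex" where F: "\<And>n. continuous_map (topo B) euclidean (F n)" "\<And>n. F n p = 0"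
          "\<And>n q. q \<in> carrier B \<Longrightarrow> q \<notin> O' n \<Longrightarrow> F n q = 1" by metis
      define f where "f n = (\<lambda>x\<in>carrier G. F n (b x))" for n
      have "f n \<in> AP G" for n unfolding f_def by (rule AP_bohr[OF F(1)])
      then obtain x where x: "x \<in> carrier G" "\<forall>n. \<phi> (f n) = f n x" using simultaneous[of f] by blast
      have "b x \<in> O' n" for n
      proof (rule ccontr)
        assume "b x \<notin> O' n"
        then have "F n (b x) = 1" using F(3) b_closed[OF x(1)] by blast
        moreover have "\<phi> (f n) = 0" unfolding f_def using pF[OF F(1)] F(2) by simp
        ultimately show False using x by (simp add: f_def)
      qed
      then show "\<exists>x\<in>carrier G. \<forall>n. b x \<in> O' n" using x(1) by blast
    qed
    then obtain x where x: "x \<in> carrier G" "p = b x" by blast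
    have "\<phi> f = f x" if f: "f \<in> AP G" for f
    proof (rule determined_by_coefficients[OF x(1) _ f])
      fix n D i k assume D: "D \<in> Rep n G" and ik: "i < n" "k < n"
      have "D \<in> cont_hom G (unitary_group n)" using D by (simp add: Rep_def)
      from bohr_universal[OF topological_group_axioms bohr_is_bohr[OF topological_group_axioms]
          compact_group_unitary this]
      obtain D' where D': "D' \<in> cont_hom B (unitary_group n)" "\<forall>x\<in>carrier G. D x = D' (b x)" by (elim bexE) (rule that)
      have "continuous_map (topo B) (topo (unitary_group n)) D'" using D'(1) by (simp add: cont_hom_def)
      from continuous_map_compose[OF this unitary_entry_continuous[OF ik]]
      have "continuous_map (topo B) euclidean (\<lambda>q. D' q $$ (i, k))" by (simp add: o_def)
      from pF[OF this] have "\<phi> (\<lambda>x\<in>carrier G. D' (b x) $$ (i, k)) = D x $$ (i, k)" using D'(2) x by simp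
      moreover have "(\<lambda>x\<in>carrier G. D' (b x) $$ (i, k)) = (\<lambda>x\<in>carrier G. D x $$ (i, k))"
        by (rule restrict_ext) (use D'(2) in simp)
      ultimately show "\<phi> (\<lambda>x\<in>carrier G. D x $$ (i, k)) = D x $$ (i, k)" by simp
    qed
    then show ?thesis using x(1) by blast
  qed
qed

end

section \<open>Continuity of homomorphisms\<close>

text \<open>A closed graph argument. Countably many translates \<open>s C\<close> of a small compact neighbourhood
\<open>C\<close> of the identity cover \<open>G\<close>, and their closed preimages \<open>E s\<close>
cover \<open>H\<close>. By Baire's theorem some \<open>E s\<close> contains a nonempty open set
\<open>Q\<close>. Translates of \<open>Q\<close> are mapped into translates of
\<open>inv C \<otimes> C\<close>, which makes \<open>t\<close> continuous at every point.\<close>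

lemma closed_preimage_imp_continuous_hom:
  assumes G: "topological_group G" and H: "topological_group H"
    and lG: "locally_compact_space (topo G)" and lH: "locally_compact_space (topo H)"
    and sG: "Lindelof_space (topo G)" and t: "t \<in> hom H G"
    and cl: "\<And>C. compactin (topo G) C \<Longrightarrow> closedin (topo H) {h \<in> carrier H. t h \<in> C}"
  shows "continuous_map (topo H) (topo G) t"
proof -
  interpret G: topological_group G by fact
  interpret H: topological_group H by fact
  interpret t: group_hom H G t using t by unfold_locales
  show ?thesis
    unfolding continuous_map_def
  proof (intro conjI allI impI)
    show "t \<in> topspace (topo H) \<rightarrow> topspace (topo G)" by (simp add: G.topspace_topo H.topspace_topo)
    fix U assume U: "openin (topo G) U"
    show "openin (topo H) {h \<in> topspace (topo H). t h \<in> U}"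
      unfolding H.topspace_topo
    proof (subst openin_subopen, intro ballI)
      fix h0 assume "h0 \<in> {h \<in> carrier H. t h \<in> U}"
      then have h0: "h0 \<in> carrier H" "t h0 \<in> U" by auto
      have o1: "openin (topo G) {x \<in> carrier G. t h0 \<otimes>\<^bsub>G\<^esub> x \<in> U}" using U h0 by (intro G.open_left_translate) auto
      have "\<one>\<^bsub>G\<^esub> \<in> {x \<in> carrier G. t h0 \<otimes>\<^bsub>G\<^esub> x \<in> U}" using h0 by simp
      with o1 have "\<exists>V. openin (topo G) V \<and> \<one>\<^bsub>G\<^esub> \<in> V \<and>
          (\<forall>v\<in>V. \<forall>w\<in>V. inv\<^bsub>G\<^esub> v \<otimes>\<^bsub>G\<^esub> w \<in> {x \<in> carrier G. t h0 \<otimes>\<^bsub>G\<^esub> x \<in> U})"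
        by (rule G.quotient_nbhd) blast
      then obtain V where V: "openin (topo G) V" "\<one>\<^bsub>G\<^esub> \<in> V"
          "\<forall>v\<in>V. \<forall>w\<in>V. inv\<^bsub>G\<^esub> v \<otimes>\<^bsub>G\<^esub> w \<in> {x \<in> carrier G. t h0 \<otimes>\<^bsub>G\<^esub> x \<in> U}"
        by (elim exE conjE) (rule that)
      have rG: "regular_space (topo G)" using lG G.Hausdorff by (rule locally_compact_Hausdorff_imp_regular_space)
      have "neighbourhood_base_of (\<lambda>C. compactin (topo G) C \<and> closedin (topo G) C) (topo G)"
        using lG rG locally_compact_regular_space_neighbourhood_base[of "topo G"] by simp
      then have "\<exists>U1 C. openin (topo G) U1 \<and> (compactin (topo G) C \<and> closedin (topo G) C) \<and> \<one>\<^bsub>G\<^esub> \<in> U1 \<and> U1 \<subseteq> C \<and> C \<subseteq> V"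
        unfolding neighbourhood_base_of using V(1,2) by blast
      then obtain U1 C where UC: "openin (topo G) U1" "compactin (topo G) C" "\<one>\<^bsub>G\<^esub> \<in> U1" "U1 \<subseteq> C" "C \<subseteq> V"
        by blast
      have CG: "C \<subseteq> carrier G" using compactin_subset_topspace[OF UC(2)] G.topspace_topo by simp
      define P where "P s = {x \<in> carrier G. inv\<^bsub>G\<^esub> s \<otimes>\<^bsub>G\<^esub> x \<in> U1}" for s
      have oP: "openin (topo G) W" if "W \<in> P ` carrier G" for W
        using that G.open_left_translate[OF UC(1)] by (auto simp: P_def)
      have "x \<in> P x" if "x \<in> carrier G" for x using that UC(3) by (simp add: P_def)
      then have cov: "\<Union>(P ` carrier G) = topspace (topo G)" by (auto simp: P_def G.topspace_topo)
      have "\<exists>\<V>. countable \<V> \<and> \<V> \<subseteq> P ` carrier G \<and> \<Union>\<V> = topspace (topo G)"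
        by (rule Lindelof_spaceD[OF sG _ cov]) (rule oP)
      then obtain \<V> where \<V>: "countable \<V>" "\<V> \<subseteq> P ` carrier G" "\<Union>\<V> = topspace (topo G)"
        by (elim exE conjE) (rule that)
      obtain S where S: "countable S" "S \<subseteq> carrier G" "\<V> = P ` S" using \<V>(1,2) by (metis countable_subset_image)
      define E where "E s = {h \<in> carrier H. inv\<^bsub>G\<^esub> s \<otimes>\<^bsub>G\<^esub> t h \<in> C}" for s
      have clE: "closedin (topo H) (E s)" if s: "s \<in> carrier G" for s
      proof -
        have "continuous_map (topo G) (topo G) (\<lambda>x. s \<otimes>\<^bsub>G\<^esub> x)"
          using s by (intro G.continuous_map_mult continuous_map_id[unfolded id_def]) (simp add: G.topspace_topo)
        from image_compactin[OF UC(2) this]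
        have c: "compactin (topo G) ((\<lambda>x. s \<otimes>\<^bsub>G\<^esub> x) ` C)" .
        have "E s = {h \<in> carrier H. t h \<in> (\<lambda>x. s \<otimes>\<^bsub>G\<^esub> x) ` C}"
          unfolding E_def
        proof (rule Collect_cong, rule conj_cong[OF refl])
          fix h assume h: "h \<in> carrier H"
          show "inv\<^bsub>G\<^esub> s \<otimes>\<^bsub>G\<^esub> t h \<in> C \<longleftrightarrow> t h \<in> (\<lambda>x. s \<otimes>\<^bsub>G\<^esub> x) ` C"
          proof
            assume "inv\<^bsub>G\<^esub> s \<otimes>\<^bsub>G\<^esub> t h \<in> C"
            moreover have "t h = s \<otimes>\<^bsub>G\<^esub> (inv\<^bsub>G\<^esub> s \<otimes>\<^bsub>G\<^esub> t h)" using s h by (simp flip: G.m_assoc)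
            ultimately show "t h \<in> (\<lambda>x. s \<otimes>\<^bsub>G\<^esub> x) ` C" by (metis imageI)
          next
            assume "t h \<in> (\<lambda>x. s \<otimes>\<^bsub>G\<^esub> x) ` C"
            then obtain c where "c \<in> C" "t h = s \<otimes>\<^bsub>G\<^esub> c" by blast
            then show "inv\<^bsub>G\<^esub> s \<otimes>\<^bsub>G\<^esub> t h \<in> C" using s CG by (auto simp flip: G.m_assoc)
          qed
        qed
        then show ?thesis using cl[OF c] by simp
      qed
      have covE: "\<Union>(E ` S) = carrier H"
      proof (rule subset_antisym; rule subsetI)
        fix h assume h: "h \<in> carrier H"
        then have "t h \<in> \<Union>(P ` S)" using \<V>(3) S(3) G.topspace_topo by simp
        then obtain s where "s \<in> S" "t h \<in> P s" by blast
        then show "h \<in> \<Union>(E ` S)" using h UC(4) by (auto simp: E_def P_def)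
      qed (auto simp: E_def)
      have "\<exists>s\<in>S. topo H interior_of (E s) \<noteq> {}"
      proof (rule ccontr)
        assume neg: "\<not> ?thesis"
        have "topo H interior_of \<Union>(E ` S) = {}"
        proof (rule Baire_category_alt)
          show "completely_metrizable_space (topo H) \<or> locally_compact_space (topo H) \<and> regular_space (topo H)"
            using lH locally_compact_Hausdorff_imp_regular_space[OF lH H.Hausdorff] by blast
          show "countable (E ` S)" using S(1) by simp
          fix T assume "T \<in> E ` S"
          then show "closedin (topo H) T \<and> topo H interior_of T = {}" using neg clE S(2) by blast
        qed
        then have "topspace (topo H) = {}" using covE H.topspace_topo by (metis interior_of_topspace)
        then show False using H.one_closed H.topspace_topo by blast
      qed
      then obtain s h1 where s: "s \<in> S" "h1 \<in> topo H interior_of (E s)" by blast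
      define Q where "Q = topo H interior_of (E s)"
      have Q: "openin (topo H) Q" "Q \<subseteq> E s" "h1 \<in> Q" using s(2) by (simp_all add: Q_def interior_of_subset)
      have sG: "s \<in> carrier G" using s(1) S(2) by blast
      have h1: "h1 \<in> carrier H" using Q by (auto simp: E_def)
      define g where "g = h1 \<otimes>\<^bsub>H\<^esub> inv\<^bsub>H\<^esub> h0"
      have gH: "g \<in> carrier H" using h0 h1 by (simp add: g_def)
      have oR: "openin (topo H) {h \<in> carrier H. g \<otimes>\<^bsub>H\<^esub> h \<in> Q}" using Q(1) gH by (rule H.open_left_translate)
      have h0R: "h0 \<in> {h \<in> carrier H. g \<otimes>\<^bsub>H\<^esub> h \<in> Q}" using h0 h1 Q(3) by (simp add: g_def H.m_assoc)
      have "t h \<in> U" if h: "h \<in> carrier H" "g \<otimes>\<^bsub>H\<^esub> h \<in> Q" for h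
      proof -
        have 1: "inv\<^bsub>G\<^esub> s \<otimes>\<^bsub>G\<^esub> t h1 \<in> V" using Q(2,3) UC(5) by (auto simp: E_def)
        have 2: "inv\<^bsub>G\<^esub> s \<otimes>\<^bsub>G\<^esub> t (g \<otimes>\<^bsub>H\<^esub> h) \<in> V" using Q(2) h(2) UC(5) by (auto simp: E_def)
        have "t h0 \<otimes>\<^bsub>G\<^esub> (inv\<^bsub>G\<^esub> (inv\<^bsub>G\<^esub> s \<otimes>\<^bsub>G\<^esub> t h1) \<otimes>\<^bsub>G\<^esub> (inv\<^bsub>G\<^esub> s \<otimes>\<^bsub>G\<^esub> t (g \<otimes>\<^bsub>H\<^esub> h))) \<in> U"
          using V(3) 1 2 by blast
        moreover have "inv\<^bsub>G\<^esub> (inv\<^bsub>G\<^esub> s \<otimes>\<^bsub>G\<^esub> t h1) \<otimes>\<^bsub>G\<^esub> (inv\<^bsub>G\<^esub> s \<otimes>\<^bsub>G\<^esub> t (g \<otimes>\<^bsub>H\<^esub> h)) = inv\<^bsub>G\<^esub> (t h1) \<otimes>\<^bsub>G\<^esub> t (g \<otimes>\<^bsub>H\<^esub> h)"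
        proof -
          have "s \<otimes>\<^bsub>G\<^esub> (inv\<^bsub>G\<^esub> s \<otimes>\<^bsub>G\<^esub> t (g \<otimes>\<^bsub>H\<^esub> h)) = t (g \<otimes>\<^bsub>H\<^esub> h)"
            using sG gH h by (simp flip: G.m_assoc)
          then show ?thesis using sG gH h h1 by (simp add: G.inv_mult_group G.m_assoc del: t.hom_mult)
        qed
        moreover have "inv\<^bsub>G\<^esub> (t h1) \<otimes>\<^bsub>G\<^esub> t (g \<otimes>\<^bsub>H\<^esub> h) = inv\<^bsub>G\<^esub> (t h0) \<otimes>\<^bsub>G\<^esub> t h"
        proof -
          have "t (g \<otimes>\<^bsub>H\<^esub> h) = t h1 \<otimes>\<^bsub>G\<^esub> (inv\<^bsub>G\<^esub> (t h0) \<otimes>\<^bsub>G\<^esub> t h)"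
            using h0 h1 h by (simp add: g_def G.m_assoc)
          then show ?thesis using h0 h1 h by (simp flip: G.m_assoc)
        qed
        moreover have "t h0 \<otimes>\<^bsub>G\<^esub> (inv\<^bsub>G\<^esub> (t h0) \<otimes>\<^bsub>G\<^esub> t h) = t h" using h0 h by (simp flip: G.m_assoc)
        ultimately show ?thesis by simp
      qed
      then show "\<exists>T. openin (topo H) T \<and> h0 \<in> T \<and> T \<subseteq> {h \<in> carrier H. t h \<in> U}"
        using oR h0R by (intro exI[of _ "{h \<in> carrier H. g \<otimes>\<^bsub>H\<^esub> h \<in> Q}"]) auto
    qed
  qed
qed

text \<open>Near \<open>h0\<close> in the compact neighbourhood \<open>C\<close>, the points that \<open>t\<close> maps
outside \<open>U\<close> are mapped into the part of \<open>t ` C\<close> outside \<open>U\<close>. That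
part is compact in \<open>G\<close>, hence closed in the Bohr topology, so the points of \<open>H\<close>
that are not mapped into it form a neighbourhood of \<open>h0\<close>.\<close>

lemma respects_compactness_continuous:
  assumes G: "map_group G" and H: "topological_group H" and lH: "locally_compact_space (topo H)"
    and rc: "respects_compactness G" and t: "continuous_map (topo H) (bohr_topology G) t"
  shows "continuous_map (topo H) (topo G) t"
proof -
  interpret G: map_group G by fact
  interpret H: topological_group H by fact
  show ?thesis
    unfolding continuous_map_def
  proof (intro conjI allI impI)
    have tc: "t h \<in> carrier G" if "h \<in> carrier H" for h
      using continuous_map_image_subset_topspace[OF t] that G.topspace_bohr H.topspace_topo by auto
    show "t \<in> topspace (topo H) \<rightarrow> topspace (topo G)" using tc by (simp add: G.topspace_topo H.topspace_topo)
    fix U assume U: "openin (topo G) U"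
    show "openin (topo H) {h \<in> topspace (topo H). t h \<in> U}"
      unfolding H.topspace_topo
    proof (subst openin_subopen, intro ballI)
      fix h0 assume "h0 \<in> {h \<in> carrier H. t h \<in> U}"
      then have h0: "h0 \<in> carrier H" "t h0 \<in> U" by auto
      have "\<exists>N C. openin (topo H) N \<and> compactin (topo H) C \<and> h0 \<in> N \<and> N \<subseteq> C"
        using lH h0(1) by (simp add: locally_compact_space_def H.topspace_topo)
      then obtain N C where N: "openin (topo H) N" "compactin (topo H) C" "h0 \<in> N" "N \<subseteq> C"
        by (elim exE conjE) (rule that)
      have "compactin (bohr_topology G) (t ` C)" using N(2) t by (rule image_compactin)
      then have c: "compactin (topo G) (t ` C)" using rc by (simp add: respects_compactness_def)
      have "compactin (topo G) (t ` C \<inter> (topspace (topo G) - U))"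
        using c U by (intro compact_Int_closedin closedin_diff closedin_topspace)
      then have cb: "closedin (bohr_topology G) (t ` C \<inter> (topspace (topo G) - U))"
        by (rule G.compactin_imp_closedin_bohr)
      define T where "T = N \<inter> {h \<in> topspace (topo H). t h \<in> topspace (bohr_topology G) - (t ` C \<inter> (topspace (topo G) - U))}"
      have "openin (topo H) T" unfolding T_def using cb
        by (intro openin_Int N openin_continuous_map_preimage[OF t] openin_diff openin_topspace)
      moreover have "h0 \<in> T" using h0 N(3) tc by (simp add: T_def G.topspace_bohr H.topspace_topo)
      moreover have "T \<subseteq> {h \<in> carrier H. t h \<in> U}"
      proof
        fix h assume "h \<in> T"
        then have h: "h \<in> N" "h \<in> carrier H" "t h \<notin> t ` C \<inter> (topspace (topo G) - U)"
          by (auto simp: T_def H.topspace_topo)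
        have "t h \<in> t ` C" using h(1) N(4) by blast
        then show "h \<in> {h \<in> carrier H. t h \<in> U}" using h tc[OF h(2)] G.topspace_topo by auto
      qed
      ultimately show "\<exists>T. openin (topo H) T \<and> h0 \<in> T \<and> T \<subseteq> {h \<in> carrier H. t h \<in> U}" by blast
    qed
  qed
qed

section \<open>Non-vanishing maps that respect representations\<close>

locale nonvanishing_map = G: map_group G + H: topological_group H
  for G :: "'g topgroup" and H :: "'h topgroup" +
  fixes T :: "('g \<Rightarrow> complex) \<Rightarrow> 'h \<Rightarrow> complex"
  assumes linear: "AP_linear G H T" and nv: "non_vanishing G H T" and reps: "respects_unitary_reps G H T"
begin

lemma T_AP: "f \<in> AP G \<Longrightarrow> T f \<in> AP H"
  using linear by (auto simp: AP_linear_def)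

lemma T_add: "f \<in> AP G \<Longrightarrow> g \<in> AP G \<Longrightarrow> h \<in> carrier H \<Longrightarrow> T (\<lambda>x\<in>carrier G. f x + g x) h = T f h + T g h"
  using linear by (simp add: AP_linear_def)

lemma T_cmult: "f \<in> AP G \<Longrightarrow> h \<in> carrier H \<Longrightarrow> T (\<lambda>x\<in>carrier G. c * f x) h = c * T f h"
  using linear by (simp add: AP_linear_def)

definition \<gamma> :: "'h \<Rightarrow> complex" where
  "\<gamma> = T (\<lambda>x\<in>carrier G. 1)"

lemma one_AP: "(\<lambda>x\<in>carrier G. 1) \<in> AP G"
  by (rule G.AP_const)

lemma T_Rep:
  assumes D: "D \<in> Rep n G" and n: "n \<ge> 1"
  shows "(\<lambda>h. mat n n (\<lambda>p. T (\<lambda>x\<in>carrier G. D x $$ p) h)) \<in> Rep n H"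
  using reps D n by (simp add: respects_unitary_reps_def)

text \<open>The matrix of size one with entry \<open>\<gamma>\<close> is the image of the trivial representation.\<close>

lemma \<gamma>_hom:
  shows \<gamma>_norm: "h \<in> carrier H \<Longrightarrow> cmod (\<gamma> h) = 1"
    and \<gamma>_mult: "h \<in> carrier H \<Longrightarrow> h' \<in> carrier H \<Longrightarrow> \<gamma> (h \<otimes>\<^bsub>H\<^esub> h') = \<gamma> h * \<gamma> h'"
proof -
  define D :: "'g \<Rightarrow> complex mat" where "D = (\<lambda>x. 1\<^sub>m 1)"
  have "D \<in> Rep 1 G"
    unfolding Rep_iff[OF G.topological_group_axioms] D_def
    by (auto simp: unitary_mats_def mat_adjoint_one)
  from T_Rep[OF this] have R: "(\<lambda>h. mat 1 1 (\<lambda>p. T (\<lambda>x\<in>carrier G. D x $$ p) h)) \<in> Rep 1 H" by simp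
  have e: "mat 1 1 (\<lambda>p. T (\<lambda>x\<in>carrier G. D x $$ p) h) = mat 1 1 (\<lambda>p. \<gamma> h)" for h
    by (rule eq_matI) (auto simp: D_def \<gamma>_def)
  have u: "mat 1 1 (\<lambda>p. \<gamma> h) \<in> unitary_mats 1" if "h \<in> carrier H" for h
    using R that unfolding Rep_iff[OF H.topological_group_axioms] e by blast
  have m: "mat 1 1 (\<lambda>p. \<gamma> (h \<otimes>\<^bsub>H\<^esub> h')) = mat 1 1 (\<lambda>p. \<gamma> h) * mat 1 1 (\<lambda>p. \<gamma> h')"
    if "h \<in> carrier H" "h' \<in> carrier H" for h h'
    using R that unfolding Rep_iff[OF H.topological_group_axioms] e by blast
  show "\<gamma> (h \<otimes>\<^bsub>H\<^esub> h') = \<gamma> h * \<gamma> h'" if "h \<in> carrier H" "h' \<in> carrier H"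
    using arg_cong[OF m[OF that], of "\<lambda>A. A $$ (0, 0)"] by (simp add: scalar_prod_def)
  show "cmod (\<gamma> h) = 1" if h: "h \<in> carrier H"
  proof -
    let ?A = "mat 1 1 (\<lambda>p. \<gamma> h)"
    have A: "?A \<in> carrier_mat 1 1" by simp
    have "(?A * mat_adjoint ?A) $$ (0, 0) = \<gamma> h * cnj (\<gamma> h)"
      using mat_mult_index[OF A mat_adjoint_carrier[OF A], of 0 0] mat_adjoint_index[OF A, of 0 0] by simp
    then have "\<gamma> h * cnj (\<gamma> h) = 1" using unitary_matsD(2)[OF u[OF h]] by simp
    then have "complex_of_real ((cmod (\<gamma> h))\<^sup>2) = 1" by (simp only: complex_norm_square)
    then have "(cmod (\<gamma> h))\<^sup>2 = 1" by (metis of_real_eq_1_iff)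
    then show ?thesis by (simp add: power2_eq_1_iff) (use norm_ge_zero[of "\<gamma> h"] in linarith)
  qed
qed

lemma \<gamma>_continuous: "continuous_map (topo H) euclidean \<gamma>"
  unfolding \<gamma>_def by (rule AP_continuous[OF T_AP[OF one_AP]])

lemma \<gamma>_dual: "\<gamma> \<in> dual_group H"
  using \<gamma>_norm \<gamma>_mult \<gamma>_continuous H.topspace_topo
  by (auto simp: dual_group_def cont_hom_def hom_def circle_group_def continuous_map_in_subtopology)

lemma \<gamma>_cnj: "h \<in> carrier H \<Longrightarrow> cnj (\<gamma> h) * \<gamma> h = 1"
  using \<gamma>_norm[of h] complex_norm_square[of "\<gamma> h"] by (simp add: mult.commute)

definition \<phi> :: "'h \<Rightarrow> ('g \<Rightarrow> complex) \<Rightarrow> complex" where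
  "\<phi> h f = cnj (\<gamma> h) * T f h"

lemma T_\<phi>: "h \<in> carrier H \<Longrightarrow> T f h = \<gamma> h * \<phi> h f"
  using \<gamma>_cnj[of h] by (simp add: \<phi>_def mult.assoc[symmetric] mult.commute[of "\<gamma> h"])

lemma \<phi>_range_functional:
  assumes h: "h \<in> carrier H" shows "range_functional G (\<phi> h)"
proof unfold_locales
  show "\<phi> h (\<lambda>x\<in>carrier G. f x + g x) = \<phi> h f + \<phi> h g" if "f \<in> AP G" "g \<in> AP G" for f g
    using that h by (simp only: \<phi>_def T_add ring_distribs)
  show "\<phi> h (\<lambda>x\<in>carrier G. c * f x) = c * \<phi> h f" if "f \<in> AP G" for f c
    using that h by (simp only: \<phi>_def T_cmult mult.left_commute)
  fix f assume f: "f \<in> AP G"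
  define c where "c = - \<phi> h f"
  define g where "g = (\<lambda>x\<in>carrier G. f x + (\<lambda>x\<in>carrier G. c * (\<lambda>x\<in>carrier G. 1) x) x)"
  have g: "g \<in> AP G" unfolding g_def by (intro G.AP_add f G.AP_cmult one_AP)
  have "T g h = T f h + c * \<gamma> h"
    unfolding g_def \<gamma>_def by (simp only: T_add[OF f G.AP_cmult[OF one_AP] h] T_cmult[OF one_AP h])
  also have "\<dots> = 0" using T_\<phi>[OF h] by (simp add: c_def mult.commute)
  finally have "\<not> (\<forall>y\<in>carrier H. T g y \<noteq> 0)" using h by blast
  then obtain x where x: "x \<in> carrier G" "g x = 0" using nv g by (auto simp: non_vanishing_def)
  then show "\<exists>x\<in>carrier G. \<phi> h f = f x" by (intro bexI[of _ x]) (simp_all add: g_def c_def)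
qed

lemma \<phi>_continuous:
  assumes f: "f \<in> AP G" shows "continuous_map (topo H) euclidean (\<lambda>h. \<phi> h f)"
proof -
  have "continuous_map (topo H) euclidean (\<lambda>h. cnj (\<gamma> h))"
    using continuous_map_compose[OF \<gamma>_continuous, of euclidean cnj] by (simp add: o_def continuous_on_cnj)
  then show ?thesis unfolding \<phi>_def
    by (intro continuous_map_complex_mult AP_continuous[OF T_AP[OF f]])
qed

text \<open>Otherwise countably many functions \<open>f n\<close> distinguish \<open>x\<close> from all functionals
\<open>\<phi> h\<close>. Let \<open>g\<close> vanish exactly where all \<open>f n\<close> have the same
values as at \<open>x\<close>. Since \<open>g x = 0\<close>, also \<open>T g\<close> has a zero
\<open>h\<close>, and a point that represents \<open>\<phi> h\<close> on \<open>g\<close> and all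
\<open>f n\<close> shows that \<open>\<phi> h\<close> is not distinguished from \<open>x\<close> by any
\<open>f n\<close>.\<close>

lemma evaluation_attained:
  assumes L: "Lindelof_space (topo H)" and x: "x \<in> carrier G"
  shows "\<exists>h\<in>carrier H. \<forall>f\<in>AP G. \<phi> h f = f x"
proof (rule ccontr)
  assume neg: "\<not> ?thesis"
  define U where "U f = {h \<in> carrier H. \<phi> h f \<noteq> f x}" for f
  have op: "openin (topo H) W" if "W \<in> U ` AP G" for W
  proof -
    obtain f where f: "f \<in> AP G" "W = U f" using \<open>W \<in> U ` AP G\<close> by (rule imageE) simp
    have "openin (topo H) {h \<in> topspace (topo H). \<phi> h f \<in> - {f x}}"
      using \<phi>_continuous[OF f(1)] by (rule openin_continuous_map_preimage) (simp add: open_Compl)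
    then show ?thesis by (simp add: f(2) U_def H.topspace_topo)
  qed
  have cov: "\<Union>(U ` AP G) = topspace (topo H)"
  proof (rule subset_antisym; rule subsetI)
    fix h assume "h \<in> topspace (topo H)"
    then have h: "h \<in> carrier H" by (simp add: H.topspace_topo)
    then obtain f where f: "f \<in> AP G" "\<phi> h f \<noteq> f x" using neg by blast
    then show "h \<in> \<Union>(U ` AP G)" using h by (auto simp: U_def)
  qed (auto simp: U_def H.topspace_topo)
  have "\<exists>\<V>. countable \<V> \<and> \<V> \<subseteq> U ` AP G \<and> \<Union>\<V> = topspace (topo H)"
    by (rule Lindelof_spaceD[OF L _ cov]) (rule op)
  then obtain \<V> where V: "countable \<V>" "\<V> \<subseteq> U ` AP G" "\<Union>\<V> = topspace (topo H)"
    by (elim exE conjE) (rule that)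
  obtain \<F> where F: "countable \<F>" "\<F> \<subseteq> AP G" "\<V> = U ` \<F>" using V(1,2) by (metis countable_subset_image)
  have "topspace (topo H) \<noteq> {}" using H.one_closed H.topspace_topo by blast
  then have "\<F> \<noteq> {}" unfolding V(3)[symmetric] F(3) by blast
  then have r: "range (from_nat_into \<F>) = \<F>" using F(1) by (rule range_from_nat_into)
  define f where "f = from_nat_into \<F>"
  have f: "f n \<in> AP G" for n unfolding f_def using \<open>\<F> \<noteq> {}\<close> F(2) from_nat_into[of \<F>] by blast
  obtain g where g: "g \<in> AP G" "\<forall>y\<in>carrier G. g y = 0 \<longleftrightarrow> (\<forall>n. f n y = f n x)"
    using G.common_zero_function[where f = f and c = "\<lambda>n. f n x", OF f] by (elim bexE conjE) (rule that)
  have "g x = 0" using g(2) x by simp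
  then have "\<not> (\<forall>y\<in>carrier H. T g y \<noteq> 0)" using nv g(1) x by (auto simp: non_vanishing_def)
  then obtain h where h: "h \<in> carrier H" "T g h = 0" by blast
  have \<phi>g: "\<phi> h g = 0" using h by (simp add: \<phi>_def)
  interpret F: range_functional G "\<phi> h" by (rule \<phi>_range_functional[OF h(1)])
  have "countable (insert g \<F>)" "insert g \<F> \<subseteq> AP G" using F g(1) by auto
  then obtain y where y: "y \<in> carrier G" "\<forall>k\<in>insert g \<F>. \<phi> h k = k y" using F.simultaneous_countable by blast
  have "g y = 0" using y(2) \<phi>g by simp
  then have fy: "f n y = f n x" for n using g(2) y(1) by simp
  have "h \<in> \<Union>\<V>" using V(3) h(1) H.topspace_topo by simp
  then obtain k where k: "k \<in> \<F>" "h \<in> U k" using F(3) by blast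
  have "k \<in> range f" unfolding f_def r by (rule k(1))
  then obtain n where "k = f n" by (rule rangeE)
  then have "\<phi> h k = k x" using y(2) k(1) fy by simp
  then show False using k(2) by (simp add: U_def)
qed

text \<open>For a representation \<open>D\<close> of \<open>G\<close>, the matrices
\<open>\<gamma> h * D (t h)\<close> form a representation of \<open>H\<close>. Cancelling
\<open>\<gamma>\<close>, the map \<open>D \<circ> t\<close> is multiplicative, and representations
separate the points of \<open>G\<close>.\<close>

lemma hom_from_evaluation:
  assumes tG: "\<And>h. h \<in> carrier H \<Longrightarrow> t h \<in> carrier G"
    and t: "\<And>h f. h \<in> carrier H \<Longrightarrow> f \<in> AP G \<Longrightarrow> \<phi> h f = f (t h)"
  shows "t \<in> hom H G"
proof (rule homI)
  show "t h \<in> carrier G" if "h \<in> carrier H" for h using tG that .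
  fix h h' assume h: "h \<in> carrier H" and h': "h' \<in> carrier H"
  have hh: "h \<otimes>\<^bsub>H\<^esub> h' \<in> carrier H" using h h' by simp
  show "t (h \<otimes>\<^bsub>H\<^esub> h') = t h \<otimes>\<^bsub>G\<^esub> t h'"
  proof (rule G.Rep_separates)
    show "t (h \<otimes>\<^bsub>H\<^esub> h') \<in> carrier G" "t h \<otimes>\<^bsub>G\<^esub> t h' \<in> carrier G" using tG h h' hh by auto
    fix n D i k assume D: "D \<in> Rep n G" and ik: "i < n" "k < n"
    have Dc: "D x \<in> carrier_mat n n" if "x \<in> carrier G" for x
      using D that unfolding Rep_iff[OF G.topological_group_axioms] by (auto dest: unitary_matsD)
    have Dm: "D (t h \<otimes>\<^bsub>G\<^esub> t h') = D (t h) * D (t h')"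
      using D tG[OF h] tG[OF h'] unfolding Rep_iff[OF G.topological_group_axioms] by blast
    define E where "E y = mat n n (\<lambda>p. T (\<lambda>x\<in>carrier G. D x $$ p) y)" for y
    have Ec: "E y \<in> carrier_mat n n" for y by (simp add: E_def)
    have E: "E y $$ (a, c) = \<gamma> y * D (t y) $$ (a, c)" if y: "y \<in> carrier H" and ac: "a < n" "c < n" for y a c
    proof -
      have "\<phi> y (\<lambda>x\<in>carrier G. D x $$ (a, c)) = D (t y) $$ (a, c)"
        using t[OF y Rep_coefficient_AP[OF G.topological_group_axioms D ac]] tG[OF y] by simp
      then show ?thesis using T_\<phi>[OF y] ac by (simp add: E_def)
    qed
    have "n \<ge> 1" using ik by simp
    then have "E \<in> Rep n H" unfolding E_def using D by (intro T_Rep)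
    then have "E (h \<otimes>\<^bsub>H\<^esub> h') = E h * E h'"
      using h h' unfolding Rep_iff[OF H.topological_group_axioms] by blast
    then have "E (h \<otimes>\<^bsub>H\<^esub> h') $$ (i, k) = (\<Sum>j<n. E h $$ (i, j) * E h' $$ (j, k))"
      using mat_mult_index[OF Ec Ec ik] by simp
    also have "\<dots> = (\<Sum>j<n. (\<gamma> h * \<gamma> h') * (D (t h) $$ (i, j) * D (t h') $$ (j, k)))"
      using E h h' ik by (intro sum.cong) auto
    also have "\<dots> = (\<gamma> h * \<gamma> h') * D (t h \<otimes>\<^bsub>G\<^esub> t h') $$ (i, k)"
      unfolding Dm mat_mult_index[OF Dc[OF tG[OF h]] Dc[OF tG[OF h']] ik] by (rule sum_distrib_left[symmetric])
    also have "E (h \<otimes>\<^bsub>H\<^esub> h') $$ (i, k) = (\<gamma> h * \<gamma> h') * D (t (h \<otimes>\<^bsub>H\<^esub> h')) $$ (i, k)"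
      using E[OF hh ik] \<gamma>_mult[OF h h'] by simp
    finally have "(\<gamma> h * \<gamma> h') * D (t (h \<otimes>\<^bsub>H\<^esub> h')) $$ (i, k) = (\<gamma> h * \<gamma> h') * D (t h \<otimes>\<^bsub>G\<^esub> t h') $$ (i, k)" .
    moreover have "\<gamma> h * \<gamma> h' \<noteq> 0" using \<gamma>_norm[OF h] \<gamma>_norm[OF h'] by auto
    ultimately show "D (t (h \<otimes>\<^bsub>H\<^esub> h')) $$ (i, k) = D (t h \<otimes>\<^bsub>G\<^esub> t h') $$ (i, k)" by simp
  qed
qed

lemma bohr_continuous:
  assumes tG: "\<And>h. h \<in> carrier H \<Longrightarrow> t h \<in> carrier G"
    and t: "\<And>h f. h \<in> carrier H \<Longrightarrow> f \<in> AP G \<Longrightarrow> \<phi> h f = f (t h)"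
  shows "continuous_map (topo H) (bohr_topology G) t"
proof -
  have "continuous_map (topo H) (topo G.B) (G.b \<circ> t)"
    unfolding continuous_map_def
  proof (intro conjI allI impI)
    show "G.b \<circ> t \<in> topspace (topo H) \<rightarrow> topspace (topo G.B)"
      using G.b_closed tG by (simp add: H.topspace_topo G.B.topspace_topo)
    fix O' assume O': "openin (topo G.B) O'"
    show "openin (topo H) {h \<in> topspace (topo H). (G.b \<circ> t) h \<in> O'}"
      unfolding H.topspace_topo
    proof (subst openin_subopen, intro ballI)
      fix h0 assume "h0 \<in> {h \<in> carrier H. (G.b \<circ> t) h \<in> O'}"
      then have h0: "h0 \<in> carrier H" "G.b (t h0) \<in> O'" by auto
      from O' h0(2) have "\<exists>F :: 'g set set \<Rightarrow> complex. continuous_map (topo G.B) euclidean F \<and> F (G.b (t h0)) = 0 \<and>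
          (\<forall>q\<in>carrier G.B. q \<notin> O' \<longrightarrow> F q = 1)"
        by (rule G.B.vanishing_function) blast
      then obtain F :: "'g set set \<Rightarrow> complex" where F: "continuous_map (topo G.B) euclidean F" "F (G.b (t h0)) = 0"
          "\<forall>q\<in>carrier G.B. q \<notin> O' \<longrightarrow> F q = 1"
        by (elim exE conjE) (rule that)
      define f where "f = (\<lambda>x\<in>carrier G. F (G.b x))"
      have f: "f \<in> AP G" unfolding f_def by (rule G.AP_bohr[OF F(1)])
      have \<phi>f: "\<phi> h f = F (G.b (t h))" if "h \<in> carrier H" for h using t[OF that f] tG[OF that] by (simp add: f_def)
      have "openin (topo H) {h \<in> topspace (topo H). \<phi> h f \<in> - {1}}"
        using \<phi>_continuous[OF f] by (rule openin_continuous_map_preimage) (simp add: open_Compl)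
      moreover have "h0 \<in> {h \<in> topspace (topo H). \<phi> h f \<in> - {1}}"
        using h0(1) \<phi>f F(2) by (simp add: H.topspace_topo)
      moreover have "{h \<in> topspace (topo H). \<phi> h f \<in> - {1}} \<subseteq> {h \<in> carrier H. (G.b \<circ> t) h \<in> O'}"
        using \<phi>f F(3) G.b_closed tG by (auto simp: H.topspace_topo)
      ultimately show "\<exists>T. openin (topo H) T \<and> h0 \<in> T \<and> T \<subseteq> {h \<in> carrier H. (G.b \<circ> t) h \<in> O'}" by blast
    qed
  qed
  then show ?thesis
    unfolding bohr_topology_def using tG H.topspace_topo by (intro continuous_map_pullback') auto
qed

end

theorem theorem3p2:
  fixes G :: "'g topgroup" and H :: "'h topgroup"
    and T :: "('g \<Rightarrow> complex) \<Rightarrow> 'h \<Rightarrow> complex"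
  assumes "topological_group G" and "topological_group H"
    and "locally_compact_space (topo G)" and "locally_compact_space (topo H)"
    and "maximally_almost_periodic G" and "maximally_almost_periodic H"
    and "sigma_compact_space (topo H)"
    and "sigma_compact_space (topo G) \<or>
         (respects_compactness G \<and> realcompact_space (bohr_topology G))"
    and "AP_linear G H T" and "AP_isometry G H T"
    and "non_vanishing G H T" and "respects_unitary_reps G H T"
  shows "\<exists>H0 t \<gamma>. subgroup H0 H \<and> closedin (topo H) H0 \<and>
           t \<in> cont_hom (topsubgroup H H0) G \<and> t ` H0 = carrier G \<and>
           \<gamma> \<in> dual_group H \<and>
           (\<forall>h\<in>H0. \<forall>f\<in>AP G. T f h = \<gamma> h * f (t h))"
proof -
  have mG: "map_group G" using assms(1,5) by (simp add: map_group_def map_group_axioms_def)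
  interpret nonvanishing_map G H T
    using mG assms(2,9,11,12) by (simp add: nonvanishing_map_def nonvanishing_map_axioms_def)
  have LH: "Lindelof_space (topo H)" using assms(7) by (rule sigma_compact_imp_Lindelof)
  have "\<exists>x\<in>carrier G. \<forall>f\<in>AP G. \<phi> h f = f x" if "h \<in> carrier H" for h
    by (rule G.functional_is_evaluation[OF \<phi>_range_functional[OF that]]) (use assms(8) in blast)
  then obtain t where t: "\<And>h. h \<in> carrier H \<Longrightarrow> t h \<in> carrier G \<and> (\<forall>f\<in>AP G. \<phi> h f = f (t h))" by metis
  have tG: "t h \<in> carrier G" if "h \<in> carrier H" for h using t that by blast
  have te: "\<phi> h f = f (t h)" if "h \<in> carrier H" "f \<in> AP G" for h f using t that by blast
  have hom: "t \<in> hom H G" using tG te by (rule hom_from_evaluation)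
  have bc: "continuous_map (topo H) (bohr_topology G) t" using tG te by (rule bohr_continuous)
  have cont: "continuous_map (topo H) (topo G) t"
    using assms(8)
  proof
    assume "sigma_compact_space (topo G)"
    then have LG: "Lindelof_space (topo G)" by (rule sigma_compact_imp_Lindelof)
    show ?thesis
    proof (rule closed_preimage_imp_continuous_hom[OF assms(1-4) LG hom])
      fix C assume "compactin (topo G) C"
      then have "closedin (bohr_topology G) C" by (rule G.compactin_imp_closedin_bohr)
      from closedin_continuous_map_preimage[OF bc this]
      show "closedin (topo H) {h \<in> carrier H. t h \<in> C}" by (simp add: H.topspace_topo)
    qed
  next
    assume "respects_compactness G \<and> realcompact_space (bohr_topology G)"
    then show ?thesis using respects_compactness_continuous[OF mG assms(2,4) _ bc] by blast
  qed
  have onto: "t ` carrier H = carrier G"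
  proof (rule subset_antisym; rule subsetI)
    fix x assume x: "x \<in> carrier G"
    obtain h where h: "h \<in> carrier H" "\<forall>f\<in>AP G. \<phi> h f = f x" using evaluation_attained[OF LH x] by blast
    have "t h = x"
    proof (rule G.AP_separates[OF tG[OF h(1)] x])
      fix f assume f: "f \<in> AP G"
      have "f (t h) = \<phi> h f" by (rule te[OF h(1) f, symmetric])
      also have "\<dots> = f x" using h(2) f by (rule bspec)
      finally show "f (t h) = f x" .
    qed
    then show "x \<in> t ` carrier H" using h(1) by blast
  qed (use tG in blast)
  have ts: "topsubgroup H (carrier H) = H"
    using subtopology_topspace[of "topo H"] H.topspace_topo by (simp add: topsubgroup_def)
  show ?thesis
  proof (intro exI conjI ballI)
    show "subgroup (carrier H) H" by (rule H.subgroup_self)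
    show "closedin (topo H) (carrier H)" using closedin_topspace[of "topo H"] H.topspace_topo by simp
    show "t \<in> cont_hom (topsubgroup H (carrier H)) G" unfolding ts using hom cont by (simp add: cont_hom_def)
    show "t ` carrier H = carrier G" by (rule onto)
    show "\<gamma> \<in> dual_group H" by (rule \<gamma>_dual)
    show "T f h = \<gamma> h * f (t h)" if "h \<in> carrier H" "f \<in> AP G" for h f
      using T_\<phi>[OF that(1), of f] te[OF that] by simp
  qed
qed

end
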